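(* Let $k$ be a natural number. (1) Let $T$ be a theory in-between $\mathsf{HA}+\mathrm{LEM}(\Pi_{k-1})$ ($\mathsf{HA}$ if $k=0$) and $\mathsf{PA}$. Then $T\vdash\mathrm{DNE}(\Sigma_k)$ if and only if $\mathrm{PNFT}_T(\mathrm{E}_{k'}^{\lor\text{-free}},\Sigma_{k'})$ holds for all $k'\le k$. (2) Let $T$ be a theory in-between $\mathsf{HA}+\mathrm{LEM}(\Pi_{k-2})$ ($\mathsf{HA}$ if $k<2$) and $\mathsf{PA}$. Then $T\vdash\mathrm{DNE}(\Sigma_{k-1})$ if and only if $\mathrm{PNFT}_T(\mathrm{U}_{k'}^{\lor\text{-free}},\Pi_{k'})$ holds for all $k'\le k$.
   Context: $\mathsf{HA}$ is intuitionistic (Heyting) arithmetic in the language with function symbols for all primitive recursive functions and logical constants $\forall,\exists,\to,\land,\lor,\perp$; $\neg\varphi$ abbreviates $\varphi\to\perp$. $\mathsf{PA}$ is $\mathsf{HA}$ plus the law of excluded middle for all formulas. $S+\mathrm{P}$ adds all instances of schema $\mathrm{P}$ to $S$. A theory $T$ is in-between $S$ and $S'$ if it is a theory in the language of $\mathsf{HA}$ whose theorems include those of $S$ and are included in those of $S'$. $T\vdash\mathrm{P}$ means every instance of $\mathrm{P}$ is provable in $T$; a principle indexed by a negative number (e.g. $\mathrm{DNE}(\Sigma_{-1})$ when $k=0$) is vacuous. $\mathrm{FV}(\varphi)$ is the set of free variables. $\Sigma_0=\Pi_0$ are the quantifier-free formulas; $\Pi_{k+1}$: formulas $Q_1\bar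 x_1\cdots Q_{k+1}\bar x_{k+1}\varphi_{qf}$ ($Q_i=\forall$ for odd $i$, $\exists$ for even $i$); $\Sigma_{k+1}$ likewise starting with $\exists$ (blocks may be empty by the paper's convention). $\Gamma(x)$: formulas in $\Gamma$ with free variables among $x$. $\mathrm{LEM}(\Gamma)$: $\forall x(\varphi(x)\lor\neg\varphi(x))$, $\varphi(x)\in\Gamma(x)$; $\mathrm{DNE}(\Gamma)$: $\forall x(\neg\neg\varphi(x)\to\varphi(x))$, $\varphi(x)\in\Gamma(x)$. $\Gamma^{\lor\text{-free}}$ is the class of formulas in $\Gamma$ not containing $\lor$. $\mathrm{PNFT}_T(\Gamma,\Gamma')$: for every $\varphi\in\Gamma$ there is $\varphi'\in\Gamma'$ with $\mathrm{FV}(\varphi)=\mathrm{FV}(\varphi')$ and $T\vdash\varphi\leftrightarrow\varphi'$. Alternation paths: finite alternating sequences of $+,-$; $i(s)$ first symbol ($\times$ if empty), $s^\perp$ swaps signs, $l(s)$ length. $\mathrm{Alt}(\varphi)=\{\langle\rangle\}$ for quantifier-free $\varphi$; otherwise $\mathrm{Alt}(\neg\varphi_1)=\{s^\perp:s\in\mathrm{Alt}(\varphi_1)\}$, $\mathrm{Alt}(\varphi_1\land\varphi_2)=\mathrm{Alt}(\varphi_1\lor\varphi_2)=\mathrm{Alt}(\varphi_1)\cup\mathrm{Alt}(\varphi_2)$, $\mathrm{Alt}(\varphi_1\to\varphi_2)=\{s^\perp:s\in\mathrm{Alt}(\varphi_1)\}\cup\mathrm{Alt}(\varphi_2)$, $\mathrm{Alt}(\forall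 x\varphi_1)=\{s\in\mathrm{Alt}(\varphi_1):i(s)=-\}\cup\{-s:s\in\mathrm{Alt}(\varphi_1),i(s)\ne-\}$, $\mathrm{Alt}(\exists x\varphi_1)=\{s\in\mathrm{Alt}(\varphi_1):i(s)=+\}\cup\{+s:s\in\mathrm{Alt}(\varphi_1),i(s)\ne+\}$. $\deg\varphi=\max\{l(s):s\in\mathrm{Alt}(\varphi)\}$, $\mathrm{F}_k=\{\varphi:\deg\varphi=k\}$, $\mathrm{U}_0=\mathrm{E}_0=\mathrm{F}_0$, $\mathrm{U}_{k+1}=\{\varphi\in\mathrm{F}_{k+1}:i(s)=-$ for all $s\in\mathrm{Alt}(\varphi)$ with $l(s)=k+1\}$, $\mathrm{E}_{k+1}$ likewise with $+$. *)

theory Defs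
  imports Main
begin

text \<open>
  Symbols for primitive recursive functions. \<open>PComp n f gs\<close> is the \<open>n\<close>-ary composition; the
  arity is recorded because \<open>gs\<close> is empty when \<open>f\<close> is the constant \<open>PZero\<close>.
  \<open>PRec f g\<close> recurses on its first argument.
\<close>

datatype pr_fun = PZero | PSuc | PProj nat nat | PComp nat pr_fun "pr_fun list" | PRec pr_fun pr_fun

primrec arity :: "pr_fun \<Rightarrow> nat" where
  "arity PZero = 0"
| "arity PSuc = 1"
| "arity (PProj n i) = n"
| "arity (PComp n f gs) = n"
| "arity (PRec f g) = Suc (arity f)"

fun pr_wf :: "pr_fun \<Rightarrow> bool" where
  "pr_wf PZero \<longleftrightarrow> True"
| "pr_wf PSuc \<longleftrightarrow> True"
| "pr_wf (PProj n i) \<longleftrightarrow> i < n"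
| "pr_wf (PComp n f gs) \<longleftrightarrow>
     pr_wf f \<and> arity f = length gs \<and> (\<forall>g \<in> set gs. pr_wf g \<and> arity g = n)"
| "pr_wf (PRec f g) \<longleftrightarrow> pr_wf f \<and> pr_wf g \<and> arity g = arity f + 2"

text \<open>
  Variables are de Bruijn indices: \<open>Forall\<close> and \<open>Exists\<close> bind index 0 of their body.
\<close>

datatype tm = Var nat | Fn pr_fun "tm list"

datatype fm =
    Bot
  | Eq tm tm
  | Conj fm fm
  | Disj fm fm
  | Impl fm fm
  | Forall fm
  | Exists fm

abbreviation Neg :: "fm \<Rightarrow> fm" where
  "Neg \<phi> \<equiv> Impl \<phi> Bot"

abbreviation Iff :: "fm \<Rightarrow> fm \<Rightarrow> fm" where
  "Iff \<phi> \<psi> \<equiv> Conj (Impl \<phi> \<psi>) (Impl \<psi> \<phi>)"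

abbreviation zero :: tm where
  "zero \<equiv> Fn PZero []"

abbreviation succ :: "tm \<Rightarrow> tm" where
  "succ t \<equiv> Fn PSuc [t]"

fun tm_wf :: "tm \<Rightarrow> bool" where
  "tm_wf (Var n) \<longleftrightarrow> True"
| "tm_wf (Fn f ts) \<longleftrightarrow> pr_wf f \<and> length ts = arity f \<and> (\<forall>t \<in> set ts. tm_wf t)"

primrec fm_wf :: "fm \<Rightarrow> bool" where
  "fm_wf Bot \<longleftrightarrow> True"
| "fm_wf (Eq s t) \<longleftrightarrow> tm_wf s \<and> tm_wf t"
| "fm_wf (Conj \<phi> \<psi>) \<longleftrightarrow> fm_wf \<phi> \<and> fm_wf \<psi>"
| "fm_wf (Disj \<phi> \<psi>) \<longleftrightarrow> fm_wf \<phi> \<and> fm_wf \<psi>"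
| "fm_wf (Impl \<phi> \<psi>) \<longleftrightarrow> fm_wf \<phi> \<and> fm_wf \<psi>"
| "fm_wf (Forall \<phi>) \<longleftrightarrow> fm_wf \<phi>"
| "fm_wf (Exists \<phi>) \<longleftrightarrow> fm_wf \<phi>"

definition formulas :: "fm set" where
  "formulas = {\<phi>. fm_wf \<phi>}"

fun FV_tm :: "tm \<Rightarrow> nat set" where
  "FV_tm (Var n) = {n}"
| "FV_tm (Fn f ts) = (\<Union>t \<in> set ts. FV_tm t)"

primrec FV :: "fm \<Rightarrow> nat set" where
  "FV Bot = {}"
| "FV (Eq s t) = FV_tm s \<union> FV_tm t"
| "FV (Conj \<phi> \<psi>) = FV \<phi> \<union> FV \<psi>"
| "FV (Disj \<phi> \<psi>) = FV \<phi> \<union> FV \<psi>"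
| "FV (Impl \<phi> \<psi>) = FV \<phi> \<union> FV \<psi>"
| "FV (Forall \<phi>) = {n. Suc n \<in> FV \<phi>}"
| "FV (Exists \<phi>) = {n. Suc n \<in> FV \<phi>}"

fun subst_tm :: "(nat \<Rightarrow> tm) \<Rightarrow> tm \<Rightarrow> tm" where
  "subst_tm \<sigma> (Var n) = \<sigma> n"
| "subst_tm \<sigma> (Fn f ts) = Fn f (map (subst_tm \<sigma>) ts)"

definition up :: "(nat \<Rightarrow> tm) \<Rightarrow> nat \<Rightarrow> tm" where
  "up \<sigma> = case_nat (Var 0) (\<lambda>n. subst_tm (\<lambda>i. Var (Suc i)) (\<sigma> n))"

primrec subst :: "(nat \<Rightarrow> tm) \<Rightarrow> fm \<Rightarrow> fm" where
  "subst \<sigma> Bot = Bot"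
| "subst \<sigma> (Eq s t) = Eq (subst_tm \<sigma> s) (subst_tm \<sigma> t)"
| "subst \<sigma> (Conj \<phi> \<psi>) = Conj (subst \<sigma> \<phi>) (subst \<sigma> \<psi>)"
| "subst \<sigma> (Disj \<phi> \<psi>) = Disj (subst \<sigma> \<phi>) (subst \<sigma> \<psi>)"
| "subst \<sigma> (Impl \<phi> \<psi>) = Impl (subst \<sigma> \<phi>) (subst \<sigma> \<psi>)"
| "subst \<sigma> (Forall \<phi>) = Forall (subst (up \<sigma>) \<phi>)"
| "subst \<sigma> (Exists \<phi>) = Exists (subst (up \<sigma>) \<phi>)"

definition shift :: "fm \<Rightarrow> fm" where
  "shift = subst (\<lambda>i. Var (Suc i))"

definition inst :: "fm \<Rightarrow> tm \<Rightarrow> fm" where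
  "inst \<phi> t = subst (case_nat t Var) \<phi>"

text \<open>
  Natural deduction for intuitionistic predicate logic: \<open>deriv T \<Gamma> \<phi>\<close> says that \<open>\<phi>\<close> is derivable
  from the non-logical axioms \<open>T\<close> and the open assumptions \<open>\<Gamma>\<close>. The eigenvariable condition
  concerns \<open>\<Gamma>\<close> only, so an axiom with free variables amounts to its universal closure. The
  \<open>fm_wf\<close> and \<open>tm_wf\<close> premises keep derivations inside the language.
\<close>

inductive deriv :: "fm set \<Rightarrow> fm list \<Rightarrow> fm \<Rightarrow> bool" for T :: "fm set" where
  Axiom: "\<phi> \<in> T \<Longrightarrow> fm_wf \<phi> \<Longrightarrow> deriv T \<Gamma> \<phi>"
| Hyp: "\<phi> \<in> set \<Gamma> \<Longrightarrow> fm_wf \<phi> \<Longrightarrow> deriv T \<Gamma> \<phi>"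
| BotE: "deriv T \<Gamma> Bot \<Longrightarrow> fm_wf \<phi> \<Longrightarrow> deriv T \<Gamma> \<phi>"
| ConjI: "deriv T \<Gamma> \<phi> \<Longrightarrow> deriv T \<Gamma> \<psi> \<Longrightarrow> deriv T \<Gamma> (Conj \<phi> \<psi>)"
| ConjE1: "deriv T \<Gamma> (Conj \<phi> \<psi>) \<Longrightarrow> deriv T \<Gamma> \<phi>"
| ConjE2: "deriv T \<Gamma> (Conj \<phi> \<psi>) \<Longrightarrow> deriv T \<Gamma> \<psi>"
| DisjI1: "deriv T \<Gamma> \<phi> \<Longrightarrow> fm_wf \<psi> \<Longrightarrow> deriv T \<Gamma> (Disj \<phi> \<psi>)"
| DisjI2: "deriv T \<Gamma> \<psi> \<Longrightarrow> fm_wf \<phi> \<Longrightarrow> deriv T \<Gamma> (Disj \<phi> \<psi>)"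
| DisjE: "deriv T \<Gamma> (Disj \<phi> \<psi>) \<Longrightarrow> deriv T (\<phi> # \<Gamma>) \<chi> \<Longrightarrow> deriv T (\<psi> # \<Gamma>) \<chi> \<Longrightarrow> deriv T \<Gamma> \<chi>"
| ImplI: "deriv T (\<phi> # \<Gamma>) \<psi> \<Longrightarrow> fm_wf \<phi> \<Longrightarrow> deriv T \<Gamma> (Impl \<phi> \<psi>)"
| ImplE: "deriv T \<Gamma> (Impl \<phi> \<psi>) \<Longrightarrow> deriv T \<Gamma> \<phi> \<Longrightarrow> deriv T \<Gamma> \<psi>"
| ForallI: "deriv T (map shift \<Gamma>) \<phi> \<Longrightarrow> deriv T \<Gamma> (Forall \<phi>)"
| ForallE: "deriv T \<Gamma> (Forall \<phi>) \<Longrightarrow> tm_wf t \<Longrightarrow> deriv T \<Gamma> (inst \<phi> t)"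
| ExistsI: "deriv T \<Gamma> (inst \<phi> t) \<Longrightarrow> tm_wf t \<Longrightarrow> fm_wf \<phi> \<Longrightarrow> deriv T \<Gamma> (Exists \<phi>)"
| ExistsE: "deriv T \<Gamma> (Exists \<phi>) \<Longrightarrow> deriv T (\<phi> # map shift \<Gamma>) (shift \<psi>) \<Longrightarrow> deriv T \<Gamma> \<psi>"

definition proves :: "fm set \<Rightarrow> fm \<Rightarrow> bool" (infix "\<turnstile>" 50) where
  "T \<turnstile> \<phi> \<longleftrightarrow> deriv T [] \<phi>"

definition theorems :: "fm set \<Rightarrow> fm set" where
  "theorems T = {\<phi>. T \<turnstile> \<phi>}"

definition proves_all :: "fm set \<Rightarrow> fm set \<Rightarrow> bool" (infix "\<turnstile>\<^sub>S" 50) where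
  "T \<turnstile>\<^sub>S P \<longleftrightarrow> (\<forall>\<phi> \<in> P. T \<turnstile> \<phi>)"

inductive_set HA :: "fm set" where
  eq_refl: "tm_wf t \<Longrightarrow> Eq t t \<in> HA"
| eq_subst: "tm_wf s \<Longrightarrow> tm_wf t \<Longrightarrow> fm_wf \<phi> \<Longrightarrow>
    Impl (Eq s t) (Impl (inst \<phi> s) (inst \<phi> t)) \<in> HA"
| succ_not_zero: "tm_wf t \<Longrightarrow> Neg (Eq (succ t) zero) \<in> HA"
| succ_inj: "tm_wf s \<Longrightarrow> tm_wf t \<Longrightarrow> Impl (Eq (succ s) (succ t)) (Eq s t) \<in> HA"
| proj: "pr_wf (PProj n i) \<Longrightarrow> length ts = n \<Longrightarrow> \<forall>t \<in> set ts. tm_wf t \<Longrightarrow>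
    Eq (Fn (PProj n i) ts) (ts ! i) \<in> HA"
| comp: "pr_wf (PComp n f gs) \<Longrightarrow> length ts = n \<Longrightarrow> \<forall>t \<in> set ts. tm_wf t \<Longrightarrow>
    Eq (Fn (PComp n f gs) ts) (Fn f (map (\<lambda>g. Fn g ts) gs)) \<in> HA"
| rec_zero: "pr_wf (PRec f g) \<Longrightarrow> length ts = arity f \<Longrightarrow> \<forall>t \<in> set ts. tm_wf t \<Longrightarrow>
    Eq (Fn (PRec f g) (zero # ts)) (Fn f ts) \<in> HA"
| rec_succ: "pr_wf (PRec f g) \<Longrightarrow> length ts = arity f \<Longrightarrow> \<forall>t \<in> set ts. tm_wf t \<Longrightarrow> tm_wf s \<Longrightarrow>
    Eq (Fn (PRec f g) (succ s # ts)) (Fn g (s # Fn (PRec f g) (s # ts) # ts)) \<in> HA"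
| induction_ax: "fm_wf \<phi> \<Longrightarrow>
    Impl (inst \<phi> zero)
      (Impl (Forall (Impl \<phi> (subst (case_nat (succ (Var 0)) (\<lambda>i. Var (Suc i))) \<phi>)))
        (Forall \<phi>)) \<in> HA"

text \<open>
  In the schemata, a formula with free variables among the tuple \<open>x\<close> of length \<open>n\<close> is one whose
  free indices are below \<open>n\<close>, and \<open>\<forall>x\<close> is an \<open>n\<close>-fold \<open>Forall\<close>.
\<close>

definition LEM :: "fm set \<Rightarrow> fm set" where
  "LEM \<Gamma> = {(Forall ^^ n) (Disj \<phi> (Neg \<phi>)) | n \<phi>. \<phi> \<in> \<Gamma> \<and> FV \<phi> \<subseteq> {..<n}}"

definition DNE :: "fm set \<Rightarrow> fm set" where
  "DNE \<Gamma> = {(Forall ^^ n) (Impl (Neg (Neg \<phi>)) \<phi>) | n \<phi>. \<phi> \<in> \<Gamma> \<and> FV \<phi> \<subseteq> {..<n}}"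

definition PA :: "fm set" where
  "PA = HA \<union> LEM formulas"

definition in_between :: "fm set \<Rightarrow> fm set \<Rightarrow> fm set \<Rightarrow> bool" where
  "in_between S T S' \<longleftrightarrow>
     T \<subseteq> formulas \<and> theorems S \<subseteq> theorems T \<and> theorems T \<subseteq> theorems S'"

primrec qfree :: "fm \<Rightarrow> bool" where
  "qfree Bot \<longleftrightarrow> True"
| "qfree (Eq s t) \<longleftrightarrow> True"
| "qfree (Conj \<phi> \<psi>) \<longleftrightarrow> qfree \<phi> \<and> qfree \<psi>"
| "qfree (Disj \<phi> \<psi>) \<longleftrightarrow> qfree \<phi> \<and> qfree \<psi>"
| "qfree (Impl \<phi> \<psi>) \<longleftrightarrow> qfree \<phi> \<and> qfree \<psi>"
| "qfree (Forall \<phi>) \<longleftrightarrow> False"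
| "qfree (Exists \<phi>) \<longleftrightarrow> False"

fun Sigma_fm :: "nat \<Rightarrow> fm set" and Pi_fm :: "nat \<Rightarrow> fm set" where
  "Sigma_fm 0 = {\<phi> \<in> formulas. qfree \<phi>}"
| "Sigma_fm (Suc k) = {(Exists ^^ n) \<phi> | n \<phi>. \<phi> \<in> Pi_fm k}"
| "Pi_fm 0 = {\<phi> \<in> formulas. qfree \<phi>}"
| "Pi_fm (Suc k) = {(Forall ^^ n) \<phi> | n \<phi>. \<phi> \<in> Sigma_fm k}"

primrec disj_free :: "fm \<Rightarrow> bool" where
  "disj_free Bot \<longleftrightarrow> True"
| "disj_free (Eq s t) \<longleftrightarrow> True"
| "disj_free (Conj \<phi> \<psi>) \<longleftrightarrow> disj_free \<phi> \<and> disj_free \<psi>"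
| "disj_free (Disj \<phi> \<psi>) \<longleftrightarrow> False"
| "disj_free (Impl \<phi> \<psi>) \<longleftrightarrow> disj_free \<phi> \<and> disj_free \<psi>"
| "disj_free (Forall \<phi>) \<longleftrightarrow> disj_free \<phi>"
| "disj_free (Exists \<phi>) \<longleftrightarrow> disj_free \<phi>"

definition disj_free_part :: "fm set \<Rightarrow> fm set" where
  "disj_free_part \<Gamma> = {\<phi> \<in> \<Gamma>. disj_free \<phi>}"

datatype sign = Plus | Minus

primrec opp :: "sign \<Rightarrow> sign" where
  "opp Plus = Minus"
| "opp Minus = Plus"

definition perp :: "sign list \<Rightarrow> sign list" where
  "perp s = map opp s"

text \<open>The value \<open>None\<close> is the symbol \<open>\<times>\<close> for the empty path.\<close>

definition init_sign :: "sign list \<Rightarrow> sign option" where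
  "init_sign s = (case s of [] \<Rightarrow> None | c # _ \<Rightarrow> Some c)"

text \<open>
  The clause for negation takes precedence over the one for implication, and the clause for
  quantifier-free formulas over all others.
\<close>

primrec Alt :: "fm \<Rightarrow> sign list set" where
  "Alt Bot = {[]}"
| "Alt (Eq s t) = {[]}"
| "Alt (Conj \<phi> \<psi>) = (if qfree (Conj \<phi> \<psi>) then {[]} else Alt \<phi> \<union> Alt \<psi>)"
| "Alt (Disj \<phi> \<psi>) = (if qfree (Disj \<phi> \<psi>) then {[]} else Alt \<phi> \<union> Alt \<psi>)"
| "Alt (Impl \<phi> \<psi>) =
     (if qfree (Impl \<phi> \<psi>) then {[]}
      else if \<psi> = Bot then perp ` Alt \<phi>
      else perp ` Alt \<phi> \<union> Alt \<psi>)"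
| "Alt (Forall \<phi>) =
     {s \<in> Alt \<phi>. init_sign s = Some Minus} \<union>
     {Minus # s | s. s \<in> Alt \<phi> \<and> init_sign s \<noteq> Some Minus}"
| "Alt (Exists \<phi>) =
     {s \<in> Alt \<phi>. init_sign s = Some Plus} \<union>
     {Plus # s | s. s \<in> Alt \<phi> \<and> init_sign s \<noteq> Some Plus}"

definition deg :: "fm \<Rightarrow> nat" where
  "deg \<phi> = Max (length ` Alt \<phi>)"

definition F_class :: "nat \<Rightarrow> fm set" where
  "F_class k = {\<phi> \<in> formulas. deg \<phi> = k}"

fun U_class :: "nat \<Rightarrow> fm set" where
  "U_class 0 = F_class 0"
| "U_class (Suc k) =
     {\<phi> \<in> F_class (Suc k). \<forall>s \<in> Alt \<phi>. length s = Suc k \<longrightarrow> init_sign s = Some Minus}"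

fun E_class :: "nat \<Rightarrow> fm set" where
  "E_class 0 = F_class 0"
| "E_class (Suc k) =
     {\<phi> \<in> F_class (Suc k). \<forall>s \<in> Alt \<phi>. length s = Suc k \<longrightarrow> init_sign s = Some Plus}"

definition PNFT :: "fm set \<Rightarrow> fm set \<Rightarrow> fm set \<Rightarrow> bool" where
  "PNFT T \<Gamma> \<Gamma>' \<longleftrightarrow> (\<forall>\<phi> \<in> \<Gamma>. \<exists>\<phi>' \<in> \<Gamma>'. FV \<phi> = FV \<phi>' \<and> T \<turnstile> Iff \<phi> \<phi>')"

end

theory Submission
  imports Defs
begin

text \<open>
  If \<open>DNE(\<Sigma>\<^sub>j)\<close> holds for \<open>j < k\<close>, structural induction on a \<open>\<or>\<close>-free formula turns members of
  \<open>U\<^sub>k\<close> into equivalent \<open>\<Pi>\<^sub>k\<close> formulas, and members of \<open>E\<^sub>k\<close> into \<open>\<Sigma>\<^sub>k\<close> formulas with an equivalent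
  negation; under \<open>DNE(\<Sigma>\<^sub>k)\<close> the latter become equivalent as well. The critical step is that
  \<open>\<forall>x \<phi> \<rightarrow> \<psi>\<close> and \<open>\<exists>x (\<phi> \<rightarrow> \<psi>)\<close> have equivalent negations when \<open>\<phi>\<close> is stable.

  Conversely, let \<open>\<phi>\<close> be a \<open>\<Sigma>\<^sub>k\<close> formula. A prenex normal form \<open>\<psi>\<close> of \<open>\<not>\<not>\<phi>\<close> (or of \<open>\<forall>y \<not>\<not>\<phi>\<close>, with
  \<open>y\<close> not free in \<open>\<phi>\<close>) satisfies \<open>\<psi> \<rightarrow> \<phi>\<close> in \<open>PA\<close>. Apply the negative translation with falsity
  replaced by \<open>\<phi>\<close>: every prenex formula implies its translation, and the translation of \<open>\<phi>\<close> implies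
  \<open>\<phi>\<close> as soon as the formulas in \<open>\<Sigma>\<^sub>k\<^sub>-\<^sub>1\<close> and \<open>\<Pi>\<^sub>k\<^sub>-\<^sub>1\<close> are decidable, which follows from
  \<open>LEM(\<Pi>\<^sub>k\<^sub>-\<^sub>1)\<close> and \<open>DNE(\<Sigma>\<^sub>k\<^sub>-\<^sub>1)\<close>. Hence the theory itself proves \<open>\<not>\<not>\<phi> \<rightarrow> \<phi>\<close>.
\<close>

section \<open>Substitution and derivations\<close>

text \<open>Intuitionistically a double negation cannot be pushed out through \<forall>, so a
  formula known only up to its negation is useless below a universal quantifier. Hence the
  asymmetry: E formulas are tracked up to equivalent negations, U formulas up to equivalence. The
  two notions meet at implications: a U implication has an E antecedent, and its consequent, stable
  by DNE one level lower, sees the antecedent only through its negation. The converse climbs a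
  ladder: DNE(Sigma_j) with LEM(Pi_j) decides Sigma_j and Pi_j, which is what it takes to undo the
  translation of a Sigma_(j+1) formula \<phi>. Its leading existential block costs nothing, because
  falsity has become \<phi> itself. Prenex form is needed since a formula must imply its own
  translation; for \<not>\<not>\<phi> itself this would already be the goal \<not>\<not>\<phi>
  \<rightarrow> \<phi>. The classes demand an exact degree and forbid \<or> even in the matrix,
  whereas Sigma_k formulas may have empty blocks and disjunctions; dummy quantifiers and De Morgan
  for decidable matrices bridge this gap.\<close>

lemma subst_tm_cong: "(\<And>i. i \<in> FV_tm t \<Longrightarrow> \<sigma> i = \<tau> i) \<Longrightarrow> subst_tm \<sigma> t = subst_tm \<tau> t"
  by (induction t rule: FV_tm.induct) auto

lemma up_simps [simp]: "up \<sigma> 0 = Var 0" "up \<sigma> (Suc n) = subst_tm (\<lambda>i. Var (Suc i)) (\<sigma> n)"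
  by (simp_all add: up_def)

lemma subst_cong: "(\<And>i. i \<in> FV \<phi> \<Longrightarrow> \<sigma> i = \<tau> i) \<Longrightarrow> subst \<sigma> \<phi> = subst \<tau> \<phi>"
proof (induction \<phi> arbitrary: \<sigma> \<tau>)
  case (Forall \<phi>)
  have "up \<sigma> i = up \<tau> i" if "i \<in> FV \<phi>" for i
    using that Forall.prems by (cases i) auto
  from Forall.IH[OF this] show ?case by simp
next
  case (Exists \<phi>)
  have "up \<sigma> i = up \<tau> i" if "i \<in> FV \<phi>" for i
    using that Exists.prems by (cases i) auto
  from Exists.IH[OF this] show ?case by simp
next
  case (Eq s t)
  have "subst_tm \<sigma> s = subst_tm \<tau> s" "subst_tm \<sigma> t = subst_tm \<tau> t"
    using Eq.prems by (auto intro!: subst_tm_cong)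
  then show ?case by simp
next
  case (Conj \<phi>1 \<phi>2)
  show ?case using Conj.IH[of \<sigma> \<tau>] Conj.prems by simp
next
  case (Disj \<phi>1 \<phi>2)
  show ?case using Disj.IH[of \<sigma> \<tau>] Disj.prems by simp
next
  case (Impl \<phi>1 \<phi>2)
  show ?case using Impl.IH[of \<sigma> \<tau>] Impl.prems by simp
qed simp

lemma subst_tm_subst_tm: "subst_tm \<sigma> (subst_tm \<tau> t) = subst_tm (\<lambda>i. subst_tm \<sigma> (\<tau> i)) t"
  by (induction t rule: FV_tm.induct) auto

lemma subst_tm_Var [simp]: "subst_tm Var t = t"
  by (induction t rule: FV_tm.induct) (auto intro: map_idI)

lemma up_comp: "(\<lambda>i. subst_tm (up \<sigma>) (up \<tau> i)) = up (\<lambda>i. subst_tm \<sigma> (\<tau> i))"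
proof
  fix i show "subst_tm (up \<sigma>) (up \<tau> i) = up (\<lambda>i. subst_tm \<sigma> (\<tau> i)) i"
    by (cases i) (simp_all add: subst_tm_subst_tm)
qed

lemma subst_subst: "subst \<sigma> (subst \<tau> \<phi>) = subst (\<lambda>i. subst_tm \<sigma> (\<tau> i)) \<phi>"
  by (induction \<phi> arbitrary: \<sigma> \<tau>) (simp_all add: subst_tm_subst_tm up_comp)

lemma up_Var: "up Var = Var"
proof
  fix i show "up Var i = Var i" by (cases i) simp_all
qed

lemma subst_Var [simp]: "subst Var \<phi> = \<phi>"
  by (induction \<phi>) (simp_all add: up_Var)

lemma inst_shift [simp]: "inst (shift \<phi>) t = \<phi>"
  by (simp add: inst_def shift_def subst_subst)

lemma inst_shift_tm [simp]:
  "subst_tm (case_nat t Var) (subst_tm (\<lambda>i. Var (Suc i)) s) = s"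
  by (simp add: subst_tm_subst_tm)

lemma subst_up_shift: "subst (up \<sigma>) (shift \<phi>) = shift (subst \<sigma> \<phi>)"
  by (simp add: shift_def subst_subst)

lemma subst_inst: "subst \<sigma> (inst \<phi> t) = inst (subst (up \<sigma>) \<phi>) (subst_tm \<sigma> t)"
proof -
  have "(\<lambda>i. subst_tm \<sigma> (case_nat t Var i)) =
        (\<lambda>i. subst_tm (case_nat (subst_tm \<sigma> t) Var) (up \<sigma> i))"
  proof
    fix i show "subst_tm \<sigma> (case_nat t Var i) = subst_tm (case_nat (subst_tm \<sigma> t) Var) (up \<sigma> i)"
      by (cases i) simp_all
  qed
  then show ?thesis by (simp add: inst_def subst_subst)
qed

lemma inst_simps [simp]:
  "inst Bot t = Bot"
  "inst (Eq r s) t = Eq (subst_tm (case_nat t Var) r) (subst_tm (case_nat t Var) s)"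
  "inst (Conj \<phi> \<psi>) t = Conj (inst \<phi> t) (inst \<psi> t)"
  "inst (Disj \<phi> \<psi>) t = Disj (inst \<phi> t) (inst \<psi> t)"
  "inst (Impl \<phi> \<psi>) t = Impl (inst \<phi> t) (inst \<psi> t)"
  by (simp_all add: inst_def)

lemma shift_simps [simp]:
  "shift Bot = Bot"
  "shift (Conj \<phi> \<psi>) = Conj (shift \<phi>) (shift \<psi>)"
  "shift (Disj \<phi> \<psi>) = Disj (shift \<phi>) (shift \<psi>)"
  "shift (Impl \<phi> \<psi>) = Impl (shift \<phi>) (shift \<psi>)"
  by (simp_all add: shift_def)

lemma tm_wf_subst: "(\<And>i. tm_wf (\<sigma> i)) \<Longrightarrow> tm_wf (subst_tm \<sigma> t) = tm_wf t"
  by (induction t rule: FV_tm.induct) auto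

lemma tm_wf_up: "(\<And>i. tm_wf (\<sigma> i)) \<Longrightarrow> tm_wf (up \<sigma> i)"
  by (cases i) (simp_all add: tm_wf_subst)

lemma fm_wf_subst: "(\<And>i. tm_wf (\<sigma> i)) \<Longrightarrow> fm_wf (subst \<sigma> \<phi>) = fm_wf \<phi>"
proof (induction \<phi> arbitrary: \<sigma>)
  case (Forall \<phi>)
  then show ?case using tm_wf_up[of \<sigma>] by simp
next
  case (Exists \<phi>)
  then show ?case using tm_wf_up[of \<sigma>] by simp
qed (simp_all add: tm_wf_subst)

lemma fm_wf_shift [simp]: "fm_wf (shift \<phi>) = fm_wf \<phi>"
  by (simp add: shift_def fm_wf_subst)

lemma tm_wf_case_nat: "tm_wf t \<Longrightarrow> tm_wf (case_nat t Var i)"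
  by (cases i) simp_all

lemma fm_wf_inst [simp]: "tm_wf t \<Longrightarrow> fm_wf (inst \<phi> t) = fm_wf \<phi>"
  unfolding inst_def by (rule fm_wf_subst) (rule tm_wf_case_nat)

lemma FV_tm_shift: "FV_tm (subst_tm (\<lambda>i. Var (f i)) t) = f ` FV_tm t"
  by (induction t rule: FV_tm.induct) auto

text \<open>Lifting a renaming gives a renaming again, which keeps the induction for
  \<open>FV_rename\<close> within renamings.\<close>

lemma up_rename: "up (\<lambda>i. Var (f i)) = (\<lambda>i. Var (case_nat 0 (\<lambda>n. Suc (f n)) i))"
proof
  fix i show "up (\<lambda>i. Var (f i)) i = Var (case_nat 0 (\<lambda>n. Suc (f n)) i)"
    by (cases i) simp_all
qed

lemma FV_rename: "FV (subst (\<lambda>i. Var (f i)) \<phi>) = f ` FV \<phi>"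
proof (induction \<phi> arbitrary: f)
  case (Forall \<phi>)
  have "{n. Suc n \<in> case_nat 0 (\<lambda>n. Suc (f n)) ` X} = f ` {n. Suc n \<in> X}" for X
    by (force split: nat.splits intro: rev_image_eqI)
  then show ?case by (simp add: up_rename Forall.IH)
next
  case (Exists \<phi>)
  have "{n. Suc n \<in> case_nat 0 (\<lambda>n. Suc (f n)) ` X} = f ` {n. Suc n \<in> X}" for X
    by (force split: nat.splits intro: rev_image_eqI)
  then show ?case by (simp add: up_rename Exists.IH)
qed (simp_all add: FV_tm_shift image_Un)

lemma FV_shift [simp]: "FV (shift \<phi>) = Suc ` FV \<phi>"
  by (simp add: shift_def FV_rename)

lemma finite_FV_tm [simp]: "finite (FV_tm t)"
  by (induction t rule: FV_tm.induct) auto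

lemma finite_FV [simp]: "finite (FV \<phi>)"
proof (induction \<phi>)
  case (Forall \<phi>)
  then show ?case by (simp add: finite_vimageI[of _ Suc, unfolded vimage_def])
next
  case (Exists \<phi>)
  then show ?case by (simp add: finite_vimageI[of _ Suc, unfolded vimage_def])
qed auto

section \<open>Derivations: weakening, universal closures, closure under substitution\<close>

lemma deriv_fm_wf: "deriv T \<Gamma> \<phi> \<Longrightarrow> fm_wf \<phi>"
  by (induction rule: deriv.induct) auto

lemma deriv_weaken: "deriv T \<Gamma> \<phi> \<Longrightarrow> set \<Gamma> \<subseteq> set \<Delta> \<Longrightarrow> deriv T \<Delta> \<phi>"
proof (induction arbitrary: \<Delta> rule: deriv.induct)
  case (DisjE \<Gamma> \<phi> \<psi> \<chi>)
  show ?case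
    by (rule deriv.DisjE[OF DisjE.IH(1) DisjE.IH(2) DisjE.IH(3)]) (use DisjE.prems in auto)
next
  case (ImplI \<phi> \<Gamma> \<psi>)
  show ?case
    by (rule deriv.ImplI[OF ImplI.IH]) (use ImplI in auto)
next
  case (ForallI \<Gamma> \<phi>)
  show ?case
    by (rule deriv.ForallI[OF ForallI.IH]) (use ForallI.prems in auto)
next
  case (ExistsE \<Gamma> \<phi> \<psi>)
  show ?case
    by (rule deriv.ExistsE[OF ExistsE.IH(1) ExistsE.IH(2)]) (use ExistsE.prems in auto)
qed (auto intro: deriv.intros)

lemma Forall_power_intro: "(\<And>\<Gamma>. deriv T \<Gamma> \<phi>) \<Longrightarrow> deriv T \<Gamma> ((Forall ^^ n) \<phi>)"
  by (induction n arbitrary: \<Gamma>) (auto intro: deriv.ForallI)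

lemma subst_Forall_power: "subst \<sigma> ((Forall ^^ n) \<phi>) = (Forall ^^ n) (subst ((up ^^ n) \<sigma>) \<phi>)"
  by (induction n arbitrary: \<sigma>) (simp_all, simp add: funpow_swap1)

lemma subst_Exists_power: "subst \<sigma> ((Exists ^^ n) \<phi>) = (Exists ^^ n) (subst ((up ^^ n) \<sigma>) \<phi>)"
  by (induction n arbitrary: \<sigma>) (simp_all, simp add: funpow_swap1)

lemma up_power:
  "(up ^^ n) \<sigma> i = (if i < n then Var i else subst_tm (\<lambda>j. Var (j + n)) (\<sigma> (i - n)))"
proof (induction n arbitrary: i)
  case 0
  then show ?case by simp
next
  case (Suc n)
  show ?case
    by (cases i) (simp_all add: Suc.IH subst_tm_subst_tm)
qed

lemma Forall_power_elim:
  "deriv T \<Gamma> ((Forall ^^ n) \<phi>) \<Longrightarrow> \<forall>i. tm_wf (\<tau> i) \<Longrightarrow>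
   deriv T \<Gamma> (subst (\<lambda>i. if i < n then \<tau> i else Var (i - n)) \<phi>)"
proof (induction n arbitrary: \<phi>)
  case 0
  then show ?case by simp
next
  case (Suc n)
  \<comment> \<open>The outermost of the \<open>Suc n\<close> quantifiers binds index
    \<open>n\<close> of the body, so it is instantiated first, with \<open>\<tau> n\<close>; the
    lift by \<open>n\<close> is undone when the inner indices are replaced.\<close>
  let ?\<rho> = "(up ^^ n) (case_nat (\<tau> n) Var)"
  have "deriv T \<Gamma> (inst ((Forall ^^ n) \<phi>) (\<tau> n))"
    using Suc.prems by (intro deriv.ForallE) simp_all
  then have "deriv T \<Gamma> ((Forall ^^ n) (subst ?\<rho> \<phi>))"
    by (simp add: inst_def subst_Forall_power)
  from Suc.IH[OF this Suc.prems(2)]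
  have "deriv T \<Gamma> (subst (\<lambda>i. subst_tm (\<lambda>i. if i < n then \<tau> i else Var (i - n)) (?\<rho> i)) \<phi>)"
    by (simp add: subst_subst)
  moreover have "subst_tm (\<lambda>i. if i < n then \<tau> i else Var (i - n)) (?\<rho> i) =
      (if i < Suc n then \<tau> i else Var (i - Suc n))" for i
    by (auto simp: up_power subst_tm_subst_tm less_Suc_eq split: nat.split)
  ultimately show ?case by simp
qed

lemma Forall_power_elim_closed:
  assumes "deriv T \<Gamma> ((Forall ^^ n) \<phi>)" "FV \<phi> \<subseteq> {..<n}" "\<forall>i. tm_wf (\<sigma> i)"
  shows "deriv T \<Gamma> (subst \<sigma> \<phi>)"
proof -
  have "subst \<sigma> \<phi> = subst (\<lambda>i. if i < n then \<sigma> i else Var (i - n)) \<phi>"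
    using assms(2) by (intro subst_cong) auto
  then show ?thesis using Forall_power_elim[OF assms(1,3)] by simp
qed

lemma FV_bounded: obtains n where "FV \<phi> \<subseteq> {..<n}"
  using finite_nat_set_iff_bounded[of "FV \<phi>"] by auto

text \<open>The axiom set \<open>T\<close> is arbitrary and need not be closed under substitution.
  The detour through the universal closure and its instances gives closure for theorems, and this
  covers the axiom case of \<open>deriv_subst\<close>.\<close>

lemma theorem_subst:
  assumes "deriv T [] \<phi>" "\<forall>i. tm_wf (\<sigma> i)"
  shows "deriv T \<Gamma> (subst \<sigma> \<phi>)"
proof -
  obtain n where n: "FV \<phi> \<subseteq> {..<n}" by (rule FV_bounded)
  have "deriv T \<Gamma> ((Forall ^^ n) \<phi>)"
    by (rule Forall_power_intro) (rule deriv_weaken[OF assms(1)], simp)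
  then show ?thesis by (rule Forall_power_elim_closed[OF _ n assms(2)])
qed

lemma theorem_inst: "deriv T [] \<phi> \<Longrightarrow> tm_wf t \<Longrightarrow> deriv T \<Gamma> (inst \<phi> t)"
  unfolding inst_def by (erule theorem_subst) (simp add: tm_wf_case_nat)

lemma deriv_subst:
  "deriv T \<Gamma> \<phi> \<Longrightarrow> \<forall>i. tm_wf (\<sigma> i) \<Longrightarrow> deriv T (map (subst \<sigma>) \<Gamma>) (subst \<sigma> \<phi>)"
proof (induction arbitrary: \<sigma> rule: deriv.induct)
  case (Axiom \<phi> \<Gamma>)
  then show ?case by (auto intro: theorem_subst deriv.Axiom)
next
  case (DisjE \<Gamma> \<phi> \<psi> \<chi>)
  show ?case
    using deriv.DisjE[OF DisjE.IH(1)[OF DisjE.prems, simplified]] DisjE.IH(2,3)[OF DisjE.prems]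
    by simp
next
  case (ForallI \<Gamma> \<phi>)
  from ForallI.IH[of "up \<sigma>"] ForallI.prems
  show ?case by (auto intro!: deriv.ForallI simp: comp_def subst_up_shift tm_wf_up)
next
  case (ForallE \<Gamma> \<phi> t)
  show ?case
    using deriv.ForallE[OF ForallE.IH[OF ForallE.prems, simplified], of "subst_tm \<sigma> t"] ForallE
    by (simp add: subst_inst tm_wf_subst)
next
  case (ExistsI \<Gamma> \<phi> t)
  show ?case
    using deriv.ExistsI[OF ExistsI.IH[OF ExistsI.prems, unfolded subst_inst]] ExistsI
    by (simp add: tm_wf_subst fm_wf_subst tm_wf_up)
next
  case (ExistsE \<Gamma> \<phi> \<psi>)
  show ?case
    using deriv.ExistsE[OF ExistsE.IH(1)[OF ExistsE.prems, simplified]] ExistsE.IH(2)[of "up \<sigma>"]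
      ExistsE.prems
    by (simp add: comp_def subst_up_shift tm_wf_up)
qed (auto intro: deriv.intros simp: fm_wf_subst)

text \<open>
  The rules for implication, disjunction and the quantifiers in the style of Kripke semantics: contexts
  are worlds, and the terms are the domain at every world, because a fresh variable is generic.
\<close>

lemma fresh_rename:
  assumes "n \<notin> FV \<phi>"
  shows "subst (\<lambda>i. if i = n then Var 0 else Var (Suc i)) \<phi> = shift \<phi>"
  unfolding shift_def using assms by (intro subst_cong) auto

text \<open>The renaming sends the fresh variable \<open>n\<close> back to the bound index 0 and so
  undoes the instantiation. Inside the body of a quantifier the outer index \<open>n\<close> is
  \<open>Suc n\<close>, whence the form of the hypothesis.\<close>

lemma fresh_rename_inst:
  assumes "Suc n \<notin> FV \<phi>"
  shows "subst (\<lambda>i. if i = n then Var 0 else Var (Suc i)) (inst \<phi> (Var n)) = \<phi>"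
proof -
  have "subst (\<lambda>i. if i = n then Var 0 else Var (Suc i)) (inst \<phi> (Var n)) = subst Var \<phi>"
    unfolding inst_def subst_subst
    by (rule subst_cong) (use assms in \<open>auto split: nat.split\<close>)
  then show ?thesis by simp
qed

lemma fresh_variable: "\<exists>n. \<forall>\<phi> \<in> set \<Gamma>. n \<notin> FV \<phi>"
  using infinite_UNIV_nat ex_new_if_finite[of "\<Union> (FV ` set \<Gamma>)"] by auto

lemma ForallI_all_terms:
  assumes "\<And>t. tm_wf t \<Longrightarrow> deriv T \<Gamma> (inst \<phi> t)"
  shows "deriv T \<Gamma> (Forall \<phi>)"
proof -
  \<comment> \<open>Freshness for \<open>Forall \<phi>\<close>, rather than for
    \<open>\<phi>\<close>, is exactly \<open>Suc n \<notin> FV \<phi>\<close>.\<close>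
  obtain n where n: "\<forall>\<psi> \<in> set (Forall \<phi> # \<Gamma>). n \<notin> FV \<psi>"
    using fresh_variable[of "Forall \<phi> # \<Gamma>"] ..
  let ?\<sigma> = "\<lambda>i. if i = n then Var 0 else Var (Suc i)"
  have "deriv T (map (subst ?\<sigma>) \<Gamma>) (subst ?\<sigma> (inst \<phi> (Var n)))"
    by (rule deriv_subst[OF assms]) auto
  moreover have "map (subst ?\<sigma>) \<Gamma> = map shift \<Gamma>"
    using n by (auto intro: fresh_rename)
  ultimately show ?thesis
    using n by (auto intro: deriv.ForallI simp: fresh_rename_inst)
qed

lemma ExistsE_all_terms:
  assumes "deriv T \<Gamma> (Exists \<phi>)"
    and "\<And>t \<Delta>. tm_wf t \<Longrightarrow> set \<Gamma> \<subseteq> set \<Delta> \<Longrightarrow> deriv T \<Delta> (inst \<phi> t) \<Longrightarrow> deriv T \<Delta> \<psi>"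
  shows "deriv T \<Gamma> \<psi>"
proof -
  obtain n where n: "\<forall>\<chi> \<in> set (Forall \<phi> # \<psi> # \<Gamma>). n \<notin> FV \<chi>"
    using fresh_variable[of "Forall \<phi> # \<psi> # \<Gamma>"] ..
  let ?\<sigma> = "\<lambda>i. if i = n then Var 0 else Var (Suc i)"
  have wf: "fm_wf \<phi>" using deriv_fm_wf[OF assms(1)] by simp
  \<comment> \<open>A single generic instance suffices; renaming turns it into the premise of the
    elimination rule.\<close>
  have "deriv T (inst \<phi> (Var n) # \<Gamma>) \<psi>"
    by (rule assms(2)[of "Var n"]) (auto intro: deriv.Hyp simp: wf)
  from deriv_subst[OF this, of ?\<sigma>]
  have "deriv T (map (subst ?\<sigma>) (inst \<phi> (Var n) # \<Gamma>)) (subst ?\<sigma> \<psi>)"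
    by auto
  moreover have "map (subst ?\<sigma>) \<Gamma> = map shift \<Gamma>"
    using n by (auto intro: fresh_rename)
  ultimately show ?thesis
    using n deriv.ExistsE[OF assms(1)]
    by (simp add: fresh_rename_inst fresh_rename)
qed

lemma ImplI_worlds:
  assumes "fm_wf \<phi>" "\<And>\<Delta>. set \<Gamma> \<subseteq> set \<Delta> \<Longrightarrow> deriv T \<Delta> \<phi> \<Longrightarrow> deriv T \<Delta> \<psi>"
  shows "deriv T \<Gamma> (Impl \<phi> \<psi>)"
  by (rule deriv.ImplI[OF assms(2) assms(1)]) (auto intro: deriv.Hyp assms(1))

lemma DisjE_worlds:
  assumes "deriv T \<Gamma> (Disj \<phi> \<psi>)"
    and "\<And>\<Delta>. set \<Gamma> \<subseteq> set \<Delta> \<Longrightarrow> deriv T \<Delta> \<phi> \<Longrightarrow> deriv T \<Delta> \<chi>"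
    and "\<And>\<Delta>. set \<Gamma> \<subseteq> set \<Delta> \<Longrightarrow> deriv T \<Delta> \<psi> \<Longrightarrow> deriv T \<Delta> \<chi>"
  shows "deriv T \<Gamma> \<chi>"
proof -
  have "fm_wf \<phi>" "fm_wf \<psi>" using deriv_fm_wf[OF assms(1)] by simp_all
  then show ?thesis
    by (intro deriv.DisjE[OF assms(1)] assms(2,3)) (auto intro: deriv.Hyp)
qed

section \<open>Entailment and weak equivalence\<close>

lemma deriv_Conj_iff: "deriv T \<Gamma> (Conj \<phi> \<psi>) \<longleftrightarrow> deriv T \<Gamma> \<phi> \<and> deriv T \<Gamma> \<psi>"
  by (auto intro: deriv.intros)

lemma deriv_Impl_iff:
  "fm_wf \<phi> \<Longrightarrow> deriv T \<Gamma> (Impl \<phi> \<psi>) \<longleftrightarrow>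
     (\<forall>\<Delta>. set \<Gamma> \<subseteq> set \<Delta> \<longrightarrow> deriv T \<Delta> \<phi> \<longrightarrow> deriv T \<Delta> \<psi>)"
  by (metis ImplI_worlds deriv.ImplE deriv_weaken)

lemma deriv_Forall_iff: "deriv T \<Gamma> (Forall \<phi>) \<longleftrightarrow> (\<forall>t. tm_wf t \<longrightarrow> deriv T \<Gamma> (inst \<phi> t))"
  by (metis ForallI_all_terms deriv.ForallE)

lemma deriv_absurd: "deriv T \<Gamma> (Neg \<phi>) \<Longrightarrow> deriv T \<Gamma> \<phi> \<Longrightarrow> fm_wf \<psi> \<Longrightarrow> deriv T \<Gamma> \<psi>"
  by (metis deriv.BotE deriv.ImplE)

text \<open>The inhabitant of the domain, needed to remove vacuous quantifiers and to supply
  arbitrary witnesses.\<close>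

lemma tm_wf_zero: "tm_wf zero"
  by simp

text \<open>Consequence at every context, read as a world. Well-formedness is built in so that this
  coincides with provability of the implication.\<close>

definition entails :: "fm set \<Rightarrow> fm \<Rightarrow> fm \<Rightarrow> bool" where
  "entails T \<phi> \<psi> \<longleftrightarrow> fm_wf \<phi> \<and> fm_wf \<psi> \<and> (\<forall>\<Gamma>. deriv T \<Gamma> \<phi> \<longrightarrow> deriv T \<Gamma> \<psi>)"

definition eqv :: "fm set \<Rightarrow> fm \<Rightarrow> fm \<Rightarrow> bool" where
  "eqv T \<phi> \<psi> \<longleftrightarrow> entails T \<phi> \<psi> \<and> entails T \<psi> \<phi>"

text \<open>Equivalently, the double negations are equivalent. This is what survives when
  quantifiers are pulled out of an implication to the Sigma side.\<close>

definition weqv :: "fm set \<Rightarrow> fm \<Rightarrow> fm \<Rightarrow> bool" where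
  "weqv T \<phi> \<psi> \<longleftrightarrow> eqv T (Neg \<phi>) (Neg \<psi>)"

definition stable :: "fm set \<Rightarrow> fm \<Rightarrow> bool" where
  "stable T \<phi> \<longleftrightarrow> entails T (Neg (Neg \<phi>)) \<phi>"

definition decidable :: "fm set \<Rightarrow> fm \<Rightarrow> bool" where
  "decidable T \<phi> \<longleftrightarrow> deriv T [] (Disj \<phi> (Neg \<phi>))"

lemma entailsI:
  "fm_wf \<phi> \<Longrightarrow> fm_wf \<psi> \<Longrightarrow> (\<And>\<Gamma>. deriv T \<Gamma> \<phi> \<Longrightarrow> deriv T \<Gamma> \<psi>) \<Longrightarrow> entails T \<phi> \<psi>"
  by (simp add: entails_def)

lemma entailsD: "entails T \<phi> \<psi> \<Longrightarrow> deriv T \<Gamma> \<phi> \<Longrightarrow> deriv T \<Gamma> \<psi>"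
  by (simp add: entails_def)

lemma entails_refl: "fm_wf \<phi> \<Longrightarrow> entails T \<phi> \<phi>"
  by (simp add: entails_def)

lemma entails_trans: "entails T \<phi> \<psi> \<Longrightarrow> entails T \<psi> \<chi> \<Longrightarrow> entails T \<phi> \<chi>"
  by (simp add: entails_def)

lemma entails_iff_theorem: "entails T \<phi> \<psi> \<longleftrightarrow> T \<turnstile> Impl \<phi> \<psi>"
proof
  assume "entails T \<phi> \<psi>"
  then show "T \<turnstile> Impl \<phi> \<psi>"
    by (auto simp: entails_def proves_def intro: ImplI_worlds)
next
  assume "T \<turnstile> Impl \<phi> \<psi>"
  then have d: "deriv T [] (Impl \<phi> \<psi>)" by (simp add: proves_def)
  show "entails T \<phi> \<psi>"
    using deriv_fm_wf[OF d] deriv_weaken[OF d] by (auto intro!: entailsI intro: deriv.ImplE)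
qed

lemma eqv_iff_theorem: "eqv T \<phi> \<psi> \<longleftrightarrow> T \<turnstile> Iff \<phi> \<psi>"
  by (simp add: eqv_def entails_iff_theorem) (simp add: proves_def deriv_Conj_iff)

lemma entails_inst:
  assumes "entails T \<phi> \<psi>" "tm_wf t"
  shows "entails T (inst \<phi> t) (inst \<psi> t)"
  using theorem_inst[of T "Impl \<phi> \<psi>" t "[]"] assms
  by (simp add: entails_iff_theorem proves_def)

lemma entails_wf: "entails T \<phi> \<psi> \<Longrightarrow> fm_wf \<phi>" "entails T \<phi> \<psi> \<Longrightarrow> fm_wf \<psi>"
  by (simp_all add: entails_def)

lemma eqv_wf: "eqv T \<phi> \<psi> \<Longrightarrow> fm_wf \<phi>" "eqv T \<phi> \<psi> \<Longrightarrow> fm_wf \<psi>"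
  by (simp_all add: eqv_def entails_def)

lemma eqvD: "eqv T \<phi> \<psi> \<Longrightarrow> deriv T \<Gamma> \<phi> \<longleftrightarrow> deriv T \<Gamma> \<psi>"
  by (auto simp: eqv_def entails_def)

lemma eqvI:
  "fm_wf \<phi> \<Longrightarrow> fm_wf \<psi> \<Longrightarrow> (\<And>\<Gamma>. deriv T \<Gamma> \<phi> \<Longrightarrow> deriv T \<Gamma> \<psi>) \<Longrightarrow>
   (\<And>\<Gamma>. deriv T \<Gamma> \<psi> \<Longrightarrow> deriv T \<Gamma> \<phi>) \<Longrightarrow> eqv T \<phi> \<psi>"
  by (simp add: eqv_def entails_def)

lemma eqv_refl: "fm_wf \<phi> \<Longrightarrow> eqv T \<phi> \<phi>"
  by (simp add: eqv_def entails_refl)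

lemma eqv_sym: "eqv T \<phi> \<psi> \<Longrightarrow> eqv T \<psi> \<phi>"
  by (simp add: eqv_def)

lemma eqv_trans: "eqv T \<phi> \<psi> \<Longrightarrow> eqv T \<psi> \<chi> \<Longrightarrow> eqv T \<phi> \<chi>"
  by (auto simp: eqv_def intro: entails_trans)

lemma entails_Conj:
  "entails T \<phi> \<phi>' \<Longrightarrow> entails T \<psi> \<psi>' \<Longrightarrow> entails T (Conj \<phi> \<psi>) (Conj \<phi>' \<psi>')"
  by (auto simp: entails_def deriv_Conj_iff)

lemma entails_Disj:
  assumes "entails T \<phi> \<phi>'" "entails T \<psi> \<psi>'"
  shows "entails T (Disj \<phi> \<psi>) (Disj \<phi>' \<psi>')"
proof (rule entailsI)
  fix \<Gamma> assume "deriv T \<Gamma> (Disj \<phi> \<psi>)"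
  then show "deriv T \<Gamma> (Disj \<phi>' \<psi>')"
    by (rule DisjE_worlds) (use assms in \<open>auto simp: entails_def intro: deriv.intros\<close>)
qed (use assms in \<open>simp_all add: entails_def\<close>)

lemma entails_Impl:
  "entails T \<phi>' \<phi> \<Longrightarrow> entails T \<psi> \<psi>' \<Longrightarrow> entails T (Impl \<phi> \<psi>) (Impl \<phi>' \<psi>')"
  by (auto simp: entails_def deriv_Impl_iff)

lemma entails_Forall:
  assumes "entails T \<phi> \<psi>"
  shows "entails T (Forall \<phi>) (Forall \<psi>)"
  using assms entailsD[OF entails_inst[OF assms]]
  by (auto intro!: entailsI simp: deriv_Forall_iff entails_wf)

lemma entails_Exists:
  assumes "entails T \<phi> \<psi>"
  shows "entails T (Exists \<phi>) (Exists \<psi>)"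
proof (rule entailsI)
  fix \<Gamma> assume "deriv T \<Gamma> (Exists \<phi>)"
  then show "deriv T \<Gamma> (Exists \<psi>)"
    by (rule ExistsE_all_terms)
      (use assms in \<open>auto intro: deriv.ExistsI entailsD[OF entails_inst] entails_wf\<close>)
qed (use assms in \<open>simp_all add: entails_def\<close>)

lemma eqv_Conj: "eqv T \<phi> \<phi>' \<Longrightarrow> eqv T \<psi> \<psi>' \<Longrightarrow> eqv T (Conj \<phi> \<psi>) (Conj \<phi>' \<psi>')"
  by (simp add: eqv_def entails_Conj)

lemma eqv_Disj: "eqv T \<phi> \<phi>' \<Longrightarrow> eqv T \<psi> \<psi>' \<Longrightarrow> eqv T (Disj \<phi> \<psi>) (Disj \<phi>' \<psi>')"
  by (simp add: eqv_def entails_Disj)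

lemma eqv_Impl: "eqv T \<phi> \<phi>' \<Longrightarrow> eqv T \<psi> \<psi>' \<Longrightarrow> eqv T (Impl \<phi> \<psi>) (Impl \<phi>' \<psi>')"
  by (simp add: eqv_def entails_Impl)

lemma eqv_Forall: "eqv T \<phi> \<psi> \<Longrightarrow> eqv T (Forall \<phi>) (Forall \<psi>)"
  by (simp add: eqv_def entails_Forall)

lemma eqv_Exists: "eqv T \<phi> \<psi> \<Longrightarrow> eqv T (Exists \<phi>) (Exists \<psi>)"
  by (simp add: eqv_def entails_Exists)

section \<open>Quantifier shifts that are intuitionistic equivalences\<close>

lemma eqv_Conj_Exists1:
  assumes [simp]: "fm_wf \<phi>" "fm_wf \<psi>"
  shows "eqv T (Conj (Exists \<phi>) \<psi>) (Exists (Conj \<phi> (shift \<psi>)))"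
proof (rule eqvI)
  fix \<Gamma> assume d: "deriv T \<Gamma> (Conj (Exists \<phi>) \<psi>)"
  then have "deriv T \<Gamma> (Exists \<phi>)" by (simp add: deriv_Conj_iff)
  then show "deriv T \<Gamma> (Exists (Conj \<phi> (shift \<psi>)))"
    by (rule ExistsE_all_terms, rule_tac t = t in deriv.ExistsI)
      (use d in \<open>auto simp: deriv_Conj_iff intro: deriv_weaken\<close>)
next
  fix \<Gamma> assume d: "deriv T \<Gamma> (Exists (Conj \<phi> (shift \<psi>)))"
  then show "deriv T \<Gamma> (Conj (Exists \<phi>) \<psi>)"
    by (rule ExistsE_all_terms) (auto simp: deriv_Conj_iff intro: deriv.ExistsI)
qed simp_all

lemma eqv_Conj_Exists2:
  assumes [simp]: "fm_wf \<phi>" "fm_wf \<psi>"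
  shows "eqv T (Conj \<phi> (Exists \<psi>)) (Exists (Conj (shift \<phi>) \<psi>))"
proof (rule eqvI)
  fix \<Gamma> assume d: "deriv T \<Gamma> (Conj \<phi> (Exists \<psi>))"
  then have "deriv T \<Gamma> (Exists \<psi>)" by (simp add: deriv_Conj_iff)
  then show "deriv T \<Gamma> (Exists (Conj (shift \<phi>) \<psi>))"
    by (rule ExistsE_all_terms, rule_tac t = t in deriv.ExistsI)
      (use d in \<open>auto simp: deriv_Conj_iff intro: deriv_weaken\<close>)
next
  fix \<Gamma> assume d: "deriv T \<Gamma> (Exists (Conj (shift \<phi>) \<psi>))"
  then show "deriv T \<Gamma> (Conj \<phi> (Exists \<psi>))"
    by (rule ExistsE_all_terms) (auto simp: deriv_Conj_iff intro: deriv.ExistsI)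
qed simp_all

lemma eqv_Conj_Forall1:
  assumes [simp]: "fm_wf \<phi>" "fm_wf \<psi>"
  shows "eqv T (Conj (Forall \<phi>) \<psi>) (Forall (Conj \<phi> (shift \<psi>)))"
  \<comment> \<open>The instance at \<open>zero\<close> recovers the conjunct that lies outside the
    scope of the quantifier.\<close>
  by (rule eqvI) (auto simp: deriv_Conj_iff deriv_Forall_iff dest: spec[of _ zero])

lemma eqv_Conj_Forall2:
  assumes [simp]: "fm_wf \<phi>" "fm_wf \<psi>"
  shows "eqv T (Conj \<phi> (Forall \<psi>)) (Forall (Conj (shift \<phi>) \<psi>))"
  by (rule eqvI) (auto simp: deriv_Conj_iff deriv_Forall_iff dest: spec[of _ zero])

lemma eqv_Impl_Exists1:
  assumes [simp]: "fm_wf \<phi>" "fm_wf \<psi>"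
  shows "eqv T (Impl (Exists \<phi>) \<psi>) (Forall (Impl \<phi> (shift \<psi>)))"
proof (rule eqvI)
  fix \<Gamma> assume "deriv T \<Gamma> (Impl (Exists \<phi>) \<psi>)"
  then show "deriv T \<Gamma> (Forall (Impl \<phi> (shift \<psi>)))"
    by (simp add: deriv_Forall_iff deriv_Impl_iff) (metis deriv.ExistsI assms(1))
next
  fix \<Gamma> assume "deriv T \<Gamma> (Forall (Impl \<phi> (shift \<psi>)))"
  then have *: "deriv T \<Delta> \<psi>" if "set \<Gamma> \<subseteq> set \<Delta>" "tm_wf t" "deriv T \<Delta> (inst \<phi> t)" for \<Delta> t
    using that by (auto simp: deriv_Forall_iff deriv_Impl_iff)
  show "deriv T \<Gamma> (Impl (Exists \<phi>) \<psi>)"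
    by (rule ImplI_worlds, simp, erule ExistsE_all_terms) (auto intro: *)
qed simp_all

lemma eqv_Impl_Forall2:
  assumes [simp]: "fm_wf \<phi>" "fm_wf \<psi>"
  shows "eqv T (Impl \<phi> (Forall \<psi>)) (Forall (Impl (shift \<phi>) \<psi>))"
  by (rule eqvI) (auto simp: deriv_Forall_iff deriv_Impl_iff)

lemma eqv_Exists_shift:
  assumes [simp]: "fm_wf \<phi>"
  shows "eqv T \<phi> (Exists (shift \<phi>))"
proof (rule eqvI)
  fix \<Gamma> assume "deriv T \<Gamma> (Exists (shift \<phi>))"
  then show "deriv T \<Gamma> \<phi>" by (rule ExistsE_all_terms) simp
qed (auto intro: deriv.ExistsI[OF _ tm_wf_zero])

lemma eqv_Forall_shift:
  assumes [simp]: "fm_wf \<phi>"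
  shows "eqv T \<phi> (Forall (shift \<phi>))"
proof (rule eqvI)
  fix \<Gamma> assume "deriv T \<Gamma> (Forall (shift \<phi>))"
  then have "deriv T \<Gamma> (inst (shift \<phi>) zero)" using tm_wf_zero by (rule deriv.ForallE)
  then show "deriv T \<Gamma> \<phi>" by simp
qed (simp_all add: deriv_Forall_iff)

section \<open>Double negation: weak equivalence, stability, decidability\<close>

lemma entails_NegNeg: "fm_wf \<phi> \<Longrightarrow> entails T \<phi> (Neg (Neg \<phi>))"
  by (rule entailsI) (auto simp: deriv_Impl_iff intro: deriv_weaken)

lemma entails_Neg: "entails T \<phi> \<psi> \<Longrightarrow> entails T (Neg \<psi>) (Neg \<phi>)"
  by (simp add: entails_Impl entails_refl)

lemma eqv_imp_weqv: "eqv T \<phi> \<psi> \<Longrightarrow> weqv T \<phi> \<psi>"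
  by (simp add: weqv_def eqv_Impl eqv_refl)

lemma weqv_trans: "weqv T \<phi> \<psi> \<Longrightarrow> weqv T \<psi> \<chi> \<Longrightarrow> weqv T \<phi> \<chi>"
  unfolding weqv_def by (rule eqv_trans)

lemma weqv_sym: "weqv T \<phi> \<psi> \<Longrightarrow> weqv T \<psi> \<phi>"
  unfolding weqv_def by (rule eqv_sym)

lemma weqv_wf: "weqv T \<phi> \<psi> \<Longrightarrow> fm_wf \<phi>" "weqv T \<phi> \<psi> \<Longrightarrow> fm_wf \<psi>"
  by (auto simp: weqv_def dest: eqv_wf)

text \<open>A stable formula is equivalent to its double negation, and weak equivalence makes the
  double negations agree.\<close>

lemma weqv_stable:
  assumes "weqv T \<phi> \<psi>" "stable T \<phi>" "stable T \<psi>"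
  shows "eqv T \<phi> \<psi>"
proof -
  have *: "entails T \<phi> \<psi>" if "weqv T \<phi> \<psi>" "stable T \<psi>" for \<phi> \<psi>
  proof (rule entails_trans[OF entails_NegNeg])
    show "fm_wf \<phi>" using weqv_wf[OF that(1)] by simp
    show "entails T (Neg (Neg \<phi>)) \<psi>"
      using that entails_Neg[of T "Neg \<psi>" "Neg \<phi>"]
      by (auto simp: weqv_def eqv_def stable_def intro: entails_trans)
  qed
  show ?thesis using assms by (auto simp: eqv_def intro: * weqv_sym)
qed

lemma stable_eqv: "eqv T \<phi> \<psi> \<Longrightarrow> stable T \<psi> \<Longrightarrow> stable T \<phi>"
  by (auto simp: eqv_def stable_def intro: entails_trans entails_Neg)

lemma stable_wf: "stable T \<phi> \<Longrightarrow> fm_wf \<phi>"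
  by (simp add: stable_def entails_def)

lemma stable_Impl:
  assumes "stable T \<psi>" "fm_wf \<phi>"
  shows "stable T (Impl \<phi> \<psi>)"
proof -
  have [simp]: "fm_wf \<psi>" "fm_wf \<phi>" using assms by (auto dest: stable_wf)
  have "deriv T \<Gamma> (Impl \<phi> \<psi>)" if d: "deriv T \<Gamma> (Neg (Neg (Impl \<phi> \<psi>)))" for \<Gamma>
  proof (rule ImplI_worlds)
    fix \<Delta> assume s: "set \<Gamma> \<subseteq> set \<Delta>" and f: "deriv T \<Delta> \<phi>"
    have "deriv T \<Delta> (Neg (Neg \<psi>))"
      using deriv_weaken[OF d s] deriv_weaken[OF f]
      by (simp add: deriv_Impl_iff)
    then show "deriv T \<Delta> \<psi>" using assms(1) by (auto simp: stable_def intro: entailsD)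
  qed simp
  then show ?thesis by (auto simp: stable_def intro!: entailsI)
qed

text \<open>A double negation can be pushed inward through \<forall>, so stability of the instances
  suffices.\<close>

lemma stable_Forall:
  assumes "stable T \<phi>"
  shows "stable T (Forall \<phi>)"
proof -
  have [simp]: "fm_wf \<phi>" using assms by (rule stable_wf)
  have "deriv T \<Gamma> (Forall \<phi>)" if d: "deriv T \<Gamma> (Neg (Neg (Forall \<phi>)))" for \<Gamma>
  proof (rule ForallI_all_terms)
    fix t assume [simp]: "tm_wf t"
    have "deriv T \<Gamma> (Neg (Neg (inst \<phi> t)))"
      using d by (simp add: deriv_Impl_iff) (metis deriv.ForallE \<open>tm_wf t\<close>)
    then show "deriv T \<Gamma> (inst \<phi> t)"
      using entails_inst[OF assms[unfolded stable_def], of t] by (auto intro: entailsD)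
  qed
  then show ?thesis by (auto simp: stable_def intro!: entailsI)
qed

lemma decidable_deriv: "decidable T \<phi> \<Longrightarrow> deriv T \<Gamma> (Disj \<phi> (Neg \<phi>))"
  unfolding decidable_def by (erule deriv_weaken) simp

lemma decidable_wf: "decidable T \<phi> \<Longrightarrow> fm_wf \<phi>"
  using deriv_fm_wf by (fastforce simp: decidable_def)

lemma decidable_stable:
  assumes "decidable T \<phi>"
  shows "stable T \<phi>"
  unfolding stable_def
proof (rule entailsI)
  fix \<Gamma> assume d: "deriv T \<Gamma> (Neg (Neg \<phi>))"
  show "deriv T \<Gamma> \<phi>"
    using decidable_deriv[OF assms]
  proof (rule DisjE_worlds)
    fix \<Delta> assume "set \<Gamma> \<subseteq> set \<Delta>" "deriv T \<Delta> (Neg \<phi>)"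
    then show "deriv T \<Delta> \<phi>"
      using deriv_weaken[OF d] decidable_wf[OF assms] by (auto intro: deriv_absurd)
  qed
qed (use decidable_wf[OF assms] in simp_all)

text \<open>Given one conjunct, refuting the conjunction means refuting the other, so the two
  conjuncts can be exchanged one after the other.\<close>

lemma entails_Neg_Conj:
  assumes "entails T (Neg \<phi>) (Neg \<phi>')" "entails T (Neg \<psi>) (Neg \<psi>')"
  shows "entails T (Neg (Conj \<phi> \<psi>)) (Neg (Conj \<phi>' \<psi>'))"
proof (rule entailsI)
  have [simp]: "fm_wf \<phi>" "fm_wf \<psi>" "fm_wf \<phi>'" "fm_wf \<psi>'"
    using assms by (auto simp: entails_def)
  then show "fm_wf (Neg (Conj \<phi> \<psi>))" "fm_wf (Neg (Conj \<phi>' \<psi>'))" by simp_all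
  fix \<Gamma> assume d: "deriv T \<Gamma> (Neg (Conj \<phi> \<psi>))"
  show "deriv T \<Gamma> (Neg (Conj \<phi>' \<psi>'))"
  proof (rule ImplI_worlds)
    fix \<Delta> assume s: "set \<Gamma> \<subseteq> set \<Delta>" and c: "deriv T \<Delta> (Conj \<phi>' \<psi>')"
    have "deriv T \<Delta> (Neg \<phi>)"
    proof (rule ImplI_worlds)
      fix \<Delta>' assume s': "set \<Delta> \<subseteq> set \<Delta>'" and f: "deriv T \<Delta>' \<phi>"
      have "deriv T \<Delta>' (Neg \<psi>)"
        using deriv_weaken[OF d] deriv_weaken[OF f] s s'
        by (simp add: deriv_Impl_iff deriv_Conj_iff)
      then have "deriv T \<Delta>' (Neg \<psi>')" by (rule entailsD[OF assms(2)])
      then show "deriv T \<Delta>' Bot"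
        using deriv_weaken[OF c s'] by (auto simp: deriv_Conj_iff intro: deriv.ImplE)
    qed simp
    then have "deriv T \<Delta> (Neg \<phi>')" by (rule entailsD[OF assms(1)])
    then show "deriv T \<Delta> Bot"
      using c by (auto simp: deriv_Conj_iff intro: deriv.ImplE)
  qed simp
qed

lemma entails_Neg_Impl:
  assumes "entails T \<phi>' \<phi>" "entails T \<phi> \<phi>'" "entails T (Neg \<psi>) (Neg \<psi>')"
  shows "entails T (Neg (Impl \<phi> \<psi>)) (Neg (Impl \<phi>' \<psi>'))"
proof (rule entailsI)
  have [simp]: "fm_wf \<phi>" "fm_wf \<psi>" "fm_wf \<phi>'" "fm_wf \<psi>'"
    using assms by (auto simp: entails_def)
  then show "fm_wf (Neg (Impl \<phi> \<psi>))" "fm_wf (Neg (Impl \<phi>' \<psi>'))" by simp_all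
  fix \<Gamma> assume d: "deriv T \<Gamma> (Neg (Impl \<phi> \<psi>))"
  show "deriv T \<Gamma> (Neg (Impl \<phi>' \<psi>'))"
  proof (rule ImplI_worlds)
    fix \<Delta> assume s: "set \<Gamma> \<subseteq> set \<Delta>" and i: "deriv T \<Delta> (Impl \<phi>' \<psi>')"
    have "deriv T \<Delta> (Neg \<psi>)"
    proof (rule ImplI_worlds)
      fix \<Delta>' assume s': "set \<Delta> \<subseteq> set \<Delta>'" and "deriv T \<Delta>' \<psi>"
      then have "deriv T \<Delta>' (Impl \<phi> \<psi>)" by (auto simp: deriv_Impl_iff intro: deriv_weaken)
      with deriv_weaken[OF d, of \<Delta>'] s s' show "deriv T \<Delta>' Bot"
        by (auto intro: deriv.ImplE)
    qed simp
    then have n: "deriv T \<Delta> (Neg \<psi>')" by (rule entailsD[OF assms(3)])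
    have "deriv T \<Delta> (Impl \<phi> \<psi>)"
    proof (rule ImplI_worlds)
      fix \<Delta>' assume s': "set \<Delta> \<subseteq> set \<Delta>'" and "deriv T \<Delta>' \<phi>"
      then have "deriv T \<Delta>' \<psi>'"
        using deriv_weaken[OF i s'] entailsD[OF assms(2)] by (auto intro: deriv.ImplE)
      then show "deriv T \<Delta>' \<psi>" by (rule deriv_absurd[OF deriv_weaken[OF n s']]) simp
    qed simp
    then show "deriv T \<Delta> Bot" using deriv_weaken[OF d s] by (auto intro: deriv.ImplE)
  qed simp
qed

text \<open>A negated \<exists> is a universally quantified negation, and \<forall> is monotone. The
  analogue for \<forall>, applied to \<phi> and its double negation, would be double negation
  shift.\<close>

lemma entails_Neg_Exists:
  assumes "entails T (Neg \<phi>) (Neg \<psi>)"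
  shows "entails T (Neg (Exists \<phi>)) (Neg (Exists \<psi>))"
proof (rule entailsI)
  have [simp]: "fm_wf \<phi>" "fm_wf \<psi>" using assms by (auto simp: entails_def)
  then show "fm_wf (Neg (Exists \<phi>))" "fm_wf (Neg (Exists \<psi>))" by simp_all
  fix \<Gamma> assume d: "deriv T \<Gamma> (Neg (Exists \<phi>))"
  have *: "entails T (Neg (Exists \<theta>)) (Forall (Neg \<theta>))"
    "entails T (Forall (Neg \<theta>)) (Neg (Exists \<theta>))" if "fm_wf \<theta>" for \<theta>
    using eqv_Impl_Exists1[OF that, of Bot T] by (simp_all add: eqv_def)
  show "deriv T \<Gamma> (Neg (Exists \<psi>))"
    using d entails_Forall[OF assms] *(1)[of \<phi>] *(2)[of \<psi>] by (simp add: entails_def)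
qed

lemma weqv_Conj: "weqv T \<phi> \<phi>' \<Longrightarrow> weqv T \<psi> \<psi>' \<Longrightarrow> weqv T (Conj \<phi> \<psi>) (Conj \<phi>' \<psi>')"
  by (simp add: weqv_def eqv_def entails_Neg_Conj)

lemma weqv_Impl: "eqv T \<phi> \<phi>' \<Longrightarrow> weqv T \<psi> \<psi>' \<Longrightarrow> weqv T (Impl \<phi> \<psi>) (Impl \<phi>' \<psi>')"
  by (simp add: weqv_def eqv_def entails_Neg_Impl)

lemma weqv_Exists: "weqv T \<phi> \<psi> \<Longrightarrow> weqv T (Exists \<phi>) (Exists \<psi>)"
  by (simp add: weqv_def eqv_def entails_Neg_Exists)

text \<open>With a stable consequent an implication follows from its contrapositive, in which the
  antecedent occurs only negated.\<close>

lemma entails_Impl_weqv: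
  assumes "entails T (Neg \<phi>) (Neg \<phi>')" "entails T \<psi> \<psi>'" "stable T \<psi>'"
  shows "entails T (Impl \<phi> \<psi>) (Impl \<phi>' \<psi>')"
proof (rule entailsI)
  have [simp]: "fm_wf \<phi>" "fm_wf \<psi>" "fm_wf \<phi>'" "fm_wf \<psi>'"
    using assms by (auto simp: entails_def)
  then show "fm_wf (Impl \<phi> \<psi>)" "fm_wf (Impl \<phi>' \<psi>')" by simp_all
  fix \<Gamma> assume "deriv T \<Gamma> (Impl \<phi> \<psi>)"
  then have d: "deriv T \<Gamma> (Impl \<phi> \<psi>')"
    by (rule entailsD[rotated]) (simp add: assms entails_Impl entails_refl)
  show "deriv T \<Gamma> (Impl \<phi>' \<psi>')"
  proof (rule ImplI_worlds)
    fix \<Delta> assume s: "set \<Gamma> \<subseteq> set \<Delta>" and f: "deriv T \<Delta> \<phi>'"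
    have "deriv T \<Delta> (Neg (Neg \<psi>'))"
    proof (rule ImplI_worlds)
      fix \<Delta>' assume s': "set \<Delta> \<subseteq> set \<Delta>'" and n: "deriv T \<Delta>' (Neg \<psi>')"
      have "deriv T \<Delta>' (Neg \<phi>)"
        using deriv_weaken[OF d] n s s' by (simp add: deriv_Impl_iff)
      then have "deriv T \<Delta>' (Neg \<phi>')" by (rule entailsD[OF assms(1)])
      then show "deriv T \<Delta>' Bot" using deriv_weaken[OF f s'] by (rule deriv.ImplE)
    qed simp
    then show "deriv T \<Delta> \<psi>'" by (rule entailsD[OF assms(3)[unfolded stable_def]])
  qed simp
qed

lemma eqv_Impl_weqv:
  assumes "weqv T \<phi> \<phi>'" "eqv T \<psi> \<psi>'" "stable T \<psi>"
  shows "eqv T (Impl \<phi> \<psi>) (Impl \<phi>' \<psi>')"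
  using assms stable_eqv[OF eqv_sym[OF assms(2)]]
  by (simp add: weqv_def eqv_def entails_Impl_weqv)

section \<open>Quantifier shifts that hold only up to negation\<close>

lemma entails_Exists_Impl_Forall:
  assumes [simp]: "fm_wf \<phi>" "fm_wf \<psi>"
  shows "entails T (Exists (Impl \<phi> (shift \<psi>))) (Impl (Forall \<phi>) \<psi>)"
proof (rule entailsI)
  fix \<Gamma> assume "deriv T \<Gamma> (Exists (Impl \<phi> (shift \<psi>)))"
  then show "deriv T \<Gamma> (Impl (Forall \<phi>) \<psi>)"
    by (rule ExistsE_all_terms) (auto simp: deriv_Impl_iff deriv_Forall_iff)
qed simp_all

text \<open>Suppose no \<open>t\<close> satisfies \<phi>(t) \<rightarrow> \<psi>. Then no \<phi>(t)
  can be refuted, since a refutation would make the implication vacuous; by stability every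
  \<phi>(t) holds. So \<forall>x \<phi> \<rightarrow> \<psi> would give \<psi>, and with it
  \<phi>(t) \<rightarrow> \<psi> for any \<open>t\<close>.\<close>

lemma weqv_Impl_Forall1:
  assumes "stable T \<phi>" and [simp]: "fm_wf \<psi>"
  shows "weqv T (Impl (Forall \<phi>) \<psi>) (Exists (Impl \<phi> (shift \<psi>)))"
proof -
  have [simp]: "fm_wf \<phi>" using assms by (auto dest: stable_wf)
  have "deriv T \<Gamma> (Neg (Impl (Forall \<phi>) \<psi>))"
    if d: "deriv T \<Gamma> (Neg (Exists (Impl \<phi> (shift \<psi>))))" for \<Gamma>
  proof (rule ImplI_worlds)
    fix \<Delta> assume s: "set \<Gamma> \<subseteq> set \<Delta>" and i: "deriv T \<Delta> (Impl (Forall \<phi>) \<psi>)"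
    note d = deriv_weaken[OF d s]
    have n: "deriv T \<Delta>' Bot"
      if "set \<Delta> \<subseteq> set \<Delta>'" "tm_wf t" "deriv T \<Delta>' (Impl (inst \<phi> t) \<psi>)" for \<Delta>' t
      using deriv.ImplE[OF deriv_weaken[OF d that(1)] deriv.ExistsI[where t = t]] that by simp
    have "deriv T \<Delta> (Forall \<phi>)"
    proof (rule ForallI_all_terms)
      fix t assume t [simp]: "tm_wf t"
      have "deriv T \<Delta> (Neg (Neg (inst \<phi> t)))"
      proof (rule ImplI_worlds)
        fix \<Delta>' assume s': "set \<Delta> \<subseteq> set \<Delta>'" and "deriv T \<Delta>' (Neg (inst \<phi> t))"
        then have "deriv T \<Delta>' (Impl (inst \<phi> t) \<psi>)"
          by (auto simp: deriv_Impl_iff intro: deriv.BotE)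
        then show "deriv T \<Delta>' Bot" using n[OF s' t] by simp
      qed simp
      then show "deriv T \<Delta> (inst \<phi> t)"
        using entails_inst[OF assms(1)[unfolded stable_def], of t] by (auto intro: entailsD)
    qed
    with i have "deriv T \<Delta> \<psi>" by (rule deriv.ImplE)
    then have "deriv T \<Delta> (Impl (inst \<phi> zero) \<psi>)"
      by (auto simp: deriv_Impl_iff intro: deriv_weaken)
    then show "deriv T \<Delta> Bot" using n[OF _ tm_wf_zero] by simp
  qed simp
  then have "entails T (Neg (Exists (Impl \<phi> (shift \<psi>)))) (Neg (Impl (Forall \<phi>) \<psi>))"
    by (intro entailsI) simp_all
  then show ?thesis
    by (simp add: weqv_def eqv_def entails_Neg entails_Exists_Impl_Forall)
qed

text \<open>Independence of premise under a negation: if no \<open>t\<close> satisfies \<phi>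
  \<rightarrow> \<psi>(t), then \<phi> together with \<phi> \<rightarrow> \<exists>x \<psi> is
  absurd, because a witness obtained from \<phi> would be such a \<open>t\<close>.\<close>

lemma weqv_Impl_Exists2:
  assumes [simp]: "fm_wf \<phi>" "fm_wf \<psi>"
  shows "weqv T (Impl \<phi> (Exists \<psi>)) (Exists (Impl (shift \<phi>) \<psi>))"
proof -
  have 1: "entails T (Exists (Impl (shift \<phi>) \<psi>)) (Impl \<phi> (Exists \<psi>))"
  proof (rule entailsI)
    fix \<Gamma> assume "deriv T \<Gamma> (Exists (Impl (shift \<phi>) \<psi>))"
    then show "deriv T \<Gamma> (Impl \<phi> (Exists \<psi>))"
      by (rule ExistsE_all_terms) (simp add: deriv_Impl_iff, metis deriv.ExistsI assms(2))
  qed simp_all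
  have "deriv T \<Gamma> (Neg (Impl \<phi> (Exists \<psi>)))"
    if d: "deriv T \<Gamma> (Neg (Exists (Impl (shift \<phi>) \<psi>)))" for \<Gamma>
  proof (rule ImplI_worlds)
    fix \<Delta> assume s: "set \<Gamma> \<subseteq> set \<Delta>" and i: "deriv T \<Delta> (Impl \<phi> (Exists \<psi>))"
    note d = deriv_weaken[OF d s]
    have n: "deriv T \<Delta>' Bot"
      if "set \<Delta> \<subseteq> set \<Delta>'" "tm_wf t" "deriv T \<Delta>' (Impl \<phi> (inst \<psi> t))" for \<Delta>' t
      using deriv.ImplE[OF deriv_weaken[OF d that(1)] deriv.ExistsI[where t = t]] that by simp
    have b: "deriv T \<Delta>' Bot" if s': "set \<Delta> \<subseteq> set \<Delta>'" and f: "deriv T \<Delta>' \<phi>" for \<Delta>'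
    proof -
      have "deriv T \<Delta>' (Exists \<psi>)" using deriv_weaken[OF i s'] f by (rule deriv.ImplE)
      then show ?thesis
      proof (rule ExistsE_all_terms)
        fix t \<Delta>'' assume t: "tm_wf t" and s'': "set \<Delta>' \<subseteq> set \<Delta>''" and p: "deriv T \<Delta>'' (inst \<psi> t)"
        have "deriv T \<Delta>'' (Impl \<phi> (inst \<psi> t))"
          by (rule ImplI_worlds) (simp_all add: deriv_weaken[OF p])
        then show "deriv T \<Delta>'' Bot" using n t s' s'' by blast
      qed
    qed
    \<comment> \<open>Since \<phi> is now refuted, the implication is vacuous and any term serves as
      witness.\<close>
    have "deriv T \<Delta> (Impl \<phi> (inst \<psi> zero))"
      by (rule ImplI_worlds, simp, rule deriv.BotE[OF b]) simp_all
    then show "deriv T \<Delta> Bot" using n[OF _ tm_wf_zero] by simp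
  qed simp
  then have "entails T (Neg (Exists (Impl (shift \<phi>) \<psi>))) (Neg (Impl \<phi> (Exists \<psi>)))"
    by (intro entailsI) simp_all
  then show ?thesis
    using 1 by (simp add: weqv_def eqv_def entails_Neg)
qed

section \<open>Prenex formulas and alternation paths\<close>

lemma fm_wf_power [simp]:
  "fm_wf ((Forall ^^ n) \<phi>) = fm_wf \<phi>" "fm_wf ((Exists ^^ n) \<phi>) = fm_wf \<phi>"
  by (induction n) simp_all

lemma Sigma_Pi_wf: "(\<phi> \<in> Sigma_fm k \<longrightarrow> fm_wf \<phi>) \<and> (\<phi> \<in> Pi_fm k \<longrightarrow> fm_wf \<phi>)"
  by (induction k arbitrary: \<phi>) (auto simp: formulas_def)

lemma Sigma_wf: "\<phi> \<in> Sigma_fm k \<Longrightarrow> fm_wf \<phi>"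
  and Pi_wf: "\<phi> \<in> Pi_fm k \<Longrightarrow> fm_wf \<phi>"
  using Sigma_Pi_wf by blast+

lemma Exists_Sigma: "\<phi> \<in> Sigma_fm (Suc k) \<Longrightarrow> Exists \<phi> \<in> Sigma_fm (Suc k)"
  by simp (metis funpow.simps(2) comp_apply)

lemma Forall_Pi: "\<phi> \<in> Pi_fm (Suc k) \<Longrightarrow> Forall \<phi> \<in> Pi_fm (Suc k)"
  by simp (metis funpow.simps(2) comp_apply)

lemma Pi_subset_Sigma_Suc: "Pi_fm k \<subseteq> Sigma_fm (Suc k)"
  by (auto intro!: exI[of _ "0 :: nat"])

lemma Sigma_subset_Pi_Suc: "Sigma_fm k \<subseteq> Pi_fm (Suc k)"
  by (auto intro!: exI[of _ "0 :: nat"])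

lemma Sigma_Pi_Suc_mono: "Sigma_fm k \<subseteq> Sigma_fm (Suc k) \<and> Pi_fm k \<subseteq> Pi_fm (Suc k)"
proof (induction k)
  case 0
  show ?case using Pi_subset_Sigma_Suc[of 0] Sigma_subset_Pi_Suc[of 0] by simp
next
  case (Suc k)
  then show ?case unfolding Sigma_fm.simps(2) Pi_fm.simps(2) by fast
qed

lemma Sigma_mono: "j \<le> k \<Longrightarrow> Sigma_fm j \<subseteq> Sigma_fm k"
  and Pi_mono: "j \<le> k \<Longrightarrow> Pi_fm j \<subseteq> Pi_fm k"
  using lift_Suc_mono_le[of Sigma_fm] lift_Suc_mono_le[of Pi_fm] Sigma_Pi_Suc_mono by auto

lemma Sigma_Suc_induct [consumes 1, case_names Pi Exists]:
  assumes "\<phi> \<in> Sigma_fm (Suc k)"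
    and "\<And>\<phi>. \<phi> \<in> Pi_fm k \<Longrightarrow> P \<phi>"
    and "\<And>\<phi>. \<phi> \<in> Sigma_fm (Suc k) \<Longrightarrow> P \<phi> \<Longrightarrow> P (Exists \<phi>)"
  shows "P \<phi>"
proof -
  obtain n \<psi> where "\<phi> = (Exists ^^ n) \<psi>" and \<psi>: "\<psi> \<in> Pi_fm k" using assms(1) by auto
  moreover have "P ((Exists ^^ n) \<psi>)"
    by (induction n) (use \<psi> assms(2,3) in auto)
  ultimately show ?thesis by simp
qed

lemma Pi_Suc_induct [consumes 1, case_names Sigma Forall]:
  assumes "\<phi> \<in> Pi_fm (Suc k)"
    and "\<And>\<phi>. \<phi> \<in> Sigma_fm k \<Longrightarrow> P \<phi>"
    and "\<And>\<phi>. \<phi> \<in> Pi_fm (Suc k) \<Longrightarrow> P \<phi> \<Longrightarrow> P (Forall \<phi>)"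
  shows "P \<phi>"
proof -
  obtain n \<psi> where "\<phi> = (Forall ^^ n) \<psi>" and \<psi>: "\<psi> \<in> Sigma_fm k" using assms(1) by auto
  moreover have "P ((Forall ^^ n) \<psi>)"
    by (induction n) (use \<psi> assms(2,3) in auto)
  ultimately show ?thesis by simp
qed

lemma qfree_subst [simp]: "qfree (subst \<sigma> \<phi>) = qfree \<phi>"
  by (induction \<phi> arbitrary: \<sigma>) simp_all

lemma Sigma_Pi_subst:
  "\<forall>i. tm_wf (\<sigma> i) \<Longrightarrow> (\<phi> \<in> Sigma_fm k \<longrightarrow> subst \<sigma> \<phi> \<in> Sigma_fm k) \<and>
     (\<phi> \<in> Pi_fm k \<longrightarrow> subst \<sigma> \<phi> \<in> Pi_fm k)"
proof (induction k arbitrary: \<phi> \<sigma>)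
  case 0
  then show ?case by (simp add: formulas_def fm_wf_subst)
next
  case (Suc k)
  have "\<forall>i. tm_wf ((up ^^ n) \<sigma> i)" for n
    using Suc.prems by (induction n) (simp_all add: tm_wf_up)
  from Suc.IH[OF this] show ?case
    by (force simp: subst_Forall_power subst_Exists_power)
qed

lemma Sigma_shift: "\<phi> \<in> Sigma_fm k \<Longrightarrow> shift \<phi> \<in> Sigma_fm k"
  and Pi_shift: "\<phi> \<in> Pi_fm k \<Longrightarrow> shift \<phi> \<in> Pi_fm k"
  using Sigma_Pi_subst[of "\<lambda>i. Var (Suc i)" \<phi> k] by (simp_all add: shift_def)

lemma qfree_Sigma_Pi: "qfree \<phi> \<Longrightarrow> fm_wf \<phi> \<Longrightarrow> \<phi> \<in> Sigma_fm k \<and> \<phi> \<in> Pi_fm k"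
  using Sigma_mono[of 0 k] Pi_mono[of 0 k] by (auto simp: formulas_def)

text \<open>One block merging for all connectives: \<open>op\<close> joins a \<open>Q1\<close> block
  and a \<open>Q2\<close> block into a single \<open>Q\<close> block, and \<open>R\<close> is either
  kind of equivalence. The left block is emptied before the right one is touched; hence
  \<open>left\<close> allows any member of \<open>D2\<close> on the right, while
  \<open>right\<close> has a bare \<open>C1\<close> matrix on the left. \<open>base\<close> carries
  the induction on the level.\<close>

lemma prenex_blocks:
  fixes op :: "fm \<Rightarrow> fm \<Rightarrow> fm"
  assumes FV: "\<And>\<phi>. FV (Q1 \<phi>) = {n. Suc n \<in> FV \<phi>}" "\<And>\<phi>. FV (Q2 \<phi>) = {n. Suc n \<in> FV \<phi>}"
    "\<And>\<phi>. FV (Q \<phi>) = {n. Suc n \<in> FV \<phi>}"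
    and base: "\<And>\<phi> \<psi>. \<phi> \<in> C1 \<Longrightarrow> \<psi> \<in> C2 \<Longrightarrow> \<exists>\<chi> \<in> D. FV \<chi> = FV \<phi> \<union> FV \<psi> \<and> R (op \<phi> \<psi>) \<chi>"
    and left: "\<And>n \<phi> \<psi>. \<phi> \<in> C1 \<Longrightarrow> \<psi> \<in> D2 \<Longrightarrow>
      R (op (Q1 ((Q1 ^^ n) \<phi>)) \<psi>) (Q (op ((Q1 ^^ n) \<phi>) (shift \<psi>)))"
    and right: "\<And>n \<phi> \<psi>. \<phi> \<in> C1 \<Longrightarrow> \<psi> \<in> C2 \<Longrightarrow>
      R (op \<phi> (Q2 ((Q2 ^^ n) \<psi>))) (Q (op (shift \<phi>) ((Q2 ^^ n) \<psi>)))"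
    and cong: "\<And>\<phi> \<psi>. R \<phi> \<psi> \<Longrightarrow> R (Q \<phi>) (Q \<psi>)"
    and trans: "\<And>\<phi> \<psi> \<chi>. R \<phi> \<psi> \<Longrightarrow> R \<psi> \<chi> \<Longrightarrow> R \<phi> \<chi>"
    and shift: "\<And>\<phi>. \<phi> \<in> C1 \<Longrightarrow> shift \<phi> \<in> C1" "\<And>\<psi>. \<psi> \<in> D2 \<Longrightarrow> shift \<psi> \<in> D2"
    and D: "\<And>\<chi>. \<chi> \<in> D \<Longrightarrow> Q \<chi> \<in> D"
    and D1: "D1 = {(Q1 ^^ n) \<phi> | n \<phi>. \<phi> \<in> C1}" and D2: "D2 = {(Q2 ^^ n) \<psi> | n \<psi>. \<psi> \<in> C2}"
    and mem: "\<phi> \<in> D1" "\<psi> \<in> D2"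
  shows "\<exists>\<chi> \<in> D. FV \<chi> = FV \<phi> \<union> FV \<psi> \<and> R (op \<phi> \<psi>) \<chi>"
proof -
  have *: "\<exists>\<chi> \<in> D. FV \<chi> = FV \<phi> \<union> FV ((Q2 ^^ n) \<psi>) \<and> R (op \<phi> ((Q2 ^^ n) \<psi>)) \<chi>"
    if "\<phi> \<in> C1" "\<psi> \<in> C2" for n \<phi> \<psi>
    using that
  proof (induction n arbitrary: \<phi>)
    case 0
    then show ?case using base by simp
  next
    case (Suc n)
    from Suc.IH[of "shift \<phi>"] Suc.prems shift(1) obtain \<chi>
      where \<chi>: "\<chi> \<in> D" "FV \<chi> = FV (shift \<phi>) \<union> FV ((Q2 ^^ n) \<psi>)"
        "R (op (shift \<phi>) ((Q2 ^^ n) \<psi>)) \<chi>" by blast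
    have "R (op \<phi> ((Q2 ^^ Suc n) \<psi>)) (Q \<chi>)"
      using trans[OF right[OF Suc.prems] cong[OF \<chi>(3)]] by simp
    moreover have "FV (Q \<chi>) = FV \<phi> \<union> FV ((Q2 ^^ Suc n) \<psi>)"
      using \<chi>(2) by (auto simp: FV)
    ultimately show ?case using D[OF \<chi>(1)] by blast
  qed
  obtain n \<phi>0 where \<phi>: "\<phi> = (Q1 ^^ n) \<phi>0" "\<phi>0 \<in> C1" using mem(1) D1 by blast
  have "\<exists>\<chi> \<in> D. FV \<chi> = FV ((Q1 ^^ n) \<phi>0) \<union> FV \<psi> \<and> R (op ((Q1 ^^ n) \<phi>0) \<psi>) \<chi>"
    using mem(2)
  proof (induction n arbitrary: \<psi>)
    case 0
    then obtain m \<psi>0 where "\<psi> = (Q2 ^^ m) \<psi>0" "\<psi>0 \<in> C2" using D2 by blast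
    then show ?case using *[OF \<phi>(2)] by simp
  next
    case (Suc n)
    from Suc.IH[OF shift(2)[OF Suc.prems]] obtain \<chi>
      where \<chi>: "\<chi> \<in> D" "FV \<chi> = FV ((Q1 ^^ n) \<phi>0) \<union> FV (shift \<psi>)"
        "R (op ((Q1 ^^ n) \<phi>0) (shift \<psi>)) \<chi>" by blast
    have "R (op ((Q1 ^^ Suc n) \<phi>0) \<psi>) (Q \<chi>)"
      using trans[OF left[OF \<phi>(2) Suc.prems] cong[OF \<chi>(3)]] by simp
    moreover have "FV (Q \<chi>) = FV ((Q1 ^^ Suc n) \<phi>0) \<union> FV \<psi>"
      using \<chi>(2) by (auto simp: FV)
    ultimately show ?case using D[OF \<chi>(1)] by blast
  qed
  then show ?thesis using \<phi> by simp
qed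

lemma Conj_prenex:
  "(\<phi> \<in> Sigma_fm k \<longrightarrow> \<psi> \<in> Sigma_fm k \<longrightarrow>
      (\<exists>\<chi> \<in> Sigma_fm k. FV \<chi> = FV \<phi> \<union> FV \<psi> \<and> eqv T (Conj \<phi> \<psi>) \<chi>)) \<and>
   (\<phi> \<in> Pi_fm k \<longrightarrow> \<psi> \<in> Pi_fm k \<longrightarrow>
      (\<exists>\<chi> \<in> Pi_fm k. FV \<chi> = FV \<phi> \<union> FV \<psi> \<and> eqv T (Conj \<phi> \<psi>) \<chi>))"
proof (induction k arbitrary: \<phi> \<psi>)
  case 0
  then show ?case
    by (auto simp: formulas_def intro!: exI[of _ "Conj \<phi> \<psi>"] eqv_refl)
next
  case (Suc k)
  have "\<exists>\<chi> \<in> Sigma_fm (Suc k). FV \<chi> = FV \<phi> \<union> FV \<psi> \<and> eqv T (Conj \<phi> \<psi>) \<chi>"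
    if "\<phi> \<in> Sigma_fm (Suc k)" "\<psi> \<in> Sigma_fm (Suc k)"
  proof (rule prenex_blocks[where op = Conj and R = "eqv T" and Q = Exists, OF _ _ _ _ _ _ _ _ _ _ _
        Sigma_fm.simps(2) Sigma_fm.simps(2) that])
    fix \<phi> \<psi> assume "\<phi> \<in> Pi_fm k" "\<psi> \<in> Pi_fm k"
    then show "\<exists>\<chi> \<in> Sigma_fm (Suc k). FV \<chi> = FV \<phi> \<union> FV \<psi> \<and> eqv T (Conj \<phi> \<psi>) \<chi>"
      using Suc.IH[of \<phi> \<psi>] Pi_subset_Sigma_Suc by blast
  qed (auto simp del: Sigma_fm.simps simp: Pi_wf Sigma_wf Exists_Sigma Pi_shift Sigma_shift
      intro: eqv_Exists eqv_trans eqv_Conj_Exists1 eqv_Conj_Exists2)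
  moreover have "\<exists>\<chi> \<in> Pi_fm (Suc k). FV \<chi> = FV \<phi> \<union> FV \<psi> \<and> eqv T (Conj \<phi> \<psi>) \<chi>"
    if "\<phi> \<in> Pi_fm (Suc k)" "\<psi> \<in> Pi_fm (Suc k)"
  proof (rule prenex_blocks[where op = Conj and R = "eqv T" and Q = Forall, OF _ _ _ _ _ _ _ _ _ _ _
        Pi_fm.simps(2) Pi_fm.simps(2) that])
    fix \<phi> \<psi> assume "\<phi> \<in> Sigma_fm k" "\<psi> \<in> Sigma_fm k"
    then show "\<exists>\<chi> \<in> Pi_fm (Suc k). FV \<chi> = FV \<phi> \<union> FV \<psi> \<and> eqv T (Conj \<phi> \<psi>) \<chi>"
      using Suc.IH[of \<phi> \<psi>] Sigma_subset_Pi_Suc by blast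
  qed (auto simp del: Pi_fm.simps simp: Pi_wf Sigma_wf Forall_Pi Pi_shift Sigma_shift
      intro: eqv_Forall eqv_trans eqv_Conj_Forall1 eqv_Conj_Forall2)
  ultimately show ?case by blast
qed

text \<open>DNE(Sigma_k) without the universal closures; the two forms are matched in
  \<open>proves_DNE_Sigma_iff\<close>.\<close>

definition stable_Sigma :: "fm set \<Rightarrow> nat \<Rightarrow> bool" where
  "stable_Sigma T k \<longleftrightarrow> (\<forall>\<phi> \<in> Sigma_fm k. stable T \<phi>)"

text \<open>Stability climbs one level for free on the universal side. For this reason
  DNE(Sigma_(k-1)) suffices for the U classes at level \<open>k\<close>.\<close>

lemma stable_Pi_Suc:
  assumes "stable_Sigma T k" "\<phi> \<in> Pi_fm (Suc k)"
  shows "stable T \<phi>"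
  using assms(2)
  by (induction rule: Pi_Suc_induct) (use assms(1) in \<open>auto simp: stable_Sigma_def stable_Forall\<close>)

text \<open>Towards Sigma, the shifts of \<forall> out of the antecedent and \<exists> out of the
  consequent hold only under negation. Towards Pi the shifts are intuitionistic, and only the
  matrix, an implication from Pi to Sigma one level lower, has to be upgraded.\<close>

lemma Impl_prenex:
  assumes "\<forall>j < k. stable_Sigma T j"
  shows "(\<phi> \<in> Pi_fm k \<longrightarrow> \<psi> \<in> Sigma_fm k \<longrightarrow>
      (\<exists>\<chi> \<in> Sigma_fm k. FV \<chi> = FV \<phi> \<union> FV \<psi> \<and> weqv T (Impl \<phi> \<psi>) \<chi>)) \<and>
   (\<phi> \<in> Sigma_fm k \<longrightarrow> \<psi> \<in> Pi_fm k \<longrightarrow>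
      (\<exists>\<chi> \<in> Pi_fm k. FV \<chi> = FV \<phi> \<union> FV \<psi> \<and> eqv T (Impl \<phi> \<psi>) \<chi>))"
  using assms
proof (induction k arbitrary: \<phi> \<psi>)
  case 0
  then show ?case
    by (auto simp: formulas_def intro!: exI[of _ "Impl \<phi> \<psi>"] eqv_refl eqv_imp_weqv)
next
  case (Suc k)
  have st: "stable_Sigma T k" "\<forall>j < k. stable_Sigma T j" using Suc.prems by auto
  have "\<exists>\<chi> \<in> Sigma_fm (Suc k). FV \<chi> = FV \<phi> \<union> FV \<psi> \<and> weqv T (Impl \<phi> \<psi>) \<chi>"
    if "\<phi> \<in> Pi_fm (Suc k)" "\<psi> \<in> Sigma_fm (Suc k)"
  proof (rule prenex_blocks[where op = Impl and R = "weqv T" and Q = Exists, OF _ _ _ _ _ _ _ _ _ _ _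
        Pi_fm.simps(2) Sigma_fm.simps(2) that])
    fix \<phi> \<psi> assume "\<phi> \<in> Sigma_fm k" "\<psi> \<in> Pi_fm k"
    then show "\<exists>\<chi> \<in> Sigma_fm (Suc k). FV \<chi> = FV \<phi> \<union> FV \<psi> \<and> weqv T (Impl \<phi> \<psi>) \<chi>"
      using Suc.IH[OF st(2), of \<phi> \<psi>] Pi_subset_Sigma_Suc eqv_imp_weqv by blast
  next
    fix n \<phi> \<psi> assume "\<phi> \<in> Sigma_fm k" "\<psi> \<in> Sigma_fm (Suc k)"
    \<comment> \<open>The scope of the \<forall> being pulled out is itself a Pi formula of level
      \<open>Suc k\<close>, stable by DNE(Sigma_k), as this shift demands.\<close>
    moreover from this(1) have "(Forall ^^ n) \<phi> \<in> Pi_fm (Suc k)" by auto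
    ultimately show "weqv T (Impl (Forall ((Forall ^^ n) \<phi>)) \<psi>)
        (Exists (Impl ((Forall ^^ n) \<phi>) (shift \<psi>)))"
      by (intro weqv_Impl_Forall1 stable_Pi_Suc[OF st(1)] Sigma_wf)
  qed (auto simp del: Sigma_fm.simps simp: Pi_wf Sigma_wf Exists_Sigma Pi_shift Sigma_shift
      intro: weqv_Exists weqv_trans weqv_Impl_Exists2)
  moreover have "\<exists>\<chi> \<in> Pi_fm (Suc k). FV \<chi> = FV \<phi> \<union> FV \<psi> \<and> eqv T (Impl \<phi> \<psi>) \<chi>"
    if "\<phi> \<in> Sigma_fm (Suc k)" "\<psi> \<in> Pi_fm (Suc k)"
  proof (rule prenex_blocks[where op = Impl and R = "eqv T" and Q = Forall, OF _ _ _ _ _ _ _ _ _ _ _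
        Sigma_fm.simps(2) Pi_fm.simps(2) that])
    fix \<phi> \<psi> assume *: "\<phi> \<in> Pi_fm k" "\<psi> \<in> Sigma_fm k"
    then obtain \<chi> where \<chi>: "\<chi> \<in> Sigma_fm k" "FV \<chi> = FV \<phi> \<union> FV \<psi>" "weqv T (Impl \<phi> \<psi>) \<chi>"
      using Suc.IH[OF st(2), of \<phi> \<psi>] by blast
    \<comment> \<open>Both sides of the weak equivalence are stable by DNE(Sigma_k), which turns it
      into an equivalence before the universal block is put in front.\<close>
    moreover have "stable T (Impl \<phi> \<psi>)" "stable T \<chi>"
      using st(1) * \<chi>(1) by (auto simp: stable_Sigma_def intro: stable_Impl Pi_wf)
    ultimately show "\<exists>\<chi> \<in> Pi_fm (Suc k). FV \<chi> = FV \<phi> \<union> FV \<psi> \<and> eqv T (Impl \<phi> \<psi>) \<chi>"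
      using weqv_stable Sigma_subset_Pi_Suc by blast
  qed (auto simp del: Pi_fm.simps simp: Pi_wf Sigma_wf Forall_Pi Pi_shift Sigma_shift
      intro: eqv_Forall eqv_trans eqv_Impl_Exists1 eqv_Impl_Forall2)
  ultimately show ?case by blast
qed

text \<open>
  The cumulative versions of the classes \<open>E\<close> (sign \<open>Plus\<close>) and \<open>U\<close> (sign \<open>Minus\<close>): they contain all
  formulas of smaller degree, and are therefore inherited by subformulas.
\<close>

definition paths_within :: "sign \<Rightarrow> nat \<Rightarrow> fm \<Rightarrow> bool" where
  "paths_within c k \<phi> \<longleftrightarrow>
     (\<forall>p \<in> Alt \<phi>. length p \<le> k \<and> (length p = k \<longrightarrow> init_sign p \<noteq> Some (opp c)))"

lemma opp_opp [simp]: "opp (opp c) = c"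
  by (cases c) simp_all

lemma opp_eq_iff [simp]: "opp c = opp d \<longleftrightarrow> c = d"
  by (cases c; cases d) simp_all

lemma length_perp [simp]: "length (perp p) = length p"
  by (simp add: perp_def)

lemma init_sign_simps [simp]: "init_sign [] = None" "init_sign (c # p) = Some c"
  by (simp_all add: init_sign_def)

lemma init_sign_perp [simp]: "init_sign (perp p) = map_option opp (init_sign p)"
  by (cases p) (simp_all add: perp_def)

lemma Alt_qfree: "qfree \<phi> \<Longrightarrow> Alt \<phi> = {[]}"
  by (cases \<phi>) simp_all

lemma Alt_finite_nonempty: "finite (Alt \<phi>) \<and> Alt \<phi> \<noteq> {}"
  by (induction \<phi>) (auto simp: setcompr_eq_image)

text \<open>A quantifier leaves only nonempty paths, and the connectives pass them on, so degree 0
  means quantifier-free.\<close>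

lemma Alt_not_qfree: "\<not> qfree \<phi> \<Longrightarrow> \<exists>p \<in> Alt \<phi>. p \<noteq> []"
proof (induction \<phi>)
  case (Impl \<phi> \<psi>)
  then show ?case by (cases "qfree \<phi>") (auto simp: perp_def)
next
  case (Forall \<phi>)
  have "p \<noteq> []" if "p \<in> Alt (Forall \<phi>)" for p using that by auto
  then show ?case using Alt_finite_nonempty[of "Forall \<phi>"] by blast
next
  case (Exists \<phi>)
  have "p \<noteq> []" if "p \<in> Alt (Exists \<phi>)" for p using that by auto
  then show ?case using Alt_finite_nonempty[of "Exists \<phi>"] by blast
qed auto

lemma paths_within_0: "paths_within c 0 \<phi> \<Longrightarrow> qfree \<phi>"
  using Alt_not_qfree by (fastforce simp: paths_within_def)

lemma paths_within_qfree: "qfree \<phi> \<Longrightarrow> paths_within c k \<phi>"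
  by (simp add: paths_within_def Alt_qfree)

lemma paths_within_Conj:
  "paths_within c k (Conj \<phi> \<psi>) \<Longrightarrow> paths_within c k \<phi> \<and> paths_within c k \<psi>"
  by (cases "qfree (Conj \<phi> \<psi>)") (simp add: paths_within_qfree, auto simp: paths_within_def)

lemma paths_within_perp:
  "(\<forall>p \<in> perp ` Alt \<phi>. length p \<le> k \<and> (length p = k \<longrightarrow> init_sign p \<noteq> Some (opp c))) \<longleftrightarrow>
   paths_within (opp c) k \<phi>"
proof -
  have "map_option opp x = Some (opp c) \<longleftrightarrow> x = Some c" for x
    by (cases x) simp_all
  then show ?thesis by (simp add: paths_within_def)
qed

lemma paths_within_Impl:
  "paths_within c k (Impl \<phi> \<psi>) \<Longrightarrow> paths_within (opp c) k \<phi> \<and> paths_within c k \<psi>"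
proof (cases "qfree (Impl \<phi> \<psi>)")
  case True
  then show ?thesis by (simp add: paths_within_qfree)
next
  case False
  assume *: "paths_within c k (Impl \<phi> \<psi>)"
  then have "paths_within (opp c) k \<phi>"
    using False unfolding paths_within_perp[symmetric]
    by (simp add: paths_within_def ball_Un split: if_splits)
  \<comment> \<open>For \<psi> = \<open>Bot\<close> the negation clause of \<open>Alt\<close> drops
    the consequent, but its only path is empty and meets the bound anyway.\<close>
  moreover have "paths_within c k \<psi>"
    using * False by (cases "\<psi> = Bot") (auto simp: paths_within_def split: if_splits)
  ultimately show ?thesis by simp
qed

text \<open>A path of the body either survives unchanged or gains a sign, so the bound passes down;
  in the second case the path of the body is even strictly shorter.\<close>

lemma paths_within_quantifier_same:
  "paths_within Plus k (Exists \<phi>) \<Longrightarrow> paths_within Plus k \<phi> \<and> 0 < k"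
  "paths_within Minus k (Forall \<phi>) \<Longrightarrow> paths_within Minus k \<phi> \<and> 0 < k"
proof -
  {
    assume *: "paths_within Plus k (Exists \<phi>)"
    have "length q \<le> k \<and> (length q = k \<longrightarrow> init_sign q \<noteq> Some Minus)" if "q \<in> Alt \<phi>" for q
      using bspec[OF *[unfolded paths_within_def], of q]
        bspec[OF *[unfolded paths_within_def], of "Plus # q"] that
      by (cases "init_sign q = Some Plus") simp_all
    moreover have "0 < k" using paths_within_0 * by (cases k) fastforce+
    ultimately show "paths_within Plus k \<phi> \<and> 0 < k" by (auto simp: paths_within_def)
  next
    assume *: "paths_within Minus k (Forall \<phi>)"
    have "length q \<le> k \<and> (length q = k \<longrightarrow> init_sign q \<noteq> Some Plus)" if "q \<in> Alt \<phi>" for q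
      using bspec[OF *[unfolded paths_within_def], of q]
        bspec[OF *[unfolded paths_within_def], of "Minus # q"] that
      by (cases "init_sign q = Some Minus") simp_all
    moreover have "0 < k" using paths_within_0 * by (cases k) fastforce+
    ultimately show "paths_within Minus k \<phi> \<and> 0 < k" by (auto simp: paths_within_def)
  }
qed

text \<open>All paths of a quantified formula start with the sign of that quantifier, which is
  forbidden at length \<open>k\<close> here. Hence all are shorter, and the formula lies in the
  opposite class one level below.\<close>

lemma paths_within_quantifier_opposite:
  "paths_within Plus k (Forall \<phi>) \<Longrightarrow> \<exists>j. k = Suc j \<and> paths_within Minus j (Forall \<phi>)"
  "paths_within Minus k (Exists \<phi>) \<Longrightarrow> \<exists>j. k = Suc j \<and> paths_within Plus j (Exists \<phi>)"
proof -
  {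
    assume *: "paths_within Plus k (Forall \<phi>)"
    then obtain j where "k = Suc j" using paths_within_0 by (cases k) fastforce+
    moreover have "init_sign q = Some Minus" if "q \<in> Alt (Forall \<phi>)" for q
      using that by auto
    ultimately show "\<exists>j. k = Suc j \<and> paths_within Minus j (Forall \<phi>)"
      using * unfolding paths_within_def by (auto simp del: Alt.simps simp: le_Suc_eq)
  next
    assume *: "paths_within Minus k (Exists \<phi>)"
    then obtain j where "k = Suc j" using paths_within_0 by (cases k) fastforce+
    moreover have "init_sign q = Some Plus" if "q \<in> Alt (Exists \<phi>)" for q
      using that by auto
    ultimately show "\<exists>j. k = Suc j \<and> paths_within Plus j (Exists \<phi>)"
      using * unfolding paths_within_def by (auto simp del: Alt.simps simp: le_Suc_eq)
  }
qed

text \<open>Both halves go through one induction because implication swaps them. The Sigma half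
  carries the weak and the conditional strong equivalence together: at level \<open>k\<close> only
  the weak one is certain, but below \<open>k\<close> the strong one is available.\<close>

lemma disj_free_prenex:
  assumes "disj_free \<phi>" "fm_wf \<phi>" "\<forall>j < k. stable_Sigma T j"
  shows "(paths_within Plus k \<phi> \<longrightarrow>
      (\<exists>\<sigma> \<in> Sigma_fm k. FV \<sigma> = FV \<phi> \<and> weqv T \<phi> \<sigma> \<and> (stable_Sigma T k \<longrightarrow> eqv T \<phi> \<sigma>))) \<and>
    (paths_within Minus k \<phi> \<longrightarrow> (\<exists>\<pi> \<in> Pi_fm k. FV \<pi> = FV \<phi> \<and> eqv T \<phi> \<pi>))"
    (is "?E k \<phi> \<and> ?U k \<phi>")
proof -
  have qf: "?E k \<phi> \<and> ?U k \<phi>" if "qfree \<phi>" "fm_wf \<phi>" for k \<phi>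
    using qfree_Sigma_Pi[OF that] eqv_refl[OF that(2)] eqv_imp_weqv by blast
  from assms show ?thesis
  proof (induction \<phi> arbitrary: k)
    case Bot
    show ?case by (rule qf) simp_all
  next
    case (Eq s t)
    then show ?case by (intro qf) simp_all
  next
    case (Conj \<phi> \<psi>)
    have IH: "?E k \<phi> \<and> ?U k \<phi>" "?E k \<psi> \<and> ?U k \<psi>"
      using Conj.IH[of k] Conj.prems by simp_all
    show ?case
    proof (intro conjI impI)
      assume "paths_within Plus k (Conj \<phi> \<psi>)"
      then obtain \<sigma> \<tau> where
        \<sigma>: "\<sigma> \<in> Sigma_fm k" "FV \<sigma> = FV \<phi>" "weqv T \<phi> \<sigma>" "stable_Sigma T k \<longrightarrow> eqv T \<phi> \<sigma>" and
        \<tau>: "\<tau> \<in> Sigma_fm k" "FV \<tau> = FV \<psi>" "weqv T \<psi> \<tau>" "stable_Sigma T k \<longrightarrow> eqv T \<psi> \<tau>"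
        using IH paths_within_Conj by blast
      from Conj_prenex \<sigma>(1) \<tau>(1) obtain \<chi>
        where \<chi>: "\<chi> \<in> Sigma_fm k" "FV \<chi> = FV \<sigma> \<union> FV \<tau>" "eqv T (Conj \<sigma> \<tau>) \<chi>" by blast
      have "weqv T (Conj \<phi> \<psi>) \<chi>"
        using weqv_trans[OF weqv_Conj eqv_imp_weqv] \<sigma>(3) \<tau>(3) \<chi>(3) by blast
      moreover have "eqv T (Conj \<phi> \<psi>) \<chi>" if "stable_Sigma T k"
        using eqv_trans[OF eqv_Conj \<chi>(3)] \<sigma>(4) \<tau>(4) that by blast
      ultimately show "\<exists>\<sigma> \<in> Sigma_fm k. FV \<sigma> = FV (Conj \<phi> \<psi>) \<and> weqv T (Conj \<phi> \<psi>) \<sigma> \<and>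
          (stable_Sigma T k \<longrightarrow> eqv T (Conj \<phi> \<psi>) \<sigma>)"
        using \<chi>(1,2) \<sigma>(2) \<tau>(2) by auto
    next
      assume "paths_within Minus k (Conj \<phi> \<psi>)"
      then obtain \<sigma> \<tau> where
        \<sigma>: "\<sigma> \<in> Pi_fm k" "FV \<sigma> = FV \<phi>" "eqv T \<phi> \<sigma>" and
        \<tau>: "\<tau> \<in> Pi_fm k" "FV \<tau> = FV \<psi>" "eqv T \<psi> \<tau>"
        using IH paths_within_Conj by blast
      from Conj_prenex \<sigma>(1) \<tau>(1) obtain \<chi>
        where \<chi>: "\<chi> \<in> Pi_fm k" "FV \<chi> = FV \<sigma> \<union> FV \<tau>" "eqv T (Conj \<sigma> \<tau>) \<chi>" by blast
      show "\<exists>\<pi> \<in> Pi_fm k. FV \<pi> = FV (Conj \<phi> \<psi>) \<and> eqv T (Conj \<phi> \<psi>) \<pi>"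
        using \<chi>(1,2) \<sigma>(2) \<tau>(2) eqv_trans[OF eqv_Conj[OF \<sigma>(3) \<tau>(3)] \<chi>(3)] by auto
    qed
  next
    case (Disj \<phi> \<psi>)
    then show ?case by simp
  next
    case (Impl \<phi> \<psi>)
    have IH: "?E k \<phi> \<and> ?U k \<phi>" "?E k \<psi> \<and> ?U k \<psi>"
      using Impl.IH[of k] Impl.prems by simp_all
    show ?case
    proof (cases "qfree (Impl \<phi> \<psi>)")
      case True
      then show ?thesis using Impl.prems by (intro qf)
    next
      case False
      show ?thesis
      proof (intro conjI impI)
        assume "paths_within Plus k (Impl \<phi> \<psi>)"
        then have "paths_within Minus k \<phi>" "paths_within Plus k \<psi>"
          using paths_within_Impl by fastforce+
        then obtain \<pi> \<sigma> where
          \<pi>: "\<pi> \<in> Pi_fm k" "FV \<pi> = FV \<phi>" "eqv T \<phi> \<pi>" and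
          \<sigma>: "\<sigma> \<in> Sigma_fm k" "FV \<sigma> = FV \<psi>" "weqv T \<psi> \<sigma>" "stable_Sigma T k \<longrightarrow> eqv T \<psi> \<sigma>"
          using IH by blast
        from Impl_prenex[OF Impl.prems(3)] \<pi>(1) \<sigma>(1) obtain \<chi>
          where \<chi>: "\<chi> \<in> Sigma_fm k" "FV \<chi> = FV \<pi> \<union> FV \<sigma>" "weqv T (Impl \<pi> \<sigma>) \<chi>" by blast
        have w: "weqv T (Impl \<phi> \<psi>) \<chi>"
          by (rule weqv_trans[OF weqv_Impl[OF \<pi>(3) \<sigma>(3)] \<chi>(3)])
        moreover have "eqv T (Impl \<phi> \<psi>) \<chi>" if st: "stable_Sigma T k"
        proof (rule weqv_stable[OF w])
          \<comment> \<open>With DNE(Sigma_k), stability passes from the Sigma form to \<psi> and to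
            the implication, so the weak equivalence becomes a strong one.\<close>
          have "stable T \<psi>"
            using st \<sigma>(1,4) by (auto simp: stable_Sigma_def intro: stable_eqv)
          then show "stable T (Impl \<phi> \<psi>)" using Impl.prems by (simp add: stable_Impl)
          show "stable T \<chi>" using st \<chi>(1) by (simp add: stable_Sigma_def)
        qed
        ultimately show "\<exists>\<sigma> \<in> Sigma_fm k. FV \<sigma> = FV (Impl \<phi> \<psi>) \<and> weqv T (Impl \<phi> \<psi>) \<sigma> \<and>
            (stable_Sigma T k \<longrightarrow> eqv T (Impl \<phi> \<psi>) \<sigma>)"
          using \<chi>(1,2) \<pi>(2) \<sigma>(2) by auto
      next
        assume U: "paths_within Minus k (Impl \<phi> \<psi>)"
        \<comment> \<open>At level 0 the implication would be quantifier-free. A positive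
          \<open>k\<close> makes DNE(Sigma_j) available, hence the Pi consequent stable, and a
          weakly equivalent antecedent is enough.\<close>
        then obtain j where k: "k = Suc j"
          using False paths_within_0 by (cases k) blast+
        from U have "paths_within Plus k \<phi>" "paths_within Minus k \<psi>"
          using paths_within_Impl by fastforce+
        then obtain \<sigma> \<pi> where
          \<sigma>: "\<sigma> \<in> Sigma_fm k" "FV \<sigma> = FV \<phi>" "weqv T \<phi> \<sigma>" and
          \<pi>: "\<pi> \<in> Pi_fm k" "FV \<pi> = FV \<psi>" "eqv T \<psi> \<pi>"
          using IH by blast
        from Impl_prenex[OF Impl.prems(3)] \<pi>(1) \<sigma>(1) obtain \<chi>
          where \<chi>: "\<chi> \<in> Pi_fm k" "FV \<chi> = FV \<sigma> \<union> FV \<pi>" "eqv T (Impl \<sigma> \<pi>) \<chi>" by blast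
        have "stable T \<pi>"
          using stable_Pi_Suc[of T j \<pi>] Impl.prems(3) \<pi>(1) k by blast
        then have "stable T \<psi>" by (rule stable_eqv[OF \<pi>(3)])
        then have "eqv T (Impl \<phi> \<psi>) \<chi>"
          using eqv_trans[OF eqv_Impl_weqv[OF \<sigma>(3) \<pi>(3)] \<chi>(3)] by blast
        then show "\<exists>\<pi> \<in> Pi_fm k. FV \<pi> = FV (Impl \<phi> \<psi>) \<and> eqv T (Impl \<phi> \<psi>) \<pi>"
          using \<chi>(1,2) \<pi>(2) \<sigma>(2) by auto
      qed
    qed
  next
    case (Forall \<phi>)
    \<comment> \<open>Needed at all levels up to \<open>k\<close>: the Sigma claim at
      \<open>k\<close> uses it at the predecessor, where the formula is already a Pi
      formula.\<close>
    have U: "?U j (Forall \<phi>)" if "j \<le> k" for j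
    proof
      assume "paths_within Minus j (Forall \<phi>)"
      from paths_within_quantifier_same(2)[OF this] obtain i
        where j: "j = Suc i" and w: "paths_within Minus j \<phi>" by (cases j) auto
      have "?E j \<phi> \<and> ?U j \<phi>"
        by (rule Forall.IH) (use Forall.prems that in auto)
      with w obtain \<pi> where "\<pi> \<in> Pi_fm j" "FV \<pi> = FV \<phi>" "eqv T \<phi> \<pi>"
        by blast
      then show "\<exists>\<pi> \<in> Pi_fm j. FV \<pi> = FV (Forall \<phi>) \<and> eqv T (Forall \<phi>) \<pi>"
        using Forall_Pi eqv_Forall unfolding j
        by (intro bexI[of _ "Forall \<pi>"]) (auto simp del: Pi_fm.simps)
    qed
    have "?E k (Forall \<phi>)"
    proof
      assume "paths_within Plus k (Forall \<phi>)"
      from paths_within_quantifier_opposite(1)[OF this] obtain j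
        where k: "k = Suc j" and w: "paths_within Minus j (Forall \<phi>)" by blast
      then show "\<exists>\<sigma> \<in> Sigma_fm k. FV \<sigma> = FV (Forall \<phi>) \<and> weqv T (Forall \<phi>) \<sigma> \<and>
          (stable_Sigma T k \<longrightarrow> eqv T (Forall \<phi>) \<sigma>)"
        using U[OF le_SucI[OF le_refl, of j, folded k]] Pi_subset_Sigma_Suc[of j] eqv_imp_weqv by blast
    qed
    with U[of k] show ?case by simp
  next
    case (Exists \<phi>)
    have E: "?E j (Exists \<phi>)" if "j \<le> k" for j
    proof
      assume "paths_within Plus j (Exists \<phi>)"
      from paths_within_quantifier_same(1)[OF this] obtain i
        where j: "j = Suc i" and w: "paths_within Plus j \<phi>" by (cases j) auto
      have "?E j \<phi> \<and> ?U j \<phi>"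
        by (rule Exists.IH) (use Exists.prems that in auto)
      with w obtain \<sigma> where "\<sigma> \<in> Sigma_fm j" "FV \<sigma> = FV \<phi>" "weqv T \<phi> \<sigma>"
          "stable_Sigma T j \<longrightarrow> eqv T \<phi> \<sigma>"
        by blast
      then show "\<exists>\<sigma> \<in> Sigma_fm j. FV \<sigma> = FV (Exists \<phi>) \<and> weqv T (Exists \<phi>) \<sigma> \<and>
          (stable_Sigma T j \<longrightarrow> eqv T (Exists \<phi>) \<sigma>)"
        using Exists_Sigma eqv_Exists weqv_Exists unfolding j
        by (intro bexI[of _ "Exists \<sigma>"]) (auto simp del: Sigma_fm.simps)
    qed
    have "?U k (Exists \<phi>)"
    proof
      assume "paths_within Minus k (Exists \<phi>)"
      from paths_within_quantifier_opposite(2)[OF this] obtain j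
        where k: "k = Suc j" and w: "paths_within Plus j (Exists \<phi>)" by blast
      then show "\<exists>\<pi> \<in> Pi_fm k. FV \<pi> = FV (Exists \<phi>) \<and> eqv T (Exists \<phi>) \<pi>"
        \<comment> \<open>DNE(Sigma_j) is assumed because \<open>j\<close> is below
          \<open>k\<close>, so the strong equivalence of the Sigma half applies.\<close>
        using E[OF le_SucI[OF le_refl, of j, folded k]] Sigma_subset_Pi_Suc[of j] Exists.prems(3)
        by blast
    qed
    with E[of k] show ?case by simp
  qed
qed

section \<open>From the classes of exact degree to the cumulative ones\<close>

lemma F_class_length: "\<phi> \<in> F_class k \<Longrightarrow> p \<in> Alt \<phi> \<Longrightarrow> length p \<le> k"
  using Alt_finite_nonempty[of \<phi>] by (auto simp: F_class_def deg_def)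

lemma E_class_paths_within: "\<phi> \<in> E_class k \<Longrightarrow> paths_within Plus k \<phi>"
  by (cases k) (auto simp: paths_within_def dest: F_class_length)

lemma U_class_paths_within: "\<phi> \<in> U_class k \<Longrightarrow> paths_within Minus k \<phi>"
  by (cases k) (auto simp: paths_within_def dest: F_class_length)

lemma E_class_wf: "\<phi> \<in> E_class k \<Longrightarrow> fm_wf \<phi>"
  by (cases k) (auto simp: F_class_def formulas_def)

lemma U_class_wf: "\<phi> \<in> U_class k \<Longrightarrow> fm_wf \<phi>"
  by (cases k) (auto simp: F_class_def formulas_def)

section \<open>Decidable formulas\<close>

text \<open>The axioms of HA are required as theorems, not as members of \<open>T\<close>, since
  being in between two theories constrains only the theorems.\<close>

locale arith =
  fixes T :: "fm set"
  assumes HA_theorem: "\<phi> \<in> HA \<Longrightarrow> deriv T [] \<phi>"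
begin

lemma HA_deriv: "\<phi> \<in> HA \<Longrightarrow> deriv T \<Gamma> \<phi>"
  by (rule deriv_weaken[OF HA_theorem]) simp_all

lemma Eq_refl: "tm_wf t \<Longrightarrow> deriv T \<Gamma> (Eq t t)"
  by (intro HA_deriv HA.eq_refl)

lemma Eq_subst:
  assumes "deriv T \<Gamma> (Eq s t)" "deriv T \<Gamma> (inst \<phi> s)" "fm_wf \<phi>"
  shows "deriv T \<Gamma> (inst \<phi> t)"
proof -
  have "deriv T \<Gamma> (Impl (Eq s t) (Impl (inst \<phi> s) (inst \<phi> t)))"
    using deriv_fm_wf[OF assms(1)] assms(3) by (intro HA_deriv HA.eq_subst) simp_all
  then show ?thesis using assms(1,2) by (blast intro: deriv.ImplE)
qed

lemma Eq_sym:
  assumes "deriv T \<Gamma> (Eq s t)"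
  shows "deriv T \<Gamma> (Eq t s)"
proof -
  have "tm_wf s" using deriv_fm_wf[OF assms] by simp
  then show ?thesis
    using Eq_subst[OF assms, of "Eq (Var 0) (subst_tm (\<lambda>i. Var (Suc i)) s)"]
    by (simp add: Eq_refl tm_wf_subst)
qed

lemma Eq_succ:
  assumes "deriv T \<Gamma> (Eq s t)"
  shows "deriv T \<Gamma> (Eq (succ s) (succ t))"
proof -
  have "tm_wf s" using deriv_fm_wf[OF assms] by simp
  then show ?thesis
    using Eq_subst[OF assms, of "Eq (succ (subst_tm (\<lambda>i. Var (Suc i)) s)) (succ (Var 0))"]
    by (simp add: Eq_refl tm_wf_subst)
qed

lemma succ_not_zero: "tm_wf t \<Longrightarrow> deriv T \<Gamma> (Neg (Eq (succ t) zero))"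
  by (intro HA_deriv HA.succ_not_zero)

lemma zero_not_succ:
  assumes "tm_wf t"
  shows "deriv T \<Gamma> (Neg (Eq zero (succ t)))"
  by (rule ImplI_worlds, use assms in simp)
    (blast intro: deriv.ImplE succ_not_zero[OF assms] Eq_sym)

lemma succ_inj:
  assumes "deriv T \<Gamma> (Eq (succ s) (succ t))"
  shows "deriv T \<Gamma> (Eq s t)"
  using deriv_fm_wf[OF assms] by (intro deriv.ImplE[OF HA_deriv assms] HA.succ_inj) simp_all

lemma induction_deriv:
  assumes "fm_wf \<phi>" "tm_wf s" "deriv T \<Gamma> (inst \<phi> zero)"
    and "\<And>t \<Delta>. tm_wf t \<Longrightarrow> set \<Gamma> \<subseteq> set \<Delta> \<Longrightarrow> deriv T \<Delta> (inst \<phi> t) \<Longrightarrow>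
      deriv T \<Delta> (inst \<phi> (succ t))"
  shows "deriv T \<Gamma> (inst \<phi> s)"
proof -
  let ?\<phi>S = "subst (case_nat (succ (Var 0)) (\<lambda>i. Var (Suc i))) \<phi>"
  have inst: "inst ?\<phi>S t = inst \<phi> (succ t)" for t
  proof -
    have "(\<lambda>i. subst_tm (case_nat t Var) (case_nat (succ (Var 0)) (\<lambda>i. Var (Suc i)) i)) =
        case_nat (succ t) Var"
      by (auto split: nat.split)
    then show ?thesis by (simp add: inst_def subst_subst)
  qed
  have "deriv T \<Gamma> (Forall (Impl \<phi> ?\<phi>S))"
    using assms(1,4) by (intro ForallI_all_terms) (auto simp: inst intro!: ImplI_worlds)
  moreover have "deriv T \<Gamma> (Impl (inst \<phi> zero) (Impl (Forall (Impl \<phi> ?\<phi>S)) (Forall \<phi>)))"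
    using assms(1) by (intro HA_deriv HA.induction_ax)
  ultimately have "deriv T \<Gamma> (Forall \<phi>)"
    using assms(3) by (blast intro: deriv.ImplE)
  then show ?thesis using assms(2) by (rule deriv.ForallE)
qed

text \<open>Double induction decides equality of arbitrary numbers, and instantiation covers all
  terms, whatever primitive recursive symbols they contain.\<close>

lemma decidable_Eq:
  assumes "tm_wf s" "tm_wf t"
  shows "decidable T (Eq s t)"
proof -
  let ?D = "\<lambda>s t. Disj (Eq s t) (Neg (Eq s t))"
  \<comment> \<open>The outer induction runs on the free variable, which is \<open>Var 1\<close>
    under the quantifier; the second argument stays universally quantified so that the hypothesis
    can be used at its predecessor.\<close>
  let ?\<phi> = "Forall (?D (Var 1) (Var 0))"
  let ?sh = "subst_tm (\<lambda>i. Var (Suc i))"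
  have inst: "inst ?\<phi> r = Forall (?D (?sh r) (Var 0))" for r
    by (simp add: inst_def up_def)
  have zero: "deriv T \<Gamma> (inst ?\<phi> zero)" for \<Gamma>
  proof -
    have "deriv T \<Gamma> (inst (?D zero (Var 0)) u)" if "tm_wf u" for u
      by (rule induction_deriv[OF _ that])
        (auto intro: deriv.DisjI1[OF Eq_refl] deriv.DisjI2[OF zero_not_succ])
    then show ?thesis unfolding inst by (intro ForallI_all_terms) simp
  qed
  have step: "deriv T \<Delta> (inst ?\<phi> (succ r))" if r: "tm_wf r" and d: "deriv T \<Delta> (inst ?\<phi> r)" for r \<Delta>
  proof -
    have *: "deriv T \<Delta>' (?D (succ r) (succ u))" if u: "tm_wf u" and s: "set \<Delta> \<subseteq> set \<Delta>'" for u \<Delta>'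
    proof -
      have "deriv T \<Delta>' (inst (?D (?sh r) (Var 0)) u)"
        using deriv_weaken[OF d s] u unfolding inst by (rule deriv.ForallE)
      then have "deriv T \<Delta>' (?D r u)" by simp
      then show ?thesis
      proof (rule DisjE_worlds)
        fix \<Delta>'' assume "deriv T \<Delta>'' (Eq r u)"
        then show "deriv T \<Delta>'' (?D (succ r) (succ u))"
          using r u by (intro deriv.DisjI1 Eq_succ) simp_all
      next
        fix \<Delta>'' assume n: "deriv T \<Delta>'' (Neg (Eq r u))"
        have "deriv T \<Delta>'' (Neg (Eq (succ r) (succ u)))"
        proof (rule ImplI_worlds)
          fix \<Delta>3 assume "set \<Delta>'' \<subseteq> set \<Delta>3" "deriv T \<Delta>3 (Eq (succ r) (succ u))"
          then show "deriv T \<Delta>3 Bot"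
            using deriv_weaken[OF n] succ_inj by (blast intro: deriv.ImplE)
        qed (use r u in simp)
        then show "deriv T \<Delta>'' (?D (succ r) (succ u))"
          using r u by (intro deriv.DisjI2) simp_all
      qed
    qed
    \<comment> \<open>Induction on \<open>u\<close> acts as a case distinction: zero differs from a
      successor, and for two successors * compares the predecessors.\<close>
    have "deriv T \<Delta> (inst (?D (succ (?sh r)) (Var 0)) u)" if "tm_wf u" for u
      by (rule induction_deriv[OF _ that])
        (use r in \<open>auto simp: tm_wf_subst intro: deriv.DisjI2[OF succ_not_zero] *\<close>)
    then show ?thesis unfolding inst by (intro ForallI_all_terms) simp
  qed
  have "deriv T [] (inst ?\<phi> s)"
    by (rule induction_deriv[OF _ assms(1) zero step]) simp_all
  then have "deriv T [] (inst (?D (?sh s) (Var 0)) t)"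
    unfolding inst using assms(2) by (rule deriv.ForallE)
  then show ?thesis by (simp add: decidable_def)
qed

end

section \<open>Closure of decidability under the connectives\<close>

lemma decidable_Conj:
  assumes "decidable T \<phi>" "decidable T \<psi>"
  shows "decidable T (Conj \<phi> \<psi>)"
proof -
  have [simp]: "fm_wf \<phi>" "fm_wf \<psi>" using assms by (auto dest: decidable_wf)
  show ?thesis unfolding decidable_def using decidable_deriv[OF assms(1)]
  proof (rule DisjE_worlds)
    fix \<Delta> assume f: "deriv T \<Delta> \<phi>"
    show "deriv T \<Delta> (Disj (Conj \<phi> \<psi>) (Neg (Conj \<phi> \<psi>)))"
      using decidable_deriv[OF assms(2)]
    proof (rule DisjE_worlds)
      fix \<Delta>' assume "set \<Delta> \<subseteq> set \<Delta>'" "deriv T \<Delta>' \<psi>"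
      then show "deriv T \<Delta>' (Disj (Conj \<phi> \<psi>) (Neg (Conj \<phi> \<psi>)))"
        using deriv_weaken[OF f] by (intro deriv.DisjI1 deriv.ConjI) simp_all
    next
      fix \<Delta>' assume "deriv T \<Delta>' (Neg \<psi>)"
      then show "deriv T \<Delta>' (Disj (Conj \<phi> \<psi>) (Neg (Conj \<phi> \<psi>)))"
        by (intro deriv.DisjI2) (simp_all add: deriv_Impl_iff deriv_Conj_iff)
    qed
  next
    fix \<Delta>' assume "deriv T \<Delta>' (Neg \<phi>)"
    then show "deriv T \<Delta>' (Disj (Conj \<phi> \<psi>) (Neg (Conj \<phi> \<psi>)))"
      by (intro deriv.DisjI2) (simp_all add: deriv_Impl_iff deriv_Conj_iff)
  qed
qed

lemma decidable_Disj:
  assumes "decidable T \<phi>" "decidable T \<psi>"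
  shows "decidable T (Disj \<phi> \<psi>)"
proof -
  have [simp]: "fm_wf \<phi>" "fm_wf \<psi>" using assms by (auto dest: decidable_wf)
  show ?thesis unfolding decidable_def using decidable_deriv[OF assms(1)]
  proof (rule DisjE_worlds)
    fix \<Delta> assume "deriv T \<Delta> \<phi>"
    then show "deriv T \<Delta> (Disj (Disj \<phi> \<psi>) (Neg (Disj \<phi> \<psi>)))"
      by (intro deriv.DisjI1) simp_all
  next
    fix \<Delta> assume f: "deriv T \<Delta> (Neg \<phi>)"
    show "deriv T \<Delta> (Disj (Disj \<phi> \<psi>) (Neg (Disj \<phi> \<psi>)))"
      using decidable_deriv[OF assms(2)]
    proof (rule DisjE_worlds)
      fix \<Delta>' assume "deriv T \<Delta>' \<psi>"
      then show "deriv T \<Delta>' (Disj (Disj \<phi> \<psi>) (Neg (Disj \<phi> \<psi>)))"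
        by (intro deriv.DisjI1 deriv.DisjI2[of _ _ \<psi>]) simp_all
    next
      fix \<Delta>' assume s: "set \<Delta> \<subseteq> set \<Delta>'" and n: "deriv T \<Delta>' (Neg \<psi>)"
      have "deriv T \<Delta>' (Neg (Disj \<phi> \<psi>))"
        using n deriv_weaken[OF f s]
        by (auto simp: deriv_Impl_iff intro: DisjE_worlds)
      then show "deriv T \<Delta>' (Disj (Disj \<phi> \<psi>) (Neg (Disj \<phi> \<psi>)))"
        by (intro deriv.DisjI2) simp_all
    qed
  qed
qed

lemma decidable_Impl:
  assumes "decidable T \<phi>" "decidable T \<psi>"
  shows "decidable T (Impl \<phi> \<psi>)"
proof -
  have [simp]: "fm_wf \<phi>" "fm_wf \<psi>" using assms by (auto dest: decidable_wf)
  show ?thesis unfolding decidable_def using decidable_deriv[OF assms(2)]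
  proof (rule DisjE_worlds)
    fix \<Delta> assume f: "deriv T \<Delta> \<psi>"
    then show "deriv T \<Delta> (Disj (Impl \<phi> \<psi>) (Neg (Impl \<phi> \<psi>)))"
      by (intro deriv.DisjI1) (simp_all add: deriv_Impl_iff deriv_weaken[OF f])
  next
    fix \<Delta> assume f: "deriv T \<Delta> (Neg \<psi>)"
    show "deriv T \<Delta> (Disj (Impl \<phi> \<psi>) (Neg (Impl \<phi> \<psi>)))"
      using decidable_deriv[OF assms(1)]
    proof (rule DisjE_worlds)
      fix \<Delta>' assume "set \<Delta> \<subseteq> set \<Delta>'" and p: "deriv T \<Delta>' \<phi>"
      then have "deriv T \<Delta>' (Neg (Impl \<phi> \<psi>))"
        using deriv_weaken[OF f, of \<Delta>'] deriv_weaken[OF p] by (simp add: deriv_Impl_iff)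
      then show "deriv T \<Delta>' (Disj (Impl \<phi> \<psi>) (Neg (Impl \<phi> \<psi>)))"
        by (intro deriv.DisjI2) simp_all
    next
      fix \<Delta>' assume n: "deriv T \<Delta>' (Neg \<phi>)"
      have "deriv T \<Delta>' (Impl \<phi> \<psi>)"
        by (rule ImplI_worlds) (auto intro: deriv_absurd[OF deriv_weaken[OF n]])
      then show "deriv T \<Delta>' (Disj (Impl \<phi> \<psi>) (Neg (Impl \<phi> \<psi>)))"
        by (intro deriv.DisjI1) simp_all
    qed
  qed
qed

lemma decidable_Bot: "decidable T Bot"
  unfolding decidable_def by (intro deriv.DisjI2 ImplI_worlds) simp_all

lemma (in arith) decidable_qfree: "qfree \<phi> \<Longrightarrow> fm_wf \<phi> \<Longrightarrow> decidable T \<phi>"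
  by (induction \<phi>)
    (simp_all add: decidable_Bot decidable_Eq decidable_Conj decidable_Disj decidable_Impl)

lemma (in arith) stable_Sigma_0: "stable_Sigma T 0"
  by (simp add: stable_Sigma_def formulas_def decidable_qfree decidable_stable)

section \<open>The negative translation\<close>

text \<open>
  The negative translation with falsity replaced by a formula \<open>\<alpha>\<close>, that is, Goedel-Gentzen followed
  by Friedman's A-translation.
\<close>

primrec tr :: "fm \<Rightarrow> fm \<Rightarrow> fm" where
  "tr \<alpha> Bot = \<alpha>"
| "tr \<alpha> (Eq s t) = Impl (Impl (Eq s t) \<alpha>) \<alpha>"
| "tr \<alpha> (Conj \<phi> \<psi>) = Conj (tr \<alpha> \<phi>) (tr \<alpha> \<psi>)"
| "tr \<alpha> (Disj \<phi> \<psi>) = Impl (Conj (Impl (tr \<alpha> \<phi>) \<alpha>) (Impl (tr \<alpha> \<psi>) \<alpha>)) \<alpha>"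
| "tr \<alpha> (Impl \<phi> \<psi>) = Impl (tr \<alpha> \<phi>) (tr \<alpha> \<psi>)"
| "tr \<alpha> (Forall \<phi>) = Forall (tr (shift \<alpha>) \<phi>)"
| "tr \<alpha> (Exists \<phi>) = Impl (Forall (Impl (tr (shift \<alpha>) \<phi>) (shift \<alpha>))) \<alpha>"

lemma fm_wf_tr [simp]: "fm_wf \<alpha> \<Longrightarrow> fm_wf (tr \<alpha> \<phi>) = fm_wf \<phi>"
  by (induction \<phi> arbitrary: \<alpha>) auto

lemma subst_tr: "subst \<sigma> (tr \<alpha> \<phi>) = tr (subst \<sigma> \<alpha>) (subst \<sigma> \<phi>)"
  by (induction \<phi> arbitrary: \<sigma> \<alpha>) (simp_all add: subst_up_shift)

lemma inst_tr: "inst (tr (shift \<alpha>) \<phi>) t = tr \<alpha> (inst \<phi> t)"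
  using inst_shift[of \<alpha> t] by (simp add: inst_def subst_tr)

lemma shift_tr: "shift (tr \<alpha> \<phi>) = tr (shift \<alpha>) (shift \<phi>)"
  by (simp add: shift_def subst_tr)

text \<open>Stability with \<alpha> in the role of falsity; for \<alpha> = \<open>Bot\<close> it is
  \<open>stable\<close>.\<close>

definition stable_rel :: "fm set \<Rightarrow> fm \<Rightarrow> fm \<Rightarrow> bool" where
  "stable_rel T \<alpha> \<phi> \<longleftrightarrow> entails T (Impl (Impl \<phi> \<alpha>) \<alpha>) \<phi>"

text \<open>The working form: the goal may be replaced by \<alpha>, with \<phi> \<rightarrow>
  \<alpha> as an extra assumption.\<close>

lemma stable_relD:
  assumes "stable_rel T \<alpha> \<phi>"
    and "\<And>\<Delta>. set \<Gamma> \<subseteq> set \<Delta> \<Longrightarrow> deriv T \<Delta> (Impl \<phi> \<alpha>) \<Longrightarrow> deriv T \<Delta> \<alpha>"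
  shows "deriv T \<Gamma> \<phi>"
proof -
  have "fm_wf \<alpha>" "fm_wf \<phi>" using assms(1) by (auto simp: stable_rel_def entails_def)
  then have "deriv T \<Gamma> (Impl (Impl \<phi> \<alpha>) \<alpha>)"
    using assms(2) by (intro ImplI_worlds) simp_all
  then show ?thesis using assms(1) by (auto simp: stable_rel_def intro: entailsD)
qed

lemma stable_rel_self: "fm_wf \<alpha> \<Longrightarrow> stable_rel T \<alpha> \<alpha>"
  by (auto simp: stable_rel_def deriv_Impl_iff intro!: entailsI)

lemma stable_rel_Impl:
  assumes "stable_rel T \<alpha> \<psi>" "fm_wf \<phi>"
  shows "stable_rel T \<alpha> (Impl \<phi> \<psi>)"
  unfolding stable_rel_def
proof (rule entailsI)
  have [simp]: "fm_wf \<phi>" "fm_wf \<alpha>" "fm_wf \<psi>"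
    using assms by (auto simp: stable_rel_def entails_def)
  then show "fm_wf (Impl (Impl (Impl \<phi> \<psi>) \<alpha>) \<alpha>)" "fm_wf (Impl \<phi> \<psi>)" by simp_all
  fix \<Gamma> assume d: "deriv T \<Gamma> (Impl (Impl (Impl \<phi> \<psi>) \<alpha>) \<alpha>)"
  show "deriv T \<Gamma> (Impl \<phi> \<psi>)"
  proof (rule ImplI_worlds)
    fix \<Delta> assume s: "set \<Gamma> \<subseteq> set \<Delta>" and p: "deriv T \<Delta> \<phi>"
    from assms(1) show "deriv T \<Delta> \<psi>"
    proof (rule stable_relD)
      fix \<Delta>' assume s': "set \<Delta> \<subseteq> set \<Delta>'" and i: "deriv T \<Delta>' (Impl \<psi> \<alpha>)"
      have "deriv T \<Delta>' (Impl (Impl \<phi> \<psi>) \<alpha>)"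
        using i deriv_weaken[OF p] s' by (simp add: deriv_Impl_iff)
      then show "deriv T \<Delta>' \<alpha>"
        using deriv_weaken[OF d, of \<Delta>'] s s' by (auto intro: deriv.ImplE)
    qed
  qed simp
qed

lemma stable_rel_Conj:
  assumes "stable_rel T \<alpha> \<phi>" "stable_rel T \<alpha> \<psi>"
  shows "stable_rel T \<alpha> (Conj \<phi> \<psi>)"
  unfolding stable_rel_def
proof (rule entailsI)
  have [simp]: "fm_wf \<phi>" "fm_wf \<alpha>" "fm_wf \<psi>"
    using assms by (auto simp: stable_rel_def entails_def)
  then show "fm_wf (Impl (Impl (Conj \<phi> \<psi>) \<alpha>) \<alpha>)" "fm_wf (Conj \<phi> \<psi>)" by simp_all
  fix \<Gamma> assume d: "deriv T \<Gamma> (Impl (Impl (Conj \<phi> \<psi>) \<alpha>) \<alpha>)"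
  have "deriv T \<Gamma> \<phi>" "deriv T \<Gamma> \<psi>"
    by (rule stable_relD[OF assms(1)] stable_relD[OF assms(2)],
        use d in \<open>simp add: deriv_Impl_iff deriv_Conj_iff\<close>)+
  then show "deriv T \<Gamma> (Conj \<phi> \<psi>)" by (rule deriv.ConjI)
qed

lemma stable_rel_Forall:
  assumes "stable_rel T (shift \<alpha>) \<phi>"
  shows "stable_rel T \<alpha> (Forall \<phi>)"
  unfolding stable_rel_def
proof (rule entailsI)
  have [simp]: "fm_wf \<phi>" "fm_wf \<alpha>"
    using assms by (auto simp: stable_rel_def entails_def)
  then show "fm_wf (Impl (Impl (Forall \<phi>) \<alpha>) \<alpha>)" "fm_wf (Forall \<phi>)" by simp_all
  fix \<Gamma> assume d: "deriv T \<Gamma> (Impl (Impl (Forall \<phi>) \<alpha>) \<alpha>)"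
  show "deriv T \<Gamma> (Forall \<phi>)"
  proof (rule ForallI_all_terms)
    fix t assume t [simp]: "tm_wf t"
    have "stable_rel T \<alpha> (inst \<phi> t)"
      using entails_inst[OF assms[unfolded stable_rel_def] t] by (simp add: stable_rel_def)
    then show "deriv T \<Gamma> (inst \<phi> t)"
    proof (rule stable_relD)
      fix \<Delta> assume s: "set \<Gamma> \<subseteq> set \<Delta>" and i: "deriv T \<Delta> (Impl (inst \<phi> t) \<alpha>)"
      have "deriv T \<Delta> (Impl (Forall \<phi>) \<alpha>)"
        using i by (simp add: deriv_Impl_iff deriv_Forall_iff)
      then show "deriv T \<Delta> \<alpha>" using deriv_weaken[OF d s] by (auto intro: deriv.ImplE)
    qed
  qed
qed

text \<open>Every translated formula is built from \<alpha> and implications into \<alpha> by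
  \<and>, \<rightarrow> and \<forall>, all of which preserve relative stability.\<close>

lemma stable_rel_tr: "fm_wf \<alpha> \<Longrightarrow> fm_wf \<phi> \<Longrightarrow> stable_rel T \<alpha> (tr \<alpha> \<phi>)"
  by (induction \<phi> arbitrary: \<alpha>)
    (simp_all add: stable_rel_self stable_rel_Impl stable_rel_Conj stable_rel_Forall)

lemma tr_Eq_intro: "deriv T \<Gamma> (Eq s t) \<Longrightarrow> fm_wf \<alpha> \<Longrightarrow> deriv T \<Gamma> (tr \<alpha> (Eq s t))"
  using deriv_fm_wf[of T \<Gamma> "Eq s t"]
  by (auto intro!: ImplI_worlds intro: deriv.ImplE deriv_weaken)

text \<open>The translated disjunction only asks that the relative negation of a formula and the
  relative negation of that negation be jointly absurd.\<close>

lemma tr_LEM: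
  assumes "fm_wf \<alpha>" "fm_wf \<phi>"
  shows "deriv T \<Gamma> (tr \<alpha> (Disj \<phi> (Neg \<phi>)))"
proof -
  have "deriv T \<Delta> \<alpha>"
    if "deriv T \<Delta> (Conj (Impl (tr \<alpha> \<phi>) \<alpha>) (Impl (Impl (tr \<alpha> \<phi>) \<alpha>) \<alpha>))" for \<Delta>
    using that unfolding deriv_Conj_iff by (blast intro: deriv.ImplE)
  then show ?thesis using assms by (auto intro!: ImplI_worlds)
qed

lemma tr_Forall_power:
  assumes "\<And>\<Gamma> \<alpha>. fm_wf \<alpha> \<Longrightarrow> deriv T \<Gamma> (tr \<alpha> \<phi>)" "fm_wf \<alpha>"
  shows "deriv T \<Gamma> (tr \<alpha> ((Forall ^^ n) \<phi>))"
  using assms(2) by (induction n arbitrary: \<Gamma> \<alpha>) (auto intro: assms(1) deriv.ForallI)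

context arith
begin

lemma tr_HA:
  assumes "\<phi> \<in> HA" and [simp]: "fm_wf \<alpha>"
  shows "deriv T \<Gamma> (tr \<alpha> \<phi>)"
  using assms(1)
proof cases
  case (eq_refl t)
  show ?thesis unfolding eq_refl by (rule tr_Eq_intro[OF HA_deriv]) (use assms eq_refl in auto)
next
  case (eq_subst s t \<psi>)
  note [simp] = eq_subst(2-)
  have "deriv T \<Gamma> (Impl (tr \<alpha> (Eq s t)) (Impl (tr \<alpha> (inst \<psi> s)) (tr \<alpha> (inst \<psi> t))))"
  proof (rule ImplI_worlds, simp, rule ImplI_worlds, simp)
    fix \<Delta> \<Delta>' assume s: "set \<Delta> \<subseteq> set \<Delta>'" and e: "deriv T \<Delta> (tr \<alpha> (Eq s t))"
      and p: "deriv T \<Delta>' (tr \<alpha> (inst \<psi> s))"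
    \<comment> \<open>Relative stability changes the goal to \<alpha>, and then the relatively
      doubly negated equation may be used as a plain one.\<close>
    have "stable_rel T \<alpha> (tr \<alpha> (inst \<psi> t))" by (rule stable_rel_tr) simp_all
    then show "deriv T \<Delta>' (tr \<alpha> (inst \<psi> t))"
    proof (rule stable_relD)
      fix \<Delta>'' assume s': "set \<Delta>' \<subseteq> set \<Delta>''" and i: "deriv T \<Delta>'' (Impl (tr \<alpha> (inst \<psi> t)) \<alpha>)"
      have "deriv T \<Delta>'' (Impl (Eq s t) \<alpha>)"
      proof (rule ImplI_worlds)
        fix \<Theta> assume s'': "set \<Delta>'' \<subseteq> set \<Theta>" and q: "deriv T \<Theta> (Eq s t)"
        have "deriv T \<Theta> (inst (tr (shift \<alpha>) \<psi>) s)"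
          using deriv_weaken[OF p, of \<Theta>] s' s'' by (simp add: inst_tr)
        from Eq_subst[OF q this] have "deriv T \<Theta> (tr \<alpha> (inst \<psi> t))" by (simp add: inst_tr)
        then show "deriv T \<Theta> \<alpha>" by (rule deriv.ImplE[OF deriv_weaken[OF i s'']])
      qed simp
      moreover have "deriv T \<Delta>'' (Impl (Impl (Eq s t) \<alpha>) \<alpha>)"
        using deriv_weaken[OF e, of \<Delta>''] s s' by simp
      ultimately show "deriv T \<Delta>'' \<alpha>" by (blast intro: deriv.ImplE)
    qed
  qed
  then show ?thesis using eq_subst(1) by simp
next
  case (succ_not_zero t)
  have "deriv T \<Delta> (Impl (Eq (succ t) zero) \<alpha>)" for \<Delta>
    by (rule ImplI_worlds)
      (use succ_not_zero(2) in \<open>auto intro: deriv_absurd[OF arith.succ_not_zero[OF arith_axioms]]\<close>)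
  then have "deriv T \<Gamma> (Impl (Impl (Impl (Eq (succ t) zero) \<alpha>) \<alpha>) \<alpha>)"
    using succ_not_zero(2) by (intro ImplI_worlds) (auto intro: deriv.ImplE)
  then show ?thesis unfolding succ_not_zero by simp
next
  case (succ_inj s t)
  note [simp] = succ_inj(2-)
  have "entails T (Eq (succ s) (succ t)) (Eq s t)"
    by (rule entailsI) (auto intro: arith.succ_inj[OF arith_axioms])
  then have "entails T (tr \<alpha> (Eq (succ s) (succ t))) (tr \<alpha> (Eq s t))"
    by (simp add: entails_Impl entails_refl)
  then have "deriv T [] (Impl (tr \<alpha> (Eq (succ s) (succ t))) (tr \<alpha> (Eq s t)))"
    by (simp only: entails_iff_theorem proves_def)
  then show ?thesis unfolding succ_inj by (auto intro: deriv_weaken)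
next
  case (proj n i ts)
  show ?thesis unfolding proj(1) by (rule tr_Eq_intro[OF HA_deriv]) (use assms proj in auto)
next
  case (comp n f gs ts)
  show ?thesis unfolding comp(1) by (rule tr_Eq_intro[OF HA_deriv]) (use assms comp in auto)
next
  case (rec_zero f g ts)
  show ?thesis unfolding rec_zero(1)
    by (rule tr_Eq_intro[OF HA_deriv]) (use assms rec_zero in auto)
next
  case (rec_succ f g ts s)
  show ?thesis unfolding rec_succ(1)
    by (rule tr_Eq_intro[OF HA_deriv]) (use assms rec_succ in auto)
next
  case (induction_ax \<psi>)
  \<comment> \<open>The shifted \<alpha> does not contain the induction variable, so the successor
    substitution leaves it alone and the translated axiom is induction for the translated
    formula.\<close>
  have "(\<lambda>i. subst_tm (case_nat (succ (Var 0)) (\<lambda>i. Var (Suc i))) (Var (Suc i))) = (\<lambda>i. Var (Suc i))"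
    by simp
  then have "subst (case_nat (succ (Var 0)) (\<lambda>i. Var (Suc i))) (shift \<alpha>) = shift \<alpha>"
    by (simp add: shift_def subst_subst)
  then have "tr \<alpha> \<phi> = Impl (inst (tr (shift \<alpha>) \<psi>) zero)
      (Impl (Forall (Impl (tr (shift \<alpha>) \<psi>)
        (subst (case_nat (succ (Var 0)) (\<lambda>i. Var (Suc i))) (tr (shift \<alpha>) \<psi>))))
      (Forall (tr (shift \<alpha>) \<psi>)))"
    unfolding induction_ax(1) by (simp add: inst_tr subst_tr)
  then show ?thesis
    using HA.induction_ax[of "tr (shift \<alpha>) \<psi>"] induction_ax(2) by (simp add: HA_deriv)
qed

text \<open>Classical axioms hold by \<open>tr_LEM\<close>. The eliminations of \<bottom>, \<or> and
  \<exists> rest on relative stability of the translated conclusion. The formula \<alpha> must vary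
  because rules with an eigenvariable shift it.\<close>

lemma tr_sound:
  "deriv PA \<Gamma> \<phi> \<Longrightarrow> fm_wf \<alpha> \<Longrightarrow> deriv T (map (tr \<alpha>) \<Gamma>) (tr \<alpha> \<phi>)"
proof (induction arbitrary: \<alpha> rule: deriv.induct)
  case (Axiom \<phi> \<Gamma>)
  then show ?case
    by (auto simp: PA_def LEM_def formulas_def intro: tr_HA tr_Forall_power tr_LEM simp del: tr.simps)
next
  case (Hyp \<phi> \<Gamma>)
  then show ?case by (intro deriv.Hyp) auto
next
  case (BotE \<Gamma> \<phi>)
  have "deriv T (map (tr \<alpha>) \<Gamma>) \<alpha>" using BotE.IH[OF BotE.prems] by simp
  then show ?case
    by (intro stable_relD[OF stable_rel_tr[OF BotE.prems BotE.hyps(2)]]) (rule deriv_weaken)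
next
  case (ConjI \<Gamma> \<phi> \<psi>)
  then show ?case by (auto intro: deriv.ConjI)
next
  case (ConjE1 \<Gamma> \<phi> \<psi>)
  then show ?case by (auto simp: deriv_Conj_iff)
next
  case (ConjE2 \<Gamma> \<phi> \<psi>)
  then show ?case by (auto simp: deriv_Conj_iff)
next
  case (DisjI1 \<Gamma> \<phi> \<psi>)
  have "deriv T \<Delta> \<alpha>" if "set (map (tr \<alpha>) \<Gamma>) \<subseteq> set \<Delta>"
    and "deriv T \<Delta> (Conj (Impl (tr \<alpha> \<phi>) \<alpha>) (Impl (tr \<alpha> \<psi>) \<alpha>))" for \<Delta>
    by (rule deriv.ImplE[OF deriv.ConjE1[OF that(2)]
          deriv_weaken[OF DisjI1.IH[OF DisjI1.prems] that(1)]])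
  moreover have "fm_wf \<phi>" using DisjI1.hyps(1) by (rule deriv_fm_wf)
  ultimately show ?case using DisjI1.prems DisjI1.hyps(2) by (auto intro!: ImplI_worlds)
next
  case (DisjI2 \<Gamma> \<psi> \<phi>)
  have "deriv T \<Delta> \<alpha>" if "set (map (tr \<alpha>) \<Gamma>) \<subseteq> set \<Delta>"
    and "deriv T \<Delta> (Conj (Impl (tr \<alpha> \<phi>) \<alpha>) (Impl (tr \<alpha> \<psi>) \<alpha>))" for \<Delta>
    by (rule deriv.ImplE[OF deriv.ConjE2[OF that(2)]
          deriv_weaken[OF DisjI2.IH[OF DisjI2.prems] that(1)]])
  moreover have "fm_wf \<psi>" using DisjI2.hyps(1) by (rule deriv_fm_wf)
  ultimately show ?case using DisjI2.prems DisjI2.hyps(2) by (auto intro!: ImplI_worlds)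
next
  case (DisjE \<Gamma> \<phi> \<psi> \<chi>)
  have wf: "fm_wf \<phi>" "fm_wf \<psi>" "fm_wf \<chi>"
    using DisjE.hyps deriv_fm_wf by fastforce+
  have l: "deriv T (map (tr \<alpha>) \<Gamma>) (Impl (tr \<alpha> \<phi>) (tr \<alpha> \<chi>))"
    using DisjE.IH(2)[OF DisjE.prems] wf DisjE.prems by (intro deriv.ImplI) simp_all
  have r: "deriv T (map (tr \<alpha>) \<Gamma>) (Impl (tr \<alpha> \<psi>) (tr \<alpha> \<chi>))"
    using DisjE.IH(3)[OF DisjE.prems] wf DisjE.prems by (intro deriv.ImplI) simp_all
  show ?case
  proof (rule stable_relD[OF stable_rel_tr[OF DisjE.prems wf(3)]])
    fix \<Delta> assume s: "set (map (tr \<alpha>) \<Gamma>) \<subseteq> set \<Delta>" and i: "deriv T \<Delta> (Impl (tr \<alpha> \<chi>) \<alpha>)"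
    have "deriv T \<Delta> (Impl (Conj (Impl (tr \<alpha> \<phi>) \<alpha>) (Impl (tr \<alpha> \<psi>) \<alpha>)) \<alpha>)"
      using deriv_weaken[OF DisjE.IH(1)[OF DisjE.prems] s] by simp
    moreover have "deriv T \<Delta> (Impl (tr \<alpha> \<phi>) \<alpha>)" "deriv T \<Delta> (Impl (tr \<alpha> \<psi>) \<alpha>)"
      using deriv_weaken[OF l s] deriv_weaken[OF r s] i wf DisjE.prems
      by (simp_all add: deriv_Impl_iff)
    ultimately show "deriv T \<Delta> \<alpha>" by (blast intro: deriv.ImplE deriv.ConjI)
  qed
next
  case (ImplI \<phi> \<Gamma> \<psi>)
  then show ?case by (auto intro: deriv.ImplI)
next
  case (ImplE \<Gamma> \<phi> \<psi>)
  from ImplE.IH[OF ImplE.prems] show ?case by (auto intro: deriv.ImplE)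
next
  case (ForallI \<Gamma> \<phi>)
  from ForallI.IH[of "shift \<alpha>"] ForallI.prems show ?case
    by (auto intro!: deriv.ForallI simp: comp_def shift_tr)
next
  case (ForallE \<Gamma> \<phi> t)
  from deriv.ForallE[OF ForallE.IH[OF ForallE.prems, simplified] ForallE.hyps(2)] show ?case
    by (simp add: inst_tr)
next
  case (ExistsI \<Gamma> \<phi> t)
  have "deriv T \<Delta> \<alpha>" if s: "set (map (tr \<alpha>) \<Gamma>) \<subseteq> set \<Delta>"
    and i: "deriv T \<Delta> (Forall (Impl (tr (shift \<alpha>) \<phi>) (shift \<alpha>)))" for \<Delta>
    using deriv.ImplE[OF _ deriv_weaken[OF ExistsI.IH[OF ExistsI.prems] s]]
      deriv.ForallE[OF i ExistsI.hyps(2)] by (simp add: inst_tr)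
  then show ?case using ExistsI.hyps(3) ExistsI.prems by (auto intro!: ImplI_worlds)
next
  case (ExistsE \<Gamma> \<phi> \<psi>)
  have wf: "fm_wf \<phi>" "fm_wf \<psi>"
    using deriv_fm_wf[OF ExistsE.hyps(1)] deriv_fm_wf[OF ExistsE.hyps(2)] by simp_all
  have "deriv T (map shift (map (tr \<alpha>) \<Gamma>)) (Impl (tr (shift \<alpha>) \<phi>) (shift (tr \<alpha> \<psi>)))"
    using ExistsE.IH(2)[of "shift \<alpha>"] ExistsE.prems wf
    by (intro deriv.ImplI) (simp_all add: shift_tr comp_def)
  then have d: "deriv T (map (tr \<alpha>) \<Gamma>) (Forall (Impl (tr (shift \<alpha>) \<phi>) (shift (tr \<alpha> \<psi>))))"
    by (rule deriv.ForallI)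
  show ?case
  proof (rule stable_relD[OF stable_rel_tr[OF ExistsE.prems wf(2)]])
    fix \<Delta> assume s: "set (map (tr \<alpha>) \<Gamma>) \<subseteq> set \<Delta>" and i: "deriv T \<Delta> (Impl (tr \<alpha> \<psi>) \<alpha>)"
    have "deriv T \<Delta> (Forall (Impl (tr (shift \<alpha>) \<phi>) (shift \<alpha>)))"
      using deriv_weaken[OF d s] i ExistsE.prems wf
      by (simp add: deriv_Forall_iff deriv_Impl_iff)
    then show "deriv T \<Delta> \<alpha>"
      using deriv_weaken[OF ExistsE.IH(1)[OF ExistsE.prems] s] by (auto intro: deriv.ImplE)
  qed
qed

end

section \<open>Conservativity of classical arithmetic\<close>

text \<open>If \<phi> is refuted, then \<phi> \<rightarrow> \<alpha> is vacuous and the relative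
  double negation gives \<alpha>.\<close>

lemma eqv_relative_dneg:
  assumes "decidable T \<phi>" and [simp]: "fm_wf \<alpha>"
  shows "eqv T (Impl (Impl \<phi> \<alpha>) \<alpha>) (Disj \<phi> \<alpha>)"
proof -
  have [simp]: "fm_wf \<phi>" using assms(1) by (rule decidable_wf)
  show ?thesis
  proof (rule eqvI)
    fix \<Gamma> assume d: "deriv T \<Gamma> (Impl (Impl \<phi> \<alpha>) \<alpha>)"
    show "deriv T \<Gamma> (Disj \<phi> \<alpha>)"
      using decidable_deriv[OF assms(1)]
    proof (rule DisjE_worlds)
      fix \<Delta> assume "deriv T \<Delta> \<phi>"
      then show "deriv T \<Delta> (Disj \<phi> \<alpha>)" by (rule deriv.DisjI1) simp
    next
      fix \<Delta> assume s: "set \<Gamma> \<subseteq> set \<Delta>" and n: "deriv T \<Delta> (Neg \<phi>)"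
      have "deriv T \<Delta> (Impl \<phi> \<alpha>)"
        by (rule ImplI_worlds) (auto intro: deriv_absurd[OF deriv_weaken[OF n]])
      then have "deriv T \<Delta> \<alpha>" by (rule deriv.ImplE[OF deriv_weaken[OF d s]])
      then show "deriv T \<Delta> (Disj \<phi> \<alpha>)" by (rule deriv.DisjI2) simp
    qed
  next
    fix \<Gamma> assume "deriv T \<Gamma> (Disj \<phi> \<alpha>)"
    then show "deriv T \<Gamma> (Impl (Impl \<phi> \<alpha>) \<alpha>)"
    proof (rule DisjE_worlds)
      fix \<Delta> assume "deriv T \<Delta> \<phi>"
      then show "deriv T \<Delta> (Impl (Impl \<phi> \<alpha>) \<alpha>)"
        by (simp add: deriv_Impl_iff) (meson deriv_weaken order_refl)
    next
      fix \<Delta> assume "deriv T \<Delta> \<alpha>"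
      then show "deriv T \<Delta> (Impl (Impl \<phi> \<alpha>) \<alpha>)"
        by (simp add: deriv_Impl_iff deriv_weaken)
    qed
  qed simp_all
qed

lemma eqv_Conj_Disj:
  assumes [simp]: "fm_wf \<phi>" "fm_wf \<psi>" "fm_wf \<alpha>"
  shows "eqv T (Conj (Disj \<phi> \<alpha>) (Disj \<psi> \<alpha>)) (Disj (Conj \<phi> \<psi>) \<alpha>)"
proof (rule eqvI)
  fix \<Gamma> assume d: "deriv T \<Gamma> (Conj (Disj \<phi> \<alpha>) (Disj \<psi> \<alpha>))"
  show "deriv T \<Gamma> (Disj (Conj \<phi> \<psi>) \<alpha>)"
    using deriv.ConjE1[OF d]
  proof (rule DisjE_worlds)
    fix \<Delta> assume s: "set \<Gamma> \<subseteq> set \<Delta>" and p: "deriv T \<Delta> \<phi>"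
    show "deriv T \<Delta> (Disj (Conj \<phi> \<psi>) \<alpha>)"
      using deriv_weaken[OF deriv.ConjE2[OF d] s]
    proof (rule DisjE_worlds)
      fix \<Delta>' assume "set \<Delta> \<subseteq> set \<Delta>'" "deriv T \<Delta>' \<psi>"
      then show "deriv T \<Delta>' (Disj (Conj \<phi> \<psi>) \<alpha>)"
        using deriv_weaken[OF p] by (intro deriv.DisjI1 deriv.ConjI) simp_all
    qed (rule deriv.DisjI2, simp_all)
  qed (rule deriv.DisjI2, simp_all)
next
  fix \<Gamma> assume "deriv T \<Gamma> (Disj (Conj \<phi> \<psi>) \<alpha>)"
  then show "deriv T \<Gamma> (Conj (Disj \<phi> \<alpha>) (Disj \<psi> \<alpha>))"
    by (rule DisjE_worlds) (auto simp: deriv_Conj_iff intro: deriv.DisjI1 deriv.DisjI2)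
qed simp_all

text \<open>Deciding the antecedent says which disjunct to choose before the antecedent is
  assumed.\<close>

lemma eqv_Impl_Disj:
  assumes "decidable T \<phi>" and [simp]: "fm_wf \<psi>" "fm_wf \<alpha>"
  shows "eqv T (Impl (Disj \<phi> \<alpha>) (Disj \<psi> \<alpha>)) (Disj (Impl \<phi> \<psi>) \<alpha>)"
proof -
  have [simp]: "fm_wf \<phi>" using assms(1) by (rule decidable_wf)
  show ?thesis
  proof (rule eqvI)
    fix \<Gamma> assume d: "deriv T \<Gamma> (Impl (Disj \<phi> \<alpha>) (Disj \<psi> \<alpha>))"
    show "deriv T \<Gamma> (Disj (Impl \<phi> \<psi>) \<alpha>)"
      using decidable_deriv[OF assms(1)]
    proof (rule DisjE_worlds)
      fix \<Delta> assume s: "set \<Gamma> \<subseteq> set \<Delta>" and "deriv T \<Delta> \<phi>"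
      then have "deriv T \<Delta> (Disj \<psi> \<alpha>)"
        using deriv.ImplE[OF deriv_weaken[OF d s] deriv.DisjI1] by simp
      then show "deriv T \<Delta> (Disj (Impl \<phi> \<psi>) \<alpha>)"
      proof (rule DisjE_worlds)
        fix \<Delta>' assume p: "deriv T \<Delta>' \<psi>"
        show "deriv T \<Delta>' (Disj (Impl \<phi> \<psi>) \<alpha>)"
          by (intro deriv.DisjI1 ImplI_worlds deriv_weaken[OF p]) simp_all
      qed (rule deriv.DisjI2, simp_all)
    next
      fix \<Delta> assume n: "deriv T \<Delta> (Neg \<phi>)"
      have "deriv T \<Delta> (Impl \<phi> \<psi>)"
        by (rule ImplI_worlds) (auto intro: deriv_absurd[OF deriv_weaken[OF n]])
      then show "deriv T \<Delta> (Disj (Impl \<phi> \<psi>) \<alpha>)" by (rule deriv.DisjI1) simp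
    qed
  next
    fix \<Gamma> assume "deriv T \<Gamma> (Disj (Impl \<phi> \<psi>) \<alpha>)"
    then show "deriv T \<Gamma> (Impl (Disj \<phi> \<alpha>) (Disj \<psi> \<alpha>))"
    proof (rule DisjE_worlds)
      fix \<Delta> assume "deriv T \<Delta> (Impl \<phi> \<psi>)"
      then have fwd: "deriv T \<Delta>' \<psi>" if "set \<Delta> \<subseteq> set \<Delta>'" "deriv T \<Delta>' \<phi>" for \<Delta>'
        using that by (simp add: deriv_Impl_iff)
      show "deriv T \<Delta> (Impl (Disj \<phi> \<alpha>) (Disj \<psi> \<alpha>))"
      proof (rule ImplI_worlds)
        fix \<Delta>' assume s: "set \<Delta> \<subseteq> set \<Delta>'" and "deriv T \<Delta>' (Disj \<phi> \<alpha>)"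
        from this(2) show "deriv T \<Delta>' (Disj \<psi> \<alpha>)"
        proof (rule DisjE_worlds)
          fix \<Theta> assume "set \<Delta>' \<subseteq> set \<Theta>" "deriv T \<Theta> \<phi>"
          then show "deriv T \<Theta> (Disj \<psi> \<alpha>)"
            using s fwd by (intro deriv.DisjI1) auto
        qed (rule deriv.DisjI2, simp_all)
      qed simp
    next
      fix \<Delta> assume a: "deriv T \<Delta> \<alpha>"
      show "deriv T \<Delta> (Impl (Disj \<phi> \<alpha>) (Disj \<psi> \<alpha>))"
        by (intro ImplI_worlds deriv.DisjI2 deriv_weaken[OF a]) simp_all
    qed
  qed simp_all
qed

lemma eqv_Conj_Impl_Disj:
  assumes [simp]: "fm_wf \<phi>" "fm_wf \<psi>" "fm_wf \<alpha>"
  shows "eqv T (Conj (Impl (Disj \<phi> \<alpha>) \<alpha>) (Impl (Disj \<psi> \<alpha>) \<alpha>)) (Impl (Disj \<phi> \<psi>) \<alpha>)"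
proof (rule eqvI)
  fix \<Gamma> assume d: "deriv T \<Gamma> (Conj (Impl (Disj \<phi> \<alpha>) \<alpha>) (Impl (Disj \<psi> \<alpha>) \<alpha>))"
  show "deriv T \<Gamma> (Impl (Disj \<phi> \<psi>) \<alpha>)"
  proof (rule ImplI_worlds)
    fix \<Delta> assume s: "set \<Gamma> \<subseteq> set \<Delta>" and "deriv T \<Delta> (Disj \<phi> \<psi>)"
    note d = deriv_weaken[OF d s, unfolded deriv_Conj_iff]
    from \<open>deriv T \<Delta> (Disj \<phi> \<psi>)\<close> show "deriv T \<Delta> \<alpha>"
    proof (rule DisjE_worlds)
      fix \<Delta>' assume "set \<Delta> \<subseteq> set \<Delta>'" "deriv T \<Delta>' \<phi>"
      then show "deriv T \<Delta>' \<alpha>"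
        using deriv.ImplE[OF deriv_weaken[OF conjunct1[OF d]] deriv.DisjI1, of \<Delta>'] by simp
    next
      fix \<Delta>' assume "set \<Delta> \<subseteq> set \<Delta>'" "deriv T \<Delta>' \<psi>"
      then show "deriv T \<Delta>' \<alpha>"
        using deriv.ImplE[OF deriv_weaken[OF conjunct2[OF d]] deriv.DisjI1, of \<Delta>'] by simp
    qed
  qed simp
next
  fix \<Gamma> assume d: "deriv T \<Gamma> (Impl (Disj \<phi> \<psi>) \<alpha>)"
  have l: "deriv T \<Delta> \<alpha>" if "set \<Gamma> \<subseteq> set \<Delta>" "deriv T \<Delta> \<phi>" for \<Delta>
    using deriv.ImplE[OF deriv_weaken[OF d that(1)] deriv.DisjI1[OF that(2)]] by simp
  have r: "deriv T \<Delta> \<alpha>" if "set \<Gamma> \<subseteq> set \<Delta>" "deriv T \<Delta> \<psi>" for \<Delta>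
    using deriv.ImplE[OF deriv_weaken[OF d that(1)] deriv.DisjI2[OF that(2)]] by simp
  show "deriv T \<Gamma> (Conj (Impl (Disj \<phi> \<alpha>) \<alpha>) (Impl (Disj \<psi> \<alpha>) \<alpha>))"
    by (intro deriv.ConjI ImplI_worlds) (simp_all, (erule DisjE_worlds, auto intro: l r)+)
qed simp_all

lemma entails_Exists_dneg:
  assumes [simp]: "fm_wf \<phi>" "fm_wf \<alpha>"
  shows "entails T (Exists \<phi>) (Impl (Forall (Impl \<phi> (shift \<alpha>))) \<alpha>)"
proof (rule entailsI)
  fix \<Gamma> assume e: "deriv T \<Gamma> (Exists \<phi>)"
  show "deriv T \<Gamma> (Impl (Forall (Impl \<phi> (shift \<alpha>))) \<alpha>)"
  proof (rule ImplI_worlds)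
    fix \<Delta> assume s: "set \<Gamma> \<subseteq> set \<Delta>" and "deriv T \<Delta> (Forall (Impl \<phi> (shift \<alpha>)))"
    then have "deriv T \<Delta> (Impl (Exists \<phi>) \<alpha>)" by (simp add: eqvD[OF eqv_Impl_Exists1])
    then show "deriv T \<Delta> \<alpha>" using deriv_weaken[OF e s] by (rule deriv.ImplE)
  qed simp
qed simp_all

text \<open>With decidable components every connective commutes with adding \<alpha> as a
  disjunct.\<close>

lemma (in arith) tr_qfree:
  "qfree \<phi> \<Longrightarrow> fm_wf \<phi> \<Longrightarrow> fm_wf \<alpha> \<Longrightarrow> eqv T (tr \<alpha> \<phi>) (Disj \<phi> \<alpha>)"
proof (induction \<phi>)
  case Bot
  then show ?case
    by (intro eqvI) (auto intro: deriv.DisjI2 elim: DisjE_worlds deriv.BotE)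
next
  case (Eq s t)
  then show ?case by (simp add: eqv_relative_dneg decidable_Eq)
next
  case (Conj \<phi> \<psi>)
  then show ?case using eqv_trans[OF eqv_Conj eqv_Conj_Disj] by simp
next
  case (Disj \<phi> \<psi>)
  have "eqv T (Conj (Impl (tr \<alpha> \<phi>) \<alpha>) (Impl (tr \<alpha> \<psi>) \<alpha>)) (Impl (Disj \<phi> \<psi>) \<alpha>)"
    using Disj by (intro eqv_trans[OF eqv_Conj eqv_Conj_Impl_Disj] eqv_Impl eqv_refl) simp_all
  then have "eqv T (tr \<alpha> (Disj \<phi> \<psi>)) (Impl (Impl (Disj \<phi> \<psi>) \<alpha>) \<alpha>)"
    using Disj.prems by (simp add: eqv_Impl eqv_refl)
  then show ?case
    using Disj.prems by (intro eqv_trans[OF _ eqv_relative_dneg] decidable_qfree)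
next
  case (Impl \<phi> \<psi>)
  then show ?case
    using eqv_trans[OF eqv_Impl eqv_Impl_Disj] decidable_qfree by simp
qed simp_all

text \<open>Above the matrix there are only quantifiers: \<forall> is translated as itself,
  \<exists> as something weaker, and both are monotone. So the claim holds at every level without
  any decidability beyond the matrix.\<close>

lemma (in arith) prenex_entails_tr:
  "fm_wf \<alpha> \<Longrightarrow> (\<phi> \<in> Sigma_fm k \<longrightarrow> entails T \<phi> (tr \<alpha> \<phi>)) \<and> (\<phi> \<in> Pi_fm k \<longrightarrow> entails T \<phi> (tr \<alpha> \<phi>))"
proof (induction k arbitrary: \<phi> \<alpha>)
  case 0
  have "entails T \<phi> (tr \<alpha> \<phi>)" if "qfree \<phi>" "fm_wf \<phi>"
  proof (rule entailsI)
    fix \<Gamma> assume "deriv T \<Gamma> \<phi>"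
    then show "deriv T \<Gamma> (tr \<alpha> \<phi>)"
      using eqvD[OF tr_qfree[OF that 0]] 0 deriv.DisjI1 by blast
  qed (use that 0 in simp_all)
  then show ?case by (simp add: formulas_def)
next
  case (Suc k)
  have "entails T \<phi> (tr \<alpha> \<phi>)" if "\<phi> \<in> Sigma_fm (Suc k)" for \<phi>
    using that Suc.prems
  proof (induction arbitrary: \<alpha> rule: Sigma_Suc_induct)
    case (Pi \<phi>)
    then show ?case using Suc.IH by blast
  next
    case (Exists \<phi>)
    have "entails T (Exists \<phi>) (Exists (tr (shift \<alpha>) \<phi>))"
      using Exists.IH[of "shift \<alpha>"] Exists.prems by (simp add: entails_Exists)
    then show ?case
      using entails_trans[OF _ entails_Exists_dneg] Exists.prems Sigma_wf[OF Exists.hyps] by simp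
  qed
  moreover have "entails T \<phi> (tr \<alpha> \<phi>)" if "\<phi> \<in> Pi_fm (Suc k)" for \<phi>
    using that Suc.prems
  proof (induction arbitrary: \<alpha> rule: Pi_Suc_induct)
    case (Sigma \<phi>)
    then show ?case using Suc.IH by blast
  next
    case (Forall \<phi>)
    then show ?case by (simp add: entails_Forall)
  qed
  ultimately show ?case by blast
qed

section \<open>Levels of the hierarchy at which all formulas are decidable\<close>

definition decidable_level :: "fm set \<Rightarrow> nat \<Rightarrow> bool" where
  "decidable_level T k \<longleftrightarrow> (\<forall>\<phi> \<in> Sigma_fm k \<union> Pi_fm k. decidable T \<phi>)"

lemma decidable_level_mono: "decidable_level T k \<Longrightarrow> j \<le> k \<Longrightarrow> decidable_level T j"
  using Sigma_mono Pi_mono by (fastforce simp: decidable_level_def)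

lemma decidable_level_stable: "decidable_level T k \<Longrightarrow> j \<le> k \<Longrightarrow> stable_Sigma T j"
  using decidable_level_mono by (fastforce simp: decidable_level_def stable_Sigma_def decidable_stable)

lemma Bot_Sigma_Pi: "Bot \<in> Sigma_fm k" "Bot \<in> Pi_fm k"
  by (simp_all add: qfree_Sigma_Pi)

lemma stable_Neg: "fm_wf \<phi> \<Longrightarrow> stable T (Neg \<phi>)"
  by (simp add: stable_Impl decidable_stable decidable_Bot)

text \<open>The negation of a Sigma_k formula has a Pi_k form, which LEM(Pi_k) decides; in the
  negative case DNE(Sigma_k) removes the double negation.\<close>

lemma decidable_levelI:
  assumes st: "\<forall>j \<le> k. stable_Sigma T j" and Pi: "\<And>\<phi>. \<phi> \<in> Pi_fm k \<Longrightarrow> decidable T \<phi>"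
  shows "decidable_level T k"
proof -
  have "decidable T \<phi>" if \<phi>: "\<phi> \<in> Sigma_fm k" for \<phi>
  proof -
    have [simp]: "fm_wf \<phi>" using \<phi> by (rule Sigma_wf)
    obtain \<chi> where \<chi>: "\<chi> \<in> Pi_fm k" "eqv T (Neg \<phi>) \<chi>"
      using Impl_prenex[of k T \<phi> Bot] \<phi> Bot_Sigma_Pi st by auto
    have "eqv T (Neg (Neg \<phi>)) \<phi>"
      using st \<phi> by (auto simp: stable_Sigma_def stable_def eqv_def entails_NegNeg)
    then have "eqv T (Neg \<chi>) \<phi>"
      using eqv_trans[OF eqv_Impl[OF eqv_sym[OF \<chi>(2)] eqv_refl]] by simp
    then have "entails T (Disj \<chi> (Neg \<chi>)) (Disj (Neg \<phi>) \<phi>)"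
      using \<chi>(2) by (auto simp: eqv_def intro: entails_Disj)
    then have "deriv T [] (Disj (Neg \<phi>) \<phi>)"
      using Pi[OF \<chi>(1)] by (auto simp: decidable_def intro: entailsD)
    then show ?thesis
      unfolding decidable_def by (rule DisjE_worlds) (auto intro: deriv.DisjI1 deriv.DisjI2)
  qed
  then show ?thesis using Pi by (auto simp: decidable_level_def)
qed

text \<open>The two sides are weakly equivalent. The right one is stable: the negation of \<phi> has
  a Sigma form, and a further \<exists> joins its leading block without raising the level.\<close>

lemma entails_Neg_Forall:
  assumes "decidable_level T (Suc k)" "\<phi> \<in> Pi_fm (Suc k)"
  shows "entails T (Neg (Forall \<phi>)) (Exists (Neg \<phi>))"
proof -
  have [simp]: "fm_wf \<phi>" using assms(2) by (rule Pi_wf)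
  have st: "\<forall>j \<le> Suc k. stable_Sigma T j"
    using decidable_level_stable[OF assms(1)] by blast
  obtain \<chi> where \<chi>: "\<chi> \<in> Sigma_fm (Suc k)" "weqv T (Neg \<phi>) \<chi>"
    using Impl_prenex[of "Suc k" T \<phi> Bot] assms(2) Bot_Sigma_Pi(1)[of "Suc k"] st
    by (metis less_imp_le)
  have "eqv T (Neg \<phi>) \<chi>"
    using \<chi> st by (intro weqv_stable stable_Neg) (auto simp: stable_Sigma_def simp del: Sigma_fm.simps)
  then have "eqv T (Exists (Neg \<phi>)) (Exists \<chi>)" by (rule eqv_Exists)
  then have "stable T (Exists (Neg \<phi>))"
    using st Exists_Sigma[OF \<chi>(1)]
    by (auto simp: stable_Sigma_def simp del: Sigma_fm.simps intro: stable_eqv)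
  moreover have "weqv T (Neg (Forall \<phi>)) (Exists (Neg \<phi>))"
    using weqv_Impl_Forall1[of T \<phi> Bot] assms
    by (auto simp: decidable_level_def intro: decidable_stable)
  ultimately have "eqv T (Neg (Forall \<phi>)) (Exists (Neg \<phi>))"
    by (intro weqv_stable stable_Neg) simp_all
  then show ?thesis by (simp add: eqv_def)
qed

text \<open>The constant domain law, by deciding the universal formula: a counterexample to \<phi>
  forces \<alpha>.\<close>

lemma entails_Forall_Disj:
  assumes "decidable T (Forall \<phi>)" "entails T (Neg (Forall \<phi>)) (Exists (Neg \<phi>))" and [simp]: "fm_wf \<alpha>"
  shows "entails T (Forall (Disj \<phi> (shift \<alpha>))) (Disj (Forall \<phi>) \<alpha>)"
proof (rule entailsI)
  have [simp]: "fm_wf \<phi>" using decidable_wf[OF assms(1)] by simp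
  then show "fm_wf (Forall (Disj \<phi> (shift \<alpha>)))" "fm_wf (Disj (Forall \<phi>) \<alpha>)" by simp_all
  fix \<Gamma> assume d: "deriv T \<Gamma> (Forall (Disj \<phi> (shift \<alpha>)))"
  show "deriv T \<Gamma> (Disj (Forall \<phi>) \<alpha>)"
    using decidable_deriv[OF assms(1)]
  proof (rule DisjE_worlds)
    fix \<Delta> assume "deriv T \<Delta> (Forall \<phi>)"
    then show "deriv T \<Delta> (Disj (Forall \<phi>) \<alpha>)" by (rule deriv.DisjI1) simp
  next
    fix \<Delta> assume s: "set \<Gamma> \<subseteq> set \<Delta>" and "deriv T \<Delta> (Neg (Forall \<phi>))"
    from entailsD[OF assms(2) this(2)] have "deriv T \<Delta> \<alpha>"
    proof (rule ExistsE_all_terms)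
      fix t \<Delta>' assume t: "tm_wf t" and s': "set \<Delta> \<subseteq> set \<Delta>'" and n: "deriv T \<Delta>' (inst (Neg \<phi>) t)"
      have "deriv T \<Delta>' (Disj (inst \<phi> t) \<alpha>)"
        using deriv.ForallE[OF deriv_weaken[OF d, of \<Delta>'] t] s s' by simp
      then show "deriv T \<Delta>' \<alpha>"
      proof (rule DisjE_worlds)
        fix \<Theta> assume "set \<Delta>' \<subseteq> set \<Theta>" "deriv T \<Theta> (inst \<phi> t)"
        then show "deriv T \<Theta> \<alpha>" using deriv_absurd[of T \<Theta> "inst \<phi> t"] deriv_weaken[OF n] by simp
      qed
    qed
    then show "deriv T \<Delta> (Disj (Forall \<phi>) \<alpha>)" by (rule deriv.DisjI2) simp
  qed
qed

text \<open>Decidability of the whole level lets \<or> \<alpha> be moved outward through the prefix: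
  through \<exists> by deciding the existential formula, through \<forall> by the constant domain
  law.\<close>

lemma (in arith) tr_entails_Disj:
  "decidable_level T k \<Longrightarrow> fm_wf \<alpha> \<Longrightarrow>
   (\<phi> \<in> Sigma_fm k \<longrightarrow> entails T (tr \<alpha> \<phi>) (Disj \<phi> \<alpha>)) \<and>
   (\<phi> \<in> Pi_fm k \<longrightarrow> entails T (tr \<alpha> \<phi>) (Disj \<phi> \<alpha>))"
proof (induction k arbitrary: \<phi> \<alpha>)
  case 0
  then show ?case using tr_qfree by (simp add: formulas_def eqv_def)
next
  case (Suc k)
  have lev: "decidable_level T k" by (rule decidable_level_mono[OF Suc.prems(1)]) simp
  have "entails T (tr \<alpha> \<phi>) (Disj \<phi> \<alpha>)" if "\<phi> \<in> Sigma_fm (Suc k)" for \<phi>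
    using that Suc.prems(2)
  proof (induction arbitrary: \<alpha> rule: Sigma_Suc_induct)
    case (Pi \<phi>)
    then show ?case using Suc.IH[OF lev] by blast
  next
    case (Exists \<phi>)
    note [simp] = Exists.prems Sigma_wf[OF Exists.hyps]
    have "decidable T (Exists \<phi>)"
      using Suc.prems(1) Exists_Sigma[OF Exists.hyps]
      by (auto simp: decidable_level_def simp del: Sigma_fm.simps)
    then have dn: "entails T (Impl (Impl (Exists \<phi>) \<alpha>) \<alpha>) (Disj (Exists \<phi>) \<alpha>)"
      using eqv_relative_dneg by (simp add: eqv_def)
    \<comment> \<open>The induction hypothesis yields only \<phi> or \<alpha>, but in front of the
      conclusion \<alpha> the second alternative is harmless.\<close>
    have "entails T (Impl \<phi> (shift \<alpha>)) (Impl (Disj \<phi> (shift \<alpha>)) (shift \<alpha>))"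
      by (rule entailsI) (auto simp: deriv_Impl_iff elim: DisjE_worlds)
    then have "entails T (Impl \<phi> (shift \<alpha>)) (Impl (tr (shift \<alpha>) \<phi>) (shift \<alpha>))"
      by (rule entails_trans) (simp add: Exists.IH entails_Impl entails_refl)
    then have "entails T (Forall (Impl \<phi> (shift \<alpha>))) (Forall (Impl (tr (shift \<alpha>) \<phi>) (shift \<alpha>)))"
      by (rule entails_Forall)
    with eqv_Impl_Exists1[of \<phi> \<alpha> T]
    have "entails T (Impl (Exists \<phi>) \<alpha>) (Forall (Impl (tr (shift \<alpha>) \<phi>) (shift \<alpha>)))"
      by (auto simp: eqv_def intro: entails_trans)
    then have "entails T (tr \<alpha> (Exists \<phi>)) (Impl (Impl (Exists \<phi>) \<alpha>) \<alpha>)"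
      by (simp add: entails_Impl entails_refl)
    then show ?case using dn by (rule entails_trans)
  qed
  moreover have "entails T (tr \<alpha> \<phi>) (Disj \<phi> \<alpha>)" if "\<phi> \<in> Pi_fm (Suc k)" for \<phi>
    using that Suc.prems(2)
  proof (induction arbitrary: \<alpha> rule: Pi_Suc_induct)
    case (Sigma \<phi>)
    then show ?case using Suc.IH[OF lev] by blast
  next
    case (Forall \<phi>)
    have "decidable T (Forall \<phi>)"
      using Suc.prems(1) Forall_Pi[OF Forall.hyps]
      by (auto simp: decidable_level_def simp del: Pi_fm.simps)
    then have "entails T (Forall (Disj \<phi> (shift \<alpha>))) (Disj (Forall \<phi>) \<alpha>)"
      using entails_Neg_Forall[OF Suc.prems(1) Forall.hyps] Forall.prems by (rule entails_Forall_Disj)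
    moreover have "entails T (tr \<alpha> (Forall \<phi>)) (Forall (Disj \<phi> (shift \<alpha>)))"
      using Forall.IH[of "shift \<alpha>"] Forall.prems by (simp add: entails_Forall)
    ultimately show ?case by (rule entails_trans[rotated])
  qed
  ultimately show ?case by blast
qed

lemma entails_shift: "entails T \<phi> \<psi> \<Longrightarrow> entails T (shift \<phi>) (shift \<psi>)"
  using theorem_subst[of T "Impl \<phi> \<psi>" "\<lambda>i. Var (Suc i)" "[]"]
  by (simp add: entails_iff_theorem proves_def shift_def)

text \<open>In the shifted context the free index 0 of \<phi> is itself the witness.\<close>

lemma entails_shift_Exists:
  assumes "fm_wf \<phi>"
  shows "entails T \<phi> (shift (Exists \<phi>))"
proof (rule entailsI)
  let ?\<sigma> = "up (\<lambda>i. Var (Suc i))"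
  have sh: "shift (Exists \<phi>) = Exists (subst ?\<sigma> \<phi>)" by (simp add: shift_def)
  have "(\<lambda>i. subst_tm (case_nat (Var 0) Var) (?\<sigma> i)) = Var"
    by (auto simp: up_def split: nat.split)
  then have inst: "inst (subst ?\<sigma> \<phi>) (Var 0) = \<phi>" by (simp add: inst_def subst_subst)
  show "fm_wf (shift (Exists \<phi>))" using assms by simp
  then have "fm_wf (subst ?\<sigma> \<phi>)" by (simp add: sh del: fm_wf_shift)
  then show "deriv T \<Gamma> (shift (Exists \<phi>))" if "deriv T \<Gamma> \<phi>" for \<Gamma>
    unfolding sh using that by (intro deriv.ExistsI[where t = "Var 0"]) (simp_all add: inst)
qed (rule assms)

text \<open>The leading existential block requires no decidability: once the translated body implies
  \<alpha>, the relative double negation yields \<alpha>. The hypothesis that \<phi> entails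
  \<alpha>, rather than \<alpha> = \<phi>, is what survives when a quantifier is stripped.\<close>

lemma (in arith) tr_Sigma_Suc_entails:
  assumes "decidable_level T k" "\<phi> \<in> Sigma_fm (Suc k)" "entails T \<phi> \<alpha>"
  shows "entails T (tr \<alpha> \<phi>) \<alpha>"
  using assms(2,3)
proof (induction arbitrary: \<alpha> rule: Sigma_Suc_induct)
  case (Pi \<phi>)
  have [simp]: "fm_wf \<alpha>" using Pi.prems by (rule entails_wf)
  have "entails T (tr \<alpha> \<phi>) (Disj \<phi> \<alpha>)" using tr_entails_Disj[OF assms(1)] Pi.hyps by simp
  moreover have "entails T (Disj \<phi> \<alpha>) \<alpha>"
    using entails_wf[OF Pi.prems]
    by (intro entailsI) (auto elim: DisjE_worlds intro: entailsD[OF Pi.prems])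
  ultimately show ?case by (rule entails_trans)
next
  case (Exists \<phi>)
  note wf [simp] = Sigma_wf[OF Exists.hyps] entails_wf(2)[OF Exists.prems]
  have "entails T \<phi> (shift \<alpha>)"
    using entails_trans[OF entails_shift_Exists entails_shift[OF Exists.prems]] by simp
  then have *: "entails T (tr (shift \<alpha>) \<phi>) (shift \<alpha>)" by (rule Exists.IH)
  have "deriv T \<Gamma> (Forall (Impl (tr (shift \<alpha>) \<phi>) (shift \<alpha>)))" for \<Gamma>
    by (intro deriv.ForallI ImplI_worlds) (auto intro: entailsD[OF *])
  then show ?case by (auto intro!: entailsI intro: deriv.ImplE)
qed

text \<open>With falsity \<phi>, the translated theorem gives the relative double negation of the
  translation of \<phi>. Relative stability removes it, and the translation implies \<phi>. The
  level of \<psi> is arbitrary, as \<psi> is only used through implying its own translation.\<close>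

theorem (in arith) PA_conservative:
  assumes "decidable_level T k" and \<phi>: "\<phi> \<in> Sigma_fm (Suc k)" and \<psi>: "\<psi> \<in> Sigma_fm m \<union> Pi_fm m"
    and PA: "PA \<turnstile> Impl \<psi> (Neg (Neg \<phi>))"
  shows "entails T \<psi> \<phi>"
proof -
  have wf [simp]: "fm_wf \<phi>" using \<phi> by (rule Sigma_wf)
  have "deriv T [] (tr \<phi> (Impl \<psi> (Neg (Neg \<phi>))))"
    using tr_sound[OF PA[unfolded proves_def] wf] by simp
  then have "entails T (tr \<phi> \<psi>) (Impl (Impl (tr \<phi> \<phi>) \<phi>) \<phi>)"
    by (simp add: entails_iff_theorem proves_def)
  moreover have "entails T (Impl (Impl (tr \<phi> \<phi>) \<phi>) \<phi>) (tr \<phi> \<phi>)"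
    using stable_rel_tr[OF wf wf] by (simp add: stable_rel_def)
  moreover have "entails T \<psi> (tr \<phi> \<psi>)" using prenex_entails_tr[OF wf] \<psi> by blast
  moreover have "entails T (tr \<phi> \<phi>) \<phi>"
    using assms(1) \<phi> entails_refl[OF wf] by (rule tr_Sigma_Suc_entails)
  ultimately show ?thesis by (blast intro: entails_trans)
qed

section \<open>The equivalences\<close>

lemma disj_free_subst [simp]: "disj_free (subst \<sigma> \<phi>) = disj_free \<phi>"
  by (induction \<phi> arbitrary: \<sigma>) simp_all

lemma subst_eq_Bot [simp]: "subst \<sigma> \<phi> = Bot \<longleftrightarrow> \<phi> = Bot"
  by (cases \<phi>) simp_all

lemma Alt_subst [simp]: "Alt (subst \<sigma> \<phi>) = Alt \<phi>"
  by (induction \<phi> arbitrary: \<sigma>) simp_all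

lemma disj_free_shift [simp]: "disj_free (shift \<phi>) = disj_free \<phi>"
  and Alt_shift [simp]: "Alt (shift \<phi>) = Alt \<phi>"
  by (simp_all add: shift_def)

lemma eqv_Disj_disj_free:
  assumes "stable T (Disj \<phi> \<psi>)"
  shows "eqv T (Disj \<phi> \<psi>) (Neg (Conj (Neg \<phi>) (Neg \<psi>)))"
proof -
  have [simp]: "fm_wf \<phi>" "fm_wf \<psi>" using stable_wf[OF assms] by simp_all
  have "eqv T (Neg (Disj \<phi> \<psi>)) (Conj (Neg \<phi>) (Neg \<psi>))"
  proof (rule eqvI)
    fix \<Gamma> assume d: "deriv T \<Gamma> (Neg (Disj \<phi> \<psi>))"
    have "deriv T \<Delta> Bot" if "set \<Gamma> \<subseteq> set \<Delta>" "deriv T \<Delta> \<phi> \<or> deriv T \<Delta> \<psi>" for \<Delta>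
    proof (rule deriv.ImplE[OF deriv_weaken[OF d that(1)]])
      show "deriv T \<Delta> (Disj \<phi> \<psi>)" using that(2) by (auto intro: deriv.DisjI1 deriv.DisjI2)
    qed
    then show "deriv T \<Gamma> (Conj (Neg \<phi>) (Neg \<psi>))"
      by (intro deriv.ConjI ImplI_worlds) simp_all
  next
    fix \<Gamma> assume d: "deriv T \<Gamma> (Conj (Neg \<phi>) (Neg \<psi>))"
    show "deriv T \<Gamma> (Neg (Disj \<phi> \<psi>))"
    proof (rule ImplI_worlds)
      fix \<Delta> assume s: "set \<Gamma> \<subseteq> set \<Delta>" and "deriv T \<Delta> (Disj \<phi> \<psi>)"
      from this(2) show "deriv T \<Delta> Bot"
        by (rule DisjE_worlds) (use s d in \<open>auto simp: deriv_Conj_iff deriv_Impl_iff\<close>)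
    qed simp
  qed simp_all
  then have "eqv T (Neg (Neg (Disj \<phi> \<psi>))) (Neg (Conj (Neg \<phi>) (Neg \<psi>)))"
    by (simp add: eqv_Impl eqv_refl)
  moreover have "eqv T (Disj \<phi> \<psi>) (Neg (Neg (Disj \<phi> \<psi>)))"
    using assms by (simp add: eqv_def stable_def entails_NegNeg)
  ultimately show ?thesis by (rule eqv_trans[rotated])
qed

text \<open>Matrices are decidable, so De Morgan eliminates their disjunctions.\<close>

lemma (in arith) qfree_disj_free:
  "qfree \<phi> \<Longrightarrow> fm_wf \<phi> \<Longrightarrow> \<exists>\<psi>. qfree \<psi> \<and> disj_free \<psi> \<and> eqv T \<phi> \<psi>"
proof (induction \<phi>)
  case (Conj \<phi> \<psi>)
  then obtain \<phi>' \<psi>' where "qfree \<phi>'" "disj_free \<phi>'" "eqv T \<phi> \<phi>'" "qfree \<psi>'" "disj_free \<psi>'" "eqv T \<psi> \<psi>'"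
    by auto
  then show ?case by (intro exI[of _ "Conj \<phi>' \<psi>'"]) (simp add: eqv_Conj)
next
  case (Impl \<phi> \<psi>)
  then obtain \<phi>' \<psi>' where "qfree \<phi>'" "disj_free \<phi>'" "eqv T \<phi> \<phi>'" "qfree \<psi>'" "disj_free \<psi>'" "eqv T \<psi> \<psi>'"
    by auto
  then show ?case by (intro exI[of _ "Impl \<phi>' \<psi>'"]) (simp add: eqv_Impl)
next
  case (Disj \<phi> \<psi>)
  then obtain \<phi>' \<psi>' where *: "qfree \<phi>'" "disj_free \<phi>'" "eqv T \<phi> \<phi>'" "qfree \<psi>'" "disj_free \<psi>'"
    "eqv T \<psi> \<psi>'"
    by auto
  then have "stable T (Disj \<phi>' \<psi>')"
    by (intro decidable_stable decidable_qfree) (auto dest: eqv_wf)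
  then show ?case
    using * eqv_trans[OF eqv_Disj[OF *(3,6)] eqv_Disj_disj_free]
    by (intro exI[of _ "Neg (Conj (Neg \<phi>') (Neg \<psi>'))"]) simp
next
  case Bot
  then show ?case using eqv_refl[of Bot T] disj_free.simps(1) by blast
next
  case (Eq s t)
  then show ?case using eqv_refl[of "Eq s t" T] by (intro exI[of _ "Eq s t"]) simp
qed simp_all

primrec alt_path :: "nat \<Rightarrow> sign \<Rightarrow> sign list" where
  "alt_path 0 c = []"
| "alt_path (Suc k) c = c # alt_path k (opp c)"

lemma length_alt_path [simp]: "length (alt_path k c) = k"
  by (induction k arbitrary: c) simp_all

lemma init_sign_alt_path: "init_sign (alt_path k (opp c)) \<noteq> Some c"
  by (cases k; cases c) simp_all

text \<open>Only the innermost quantifier of the block adds a sign, since the path below is empty or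
  starts with \<open>Minus\<close>; the others find \<open>Plus\<close> already in front.\<close>

lemma Alt_Exists_power:
  "Alt \<phi> = {alt_path k Minus} \<Longrightarrow> Alt ((Exists ^^ Suc n) \<phi>) = {alt_path (Suc k) Plus}"
  using init_sign_alt_path[of k Plus] by (induction n) auto

lemma Alt_Forall_power:
  "Alt \<phi> = {alt_path k Plus} \<Longrightarrow> Alt ((Forall ^^ Suc n) \<phi>) = {alt_path (Suc k) Minus}"
  using init_sign_alt_path[of k Minus] by (induction n) auto

lemma disj_free_power [simp]:
  "disj_free ((Exists ^^ n) \<phi>) = disj_free \<phi>" "disj_free ((Forall ^^ n) \<phi>) = disj_free \<phi>"
  by (induction n) simp_all

lemma eqv_power:
  assumes "eqv T \<phi> \<psi>"
  shows "eqv T ((Exists ^^ n) \<phi>) ((Exists ^^ n) \<psi>)" "eqv T ((Forall ^^ n) \<phi>) ((Forall ^^ n) \<psi>)"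
  using assms by (induction n) (simp_all add: eqv_Exists eqv_Forall)

text \<open>A dummy quantifier in every block gives a prenex formula its nominal degree.\<close>

lemma (in arith) prenex_exact_degree:
  "(\<phi> \<in> Sigma_fm k \<longrightarrow> (\<exists>\<psi>. disj_free \<psi> \<and> Alt \<psi> = {alt_path k Plus} \<and> eqv T \<phi> \<psi>)) \<and>
   (\<phi> \<in> Pi_fm k \<longrightarrow> (\<exists>\<psi>. disj_free \<psi> \<and> Alt \<psi> = {alt_path k Minus} \<and> eqv T \<phi> \<psi>))"
proof (induction k arbitrary: \<phi>)
  case 0
  show ?case using qfree_disj_free[of \<phi>] Alt_qfree by (auto simp: formulas_def)
next
  case (Suc k)
  have "\<exists>\<psi>. disj_free \<psi> \<and> Alt \<psi> = {alt_path (Suc k) Plus} \<and> eqv T \<phi> \<psi>"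
    if \<phi>: "\<phi> \<in> Sigma_fm (Suc k)"
  proof -
    obtain n \<phi>0 where \<phi>0: "\<phi> = (Exists ^^ n) \<phi>0" "\<phi>0 \<in> Pi_fm k" using \<phi> by auto
    obtain \<psi> where \<psi>: "disj_free \<psi>" "Alt \<psi> = {alt_path k Minus}" "eqv T \<phi>0 \<psi>"
      using Suc.IH \<phi>0(2) by blast
    \<comment> \<open>The dummy quantifier is innermost in its block, so the block has
      \<open>Suc n\<close> quantifiers and is nonempty even for \<open>n = 0\<close>.\<close>
    have "eqv T \<phi>0 (Exists (shift \<psi>))"
      using eqv_trans[OF \<psi>(3) eqv_Exists_shift] eqv_wf[OF \<psi>(3)] by blast
    then have "eqv T \<phi> ((Exists ^^ Suc n) (shift \<psi>))"
      unfolding \<phi>0(1) funpow_Suc_right comp_apply by (rule eqv_power)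
    then show ?thesis
      using \<psi> Alt_Exists_power[of "shift \<psi>" k n] by (metis Alt_shift disj_free_shift disj_free_power(1))
  qed
  moreover have "\<exists>\<psi>. disj_free \<psi> \<and> Alt \<psi> = {alt_path (Suc k) Minus} \<and> eqv T \<phi> \<psi>"
    if \<phi>: "\<phi> \<in> Pi_fm (Suc k)"
  proof -
    obtain n \<phi>0 where \<phi>0: "\<phi> = (Forall ^^ n) \<phi>0" "\<phi>0 \<in> Sigma_fm k" using \<phi> by auto
    obtain \<psi> where \<psi>: "disj_free \<psi>" "Alt \<psi> = {alt_path k Plus}" "eqv T \<phi>0 \<psi>"
      using Suc.IH \<phi>0(2) by blast
    have "eqv T \<phi>0 (Forall (shift \<psi>))"
      using eqv_trans[OF \<psi>(3) eqv_Forall_shift] eqv_wf[OF \<psi>(3)] by blast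
    then have "eqv T \<phi> ((Forall ^^ Suc n) (shift \<psi>))"
      unfolding \<phi>0(1) funpow_Suc_right comp_apply by (rule eqv_power)
    then show ?thesis
      using \<psi> Alt_Forall_power[of "shift \<psi>" k n] by (metis Alt_shift disj_free_shift disj_free_power(2))
  qed
  ultimately show ?case by blast
qed

lemma Alt_NegNeg:
  assumes "Alt \<phi> = {alt_path (Suc k) c}"
  shows "Alt (Neg (Neg \<phi>)) = {alt_path (Suc k) c}"
proof -
  have "\<not> qfree \<phi>" using assms Alt_qfree by auto
  then show ?thesis using assms by (simp add: perp_def comp_def)
qed

lemma singleton_Alt_E_class:
  "fm_wf \<phi> \<Longrightarrow> Alt \<phi> = {alt_path (Suc k) Plus} \<Longrightarrow> \<phi> \<in> E_class (Suc k)"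
  by (simp add: F_class_def deg_def formulas_def)

lemma singleton_Alt_U_class:
  "fm_wf \<phi> \<Longrightarrow> Alt \<phi> = {alt_path (Suc k) Minus} \<Longrightarrow> \<phi> \<in> U_class (Suc k)"
  by (simp add: F_class_def deg_def formulas_def)

section \<open>The schemata and theories in between\<close>

lemma proves_DNE_Sigma_iff: "T \<turnstile>\<^sub>S DNE (Sigma_fm k) \<longleftrightarrow> stable_Sigma T k"
proof
  assume *: "T \<turnstile>\<^sub>S DNE (Sigma_fm k)"
  have "stable T \<phi>" if \<phi>: "\<phi> \<in> Sigma_fm k" for \<phi>
  proof -
    obtain n where n: "FV \<phi> \<subseteq> {..<n}" by (rule FV_bounded)
    then have "deriv T [] ((Forall ^^ n) (Impl (Neg (Neg \<phi>)) \<phi>))"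
      using * \<phi> unfolding proves_all_def DNE_def proves_def by blast
    from Forall_power_elim_closed[OF this, of Var] n show ?thesis
      by (simp add: stable_def entails_iff_theorem proves_def)
  qed
  then show "stable_Sigma T k" by (simp add: stable_Sigma_def)
next
  assume "stable_Sigma T k"
  then have "deriv T [] (Impl (Neg (Neg \<phi>)) \<phi>)" if "\<phi> \<in> Sigma_fm k" for \<phi>
    using that by (simp add: stable_Sigma_def stable_def entails_iff_theorem proves_def)
  then have "deriv T \<Gamma> (Impl (Neg (Neg \<phi>)) \<phi>)" if "\<phi> \<in> Sigma_fm k" for \<phi> \<Gamma>
    using deriv_weaken[of T "[]"] that by simp
  then show "T \<turnstile>\<^sub>S DNE (Sigma_fm k)"
    by (auto simp: proves_all_def DNE_def proves_def intro: Forall_power_intro)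
qed

lemma proves_LEM_decidable:
  assumes "T \<turnstile>\<^sub>S LEM C" "\<phi> \<in> C"
  shows "decidable T \<phi>"
proof -
  obtain n where n: "FV \<phi> \<subseteq> {..<n}" by (rule FV_bounded)
  then have "deriv T [] ((Forall ^^ n) (Disj \<phi> (Neg \<phi>)))"
    using assms unfolding proves_all_def LEM_def proves_def by blast
  from Forall_power_elim_closed[OF this, of Var] n show ?thesis
    by (simp add: decidable_def)
qed

lemma stable_Sigma_antimono: "stable_Sigma T k \<Longrightarrow> j \<le> k \<Longrightarrow> stable_Sigma T j"
  using Sigma_mono by (fastforce simp: stable_Sigma_def)

text \<open>The rung of the ladder shared by both parts. Normal forms are requested only where the
  paths have exact length, so that the hypothesis on the exact classes applies, and may have any
  level \<open>m\<close>.\<close>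

lemma (in arith) stable_Sigma_Suc:
  assumes PA: "theorems T \<subseteq> theorems PA"
    and st: "stable_Sigma T k"
    and Pi: "\<And>\<phi>. \<phi> \<in> Pi_fm k \<Longrightarrow> decidable T \<phi>"
    and nf: "\<And>\<phi>. fm_wf \<phi> \<Longrightarrow> disj_free \<phi> \<Longrightarrow> Alt \<phi> = {alt_path (Suc k) Plus} \<Longrightarrow>
      \<exists>m. \<exists>\<psi> \<in> Sigma_fm m \<union> Pi_fm m. eqv T (Neg (Neg \<phi>)) \<psi>"
  shows "stable_Sigma T (Suc k)"
  unfolding stable_Sigma_def
proof
  fix \<phi> assume \<phi>: "\<phi> \<in> Sigma_fm (Suc k)"
  then obtain \<phi>' where \<phi>': "disj_free \<phi>'" "Alt \<phi>' = {alt_path (Suc k) Plus}" "eqv T \<phi> \<phi>'"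
    using prenex_exact_degree by blast
  obtain m \<psi> where \<psi>: "\<psi> \<in> Sigma_fm m \<union> Pi_fm m" "eqv T (Neg (Neg \<phi>')) \<psi>"
    using nf[OF _ \<phi>'(1,2)] eqv_wf[OF \<phi>'(3)] by blast
  have "eqv T (Neg (Neg \<phi>)) (Neg (Neg \<phi>'))"
    using \<phi>'(3) by (simp add: eqv_Impl eqv_refl)
  from eqv_trans[OF this \<psi>(2)] have *: "entails T (Neg (Neg \<phi>)) \<psi>" "entails T \<psi> (Neg (Neg \<phi>))"
    by (simp_all add: eqv_def)
  \<comment> \<open>This fact passes up to \<open>PA\<close> only to come back to \<open>T\<close>
    strengthened, with the double negation gone.\<close>
  have "PA \<turnstile> Impl \<psi> (Neg (Neg \<phi>))"
    using PA *(2) by (auto simp: entails_iff_theorem theorems_def)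
  moreover have "decidable_level T k"
    using st Pi stable_Sigma_antimono by (blast intro: decidable_levelI)
  ultimately have "entails T \<psi> \<phi>"
    using PA_conservative \<phi> \<psi>(1) by blast
  then show "stable T \<phi>" unfolding stable_def by (rule entails_trans[OF *(1)])
qed

lemma HA_wf: "\<phi> \<in> HA \<Longrightarrow> fm_wf \<phi>"
proof (induction rule: HA.induct)
  case (induction_ax \<phi>)
  have "fm_wf (subst (case_nat (succ (Var 0)) (\<lambda>i. Var (Suc i))) \<phi>) = fm_wf \<phi>"
    by (rule fm_wf_subst) (simp split: nat.split)
  then show ?case using induction_ax by simp
qed auto

lemma in_between_arith:
  assumes "in_between S T PA" "HA \<subseteq> S"
  shows "arith T"
proof
  fix \<phi> assume "\<phi> \<in> HA"
  then have "\<phi> \<in> theorems S"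
    using assms(2) HA_wf by (auto simp: theorems_def proves_def intro: deriv.Axiom)
  then show "deriv T [] \<phi>" using assms(1) by (auto simp: in_between_def theorems_def proves_def)
qed

lemma in_between_LEM:
  assumes "in_between (HA \<union> LEM (Pi_fm k)) T PA" "\<phi> \<in> Pi_fm k"
  shows "decidable T \<phi>"
proof (rule proves_LEM_decidable[OF _ assms(2)])
  have "LEM (Pi_fm k) \<subseteq> theorems (HA \<union> LEM (Pi_fm k))"
    by (auto simp: theorems_def proves_def LEM_def Pi_wf intro!: deriv.Axiom)
  then show "T \<turnstile>\<^sub>S LEM (Pi_fm k)"
    using assms(1) by (auto simp: in_between_def theorems_def proves_all_def)
qed

text \<open>Subtraction on \<open>nat\<close> truncates, so the disjunct \<open>k = 0\<close> makes
  DNE at level -1 vacuous.\<close>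

theorem theorem7p17:
  fixes k :: nat
  shows "(\<forall>T. in_between (if k = 0 then HA else HA \<union> LEM (Pi_fm (k - 1))) T PA \<longrightarrow>
            (T \<turnstile>\<^sub>S DNE (Sigma_fm k) \<longleftrightarrow>
              (\<forall>k' \<le> k. PNFT T (disj_free_part (E_class k')) (Sigma_fm k'))))
       \<and> (\<forall>T. in_between (if k < 2 then HA else HA \<union> LEM (Pi_fm (k - 2))) T PA \<longrightarrow>
            ((k = 0 \<or> T \<turnstile>\<^sub>S DNE (Sigma_fm (k - 1))) \<longleftrightarrow>
              (\<forall>k' \<le> k. PNFT T (disj_free_part (U_class k')) (Pi_fm k'))))"
proof (intro conjI allI impI)
  fix T assume T: "in_between (if k = 0 then HA else HA \<union> LEM (Pi_fm (k - 1))) T PA"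
  interpret arith T by (rule in_between_arith[OF T]) simp
  have PA: "theorems T \<subseteq> theorems PA" using T by (simp add: in_between_def)
  have dec: "decidable T \<phi>" if "j < k" "\<phi> \<in> Pi_fm j" for j \<phi>
  proof (rule in_between_LEM)
    show "in_between (HA \<union> LEM (Pi_fm (k - 1))) T PA" using T that(1) by simp
    have "j \<le> k - 1" using that(1) by simp
    then show "\<phi> \<in> Pi_fm (k - 1)" using Pi_mono that(2) by blast
  qed
  show "T \<turnstile>\<^sub>S DNE (Sigma_fm k) \<longleftrightarrow> (\<forall>k' \<le> k. PNFT T (disj_free_part (E_class k')) (Sigma_fm k'))"
    unfolding proves_DNE_Sigma_iff
  proof
    assume st: "stable_Sigma T k"
    show "\<forall>k' \<le> k. PNFT T (disj_free_part (E_class k')) (Sigma_fm k')"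
    proof (intro allI impI)
      fix k' assume "k' \<le> k"
      then have st': "\<forall>j \<le> k'. stable_Sigma T j" using stable_Sigma_antimono[OF st] by auto
      have "\<exists>\<psi> \<in> Sigma_fm k'. FV \<phi> = FV \<psi> \<and> T \<turnstile> Iff \<phi> \<psi>"
        if e: "\<phi> \<in> E_class k'" and d: "disj_free \<phi>" for \<phi>
      proof -
        have "\<forall>j < k'. stable_Sigma T j" "stable_Sigma T k'" using st' by auto
        then obtain \<psi> where "\<psi> \<in> Sigma_fm k'" "FV \<psi> = FV \<phi>" "eqv T \<phi> \<psi>"
          using disj_free_prenex[OF d E_class_wf[OF e]] E_class_paths_within[OF e] by blast
        then show ?thesis unfolding eqv_iff_theorem by (intro bexI[of _ \<psi>]) simp_all
      qed
      then show "PNFT T (disj_free_part (E_class k')) (Sigma_fm k')"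
        by (simp add: PNFT_def disj_free_part_def)
    qed
  next
    assume nf: "\<forall>k' \<le> k. PNFT T (disj_free_part (E_class k')) (Sigma_fm k')"
    \<comment> \<open>Going from \<open>j\<close> to \<open>Suc j\<close> uses LEM(Pi_j) with
      \<open>j < k\<close>, which LEM(Pi_(k-1)) covers.\<close>
    have "j \<le> k \<Longrightarrow> stable_Sigma T j" for j
    proof (induction j)
      case 0
      show ?case by (rule stable_Sigma_0)
    next
      case (Suc j)
      show ?case
      proof (rule stable_Sigma_Suc[OF PA])
        fix \<phi> assume \<phi>: "fm_wf \<phi>" "disj_free \<phi>" "Alt \<phi> = {alt_path (Suc j) Plus}"
        \<comment> \<open>Two negations restore all signs, so the class and the exact degree are
          unchanged.\<close>
        then have "Neg (Neg \<phi>) \<in> disj_free_part (E_class (Suc j))"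
          using singleton_Alt_E_class[OF _ Alt_NegNeg]
          by (simp add: disj_free_part_def del: E_class.simps)
        then show "\<exists>m. \<exists>\<psi> \<in> Sigma_fm m \<union> Pi_fm m. eqv T (Neg (Neg \<phi>)) \<psi>"
          using nf Suc.prems unfolding PNFT_def eqv_iff_theorem by blast
      qed (use Suc dec[of j] in auto)
    qed
    then show "stable_Sigma T k" by simp
  qed
next
  fix T assume T: "in_between (if k < 2 then HA else HA \<union> LEM (Pi_fm (k - 2))) T PA"
  interpret arith T by (rule in_between_arith[OF T]) simp
  have PA: "theorems T \<subseteq> theorems PA" using T by (simp add: in_between_def)
  have dec: "decidable T \<phi>" if "Suc j < k" "\<phi> \<in> Pi_fm j" for j \<phi>
  proof (rule in_between_LEM)
    show "in_between (HA \<union> LEM (Pi_fm (k - 2))) T PA" using T that(1) by simp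
    have "j \<le> k - 2" using that(1) by simp
    then show "\<phi> \<in> Pi_fm (k - 2)" using Pi_mono that(2) by blast
  qed
  show "(k = 0 \<or> T \<turnstile>\<^sub>S DNE (Sigma_fm (k - 1))) \<longleftrightarrow>
      (\<forall>k' \<le> k. PNFT T (disj_free_part (U_class k')) (Pi_fm k'))"
    unfolding proves_DNE_Sigma_iff
  proof
    assume st: "k = 0 \<or> stable_Sigma T (k - 1)"
    show "\<forall>k' \<le> k. PNFT T (disj_free_part (U_class k')) (Pi_fm k')"
    proof (intro allI impI)
      fix k' assume "k' \<le> k"
      \<comment> \<open>The Pi half of the normal form theorem needs DNE strictly below
        \<open>k'\<close> only, which accounts for the index \<open>k - 1\<close>.\<close>
      then have st': "\<forall>j < k'. stable_Sigma T j" using st stable_Sigma_antimono[of T "k - 1"] by auto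
      have "\<exists>\<psi> \<in> Pi_fm k'. FV \<phi> = FV \<psi> \<and> T \<turnstile> Iff \<phi> \<psi>"
        if e: "\<phi> \<in> U_class k'" and d: "disj_free \<phi>" for \<phi>
      proof -
        from st' obtain \<psi> where "\<psi> \<in> Pi_fm k'" "FV \<psi> = FV \<phi>" "eqv T \<phi> \<psi>"
          using disj_free_prenex[OF d U_class_wf[OF e]] U_class_paths_within[OF e] by blast
        then show ?thesis unfolding eqv_iff_theorem by (intro bexI[of _ \<psi>]) simp_all
      qed
      then show "PNFT T (disj_free_part (U_class k')) (Pi_fm k')"
        by (simp add: PNFT_def disj_free_part_def)
    qed
  next
    assume nf: "\<forall>k' \<le> k. PNFT T (disj_free_part (U_class k')) (Pi_fm k')"
    have "j < k \<Longrightarrow> stable_Sigma T j" for j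
    proof (induction j)
      case 0
      show ?case by (rule stable_Sigma_0)
    next
      case (Suc j)
      show ?case
      proof (rule stable_Sigma_Suc[OF PA])
        fix \<phi> assume \<phi>: "fm_wf \<phi>" "disj_free \<phi>" "Alt \<phi> = {alt_path (Suc j) Plus}"
        \<comment> \<open>A dummy \<forall> lifts the double negation from E at level
          \<open>Suc j\<close> to U at level \<open>Suc (Suc j)\<close>, still at most
          \<open>k\<close> because \<open>Suc j < k\<close>.\<close>
        let ?\<chi> = "Forall (shift (Neg (Neg \<phi>)))"
        have "Alt ?\<chi> = {alt_path (Suc (Suc j)) Minus}"
          using Alt_Forall_power[of "shift (Neg (Neg \<phi>))" "Suc j" 0] Alt_NegNeg[OF \<phi>(3)]
          by (simp del: shift_simps Alt.simps)
        then have "?\<chi> \<in> disj_free_part (U_class (Suc (Suc j)))"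
          using singleton_Alt_U_class[of ?\<chi>] \<phi>
          by (simp add: disj_free_part_def del: U_class.simps Alt.simps)
        then obtain \<psi> where "\<psi> \<in> Pi_fm (Suc (Suc j))" "eqv T ?\<chi> \<psi>"
          using nf Suc.prems unfolding PNFT_def eqv_iff_theorem by (meson Suc_leI)
        then show "\<exists>m. \<exists>\<psi> \<in> Sigma_fm m \<union> Pi_fm m. eqv T (Neg (Neg \<phi>)) \<psi>"
          using eqv_trans[OF eqv_Forall_shift[of "Neg (Neg \<phi>)" T]] \<phi>(1) fm_wf.simps(1,5) by blast
      qed (use Suc dec[of j] in auto)
    qed
    then show "k = 0 \<or> stable_Sigma T (k - 1)" by (cases k) simp_all
  qed
qed

end
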